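(* Suppose $0<p\le q<\infty$, $\alpha$ is real, and $\mu$ is a positive Borel measure on $\mathbb B_n$. Then for any nonnegative integer $k$ with $\alpha+kp>-1$ the following conditions are equivalent. (a) There is a constant $C>0$ such that $$\int_{\mathbb B_n}|R^kf(w)|^q\,d\mu(w)\le C\|f\|_{p,\alpha}^q$$ for all $f\in A^p_\alpha$. (b) For each (or some) $s>0$ there is a constant $C>0$ such that $$\int_{\mathbb B_n}\frac{(1-|z|^2)^s}{|1-\langle z,w\rangle|^{s+(n+1+\alpha+kp)q/p}}\,d\mu(w)\le C$$ for all $z\in\mathbb B_n$. (c) There is a constant $C>0$ such that $$\mu(Q_r(\zeta))\le Cr^{(n+1+\alpha+kp)q/p}$$ for all $r>0$ and $\zeta\in\mathbb S_n$. (d) For each (or some) $R>0$ there exists a constant $C>0$ such that $$\mu(D(a,R))\le C(1-|a|^2)^{(n+1+\alpha+kp)q/p}$$ for all $a\in\mathbb B_n$.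
   Context: Fix a positive integer $n$. $\mathbb B_n$ is the open unit ball of $\mathbb C^n$, $\mathbb S_n$ the unit sphere, $\langle z,w\rangle=\sum_j z_j\overline{w_j}$, $dv$ is volume measure, and $dv_\alpha(z)=(1-|z|^2)^\alpha dv(z)$ for real $\alpha$ (normalized to be a probability measure when $\alpha>-1$). For $\zeta\in\mathbb S_n$ and $r>0$, $Q_r(\zeta)=\{z\in\mathbb B_n:|1-\langle z,\zeta\rangle|<r\}$. For $a\in\mathbb B_n$ and a radius $R>0$, $D(a,R)=\{z\in\mathbb B_n:\beta(z,a)<R\}$, where $\beta$ is the distance in the Bergman metric of $\mathbb B_n$. In expressions such as $R^kf$, $R$ denotes the radial derivative operator $Rf(z)=\sum_{j=1}^n z_j\frac{\partial f}{\partial z_j}(z)$, $R^k$ is its $k$-fold iterate, and $R^0f=f$. For $p>0$ and real $\alpha$, $A^p_\alpha$ is the space of holomorphic $f$ in $\mathbb B_n$ such that, for a nonnegative integer $k$ with $pk+\alpha>-1$, the function $(1-|z|^2)^kR^kf(z)$ is in $L^p(\mathbb B_n,dv_\alpha)$ (the space does not depend on the choice of such $k$). With $N$ the smallest nonnegative integer such that $pN+\alpha>-1$, $$\|f\|_{p,\alpha}=|f(0)|+\left[\int_{\mathbb B_n}(1-|z|^2)^{pN}|R^Nf(z)|^p\,dv_\alpha(z)\right]^{1/p}.$$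
   Formalization: For k > 0, μ is additionally assumed finite on some ball of radius less than 1 about the origin; otherwise the claim fails, since R^k f(0) = 0 makes an infinite point mass at 0 satisfy (a) but not (b), (c) or (d). *)

theory Defs
  imports "HOL-Analysis.Analysis"
begin

type_synonym 'n cvec = "(complex, 'n) vec"

abbreviation unit_ball :: "('n::finite) cvec set"
  where "unit_ball \<equiv> ball 0 1"

definition herm :: "('n::finite) cvec \<Rightarrow> 'n cvec \<Rightarrow> complex"
  where "herm z w = (\<Sum>j\<in>UNIV. z $ j * cnj (w $ j))"


section \<open>Holomorphic functions of several variables and the radial derivative\<close>

definition holomorphic_vec_on :: "(('n::finite) cvec \<Rightarrow> complex) \<Rightarrow> 'n cvec set \<Rightarrow> bool"
    (infixl \<open>holomorphic'_vec'_on\<close> 50)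
  where "f holomorphic_vec_on S \<longleftrightarrow>
    (\<forall>z\<in>S. \<exists>D. (f has_derivative D) (at z) \<and> (\<forall>c x. D (c *s x) = c * D x))"

definition cpartial :: "'n \<Rightarrow> (('n::finite) cvec \<Rightarrow> complex) \<Rightarrow> 'n cvec \<Rightarrow> complex"
  where "cpartial j f z = deriv (\<lambda>c. f (z + axis j c)) 0"

definition radial_deriv :: "(('n::finite) cvec \<Rightarrow> complex) \<Rightarrow> 'n cvec \<Rightarrow> complex"
  where "radial_deriv f z = (\<Sum>j\<in>UNIV. z $ j * cpartial j f z)"


section \<open>Weighted volume measures and Bergman spaces\<close>

text \<open>The unnormalized measure is infinite for \<open>\<alpha> \<le> -1\<close>; it is normalized to be a
  probability measure only when \<open>\<alpha> > -1\<close>.\<close>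

definition weighted_volume_raw :: "real \<Rightarrow> ('n::finite) cvec measure"
  where "weighted_volume_raw \<alpha> =
    density (restrict_space lborel unit_ball) (\<lambda>z. ennreal ((1 - (norm z)\<^sup>2) powr \<alpha>))"

definition weighted_volume :: "real \<Rightarrow> ('n::finite) cvec measure"
  where "weighted_volume \<alpha> =
    (if \<alpha> > -1
     then scale_measure (1 / emeasure (weighted_volume_raw \<alpha> :: 'n cvec measure) unit_ball)
            (weighted_volume_raw \<alpha>)
     else weighted_volume_raw \<alpha>)"

definition bergman_space :: "real \<Rightarrow> real \<Rightarrow> (('n::finite) cvec \<Rightarrow> complex) set"
  where "bergman_space p \<alpha> =
    {f. f holomorphic_vec_on unit_ball \<and>
        (\<exists>k::nat. p * real k + \<alpha> > -1 \<and>
          (\<integral>\<^sup>+ z. ennreal (((1 - (norm z)\<^sup>2) ^ k * cmod ((radial_deriv ^^ k) f z)) powr p)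
             \<partial>weighted_volume \<alpha>) < \<infinity>)}"

text \<open>Real powers in \<open>[0, \<infinity>]\<close>, used only for positive exponents, so that \<open>\<infinity>\<close> has power \<open>\<infinity>\<close>.
  The quasi-norm takes values in \<open>[0, \<infinity>]\<close> to avoid a junk real value when the integral diverges
  (which does not happen for members of the Bergman space).\<close>

definition ennreal_powr :: "ennreal \<Rightarrow> real \<Rightarrow> ennreal"
  where "ennreal_powr x a = (if x = \<infinity> then \<infinity> else ennreal (enn2real x powr a))"

definition bergman_index :: "real \<Rightarrow> real \<Rightarrow> nat"
  where "bergman_index p \<alpha> = (LEAST N. p * real N + \<alpha> > -1)"

definition bergman_norm :: "real \<Rightarrow> real \<Rightarrow> (('n::finite) cvec \<Rightarrow> complex) \<Rightarrow> ennreal"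
  where "bergman_norm p \<alpha> f =
    (let N = bergman_index p \<alpha> in
      ennreal (cmod (f 0)) +
      ennreal_powr
        (\<integral>\<^sup>+ z. ennreal ((1 - (norm z)\<^sup>2) powr (p * real N) *
                        cmod ((radial_deriv ^^ N) f z) powr p) \<partial>weighted_volume \<alpha>)
        (1 / p))"


section \<open>The Bergman metric\<close>

definition bergman_kernel :: "('n::finite) cvec \<Rightarrow> 'n cvec \<Rightarrow> complex"
  where "bergman_kernel z w = 1 / (1 - herm z w) ^ (CARD('n) + 1)"

text \<open>The Wirtinger derivatives \<open>\<partial>/\<partial>z\<^sub>j\<close> and \<open>\<partial>/\<partial>z\<^sub>j\<close>-bar of a function that
  need only be real differentiable.\<close>

definition wirtinger :: "'n \<Rightarrow> (('n::finite) cvec \<Rightarrow> complex) \<Rightarrow> 'n cvec \<Rightarrow> complex"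
  where "wirtinger j u z =
    (vector_derivative (\<lambda>t. u (z + axis j (of_real t))) (at 0) -
     \<i> * vector_derivative (\<lambda>t. u (z + axis j (of_real t * \<i>))) (at 0)) / 2"

definition wirtinger_bar :: "'n \<Rightarrow> (('n::finite) cvec \<Rightarrow> complex) \<Rightarrow> 'n cvec \<Rightarrow> complex"
  where "wirtinger_bar j u z =
    (vector_derivative (\<lambda>t. u (z + axis j (of_real t))) (at 0) +
     \<i> * vector_derivative (\<lambda>t. u (z + axis j (of_real t * \<i>))) (at 0)) / 2"

definition bergman_matrix :: "('n::finite) cvec \<Rightarrow> 'n \<Rightarrow> 'n \<Rightarrow> complex"
  where "bergman_matrix z i j =
    wirtinger i (wirtinger_bar j (\<lambda>w. Ln (bergman_kernel w w))) z / of_nat (CARD('n) + 1)"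

definition bergman_form :: "('n::finite) cvec \<Rightarrow> 'n cvec \<Rightarrow> real"
  where "bergman_form z \<xi> =
    Re (\<Sum>i\<in>UNIV. \<Sum>j\<in>UNIV. bergman_matrix z i j * \<xi> $ i * cnj (\<xi> $ j))"

text \<open>The length integral is required to exist: a \<^const>\<open>valid_path\<close> may have an unbounded
  derivative and infinite length, in which case \<^const>\<open>integral\<close> would return 0.\<close>

definition bergman_dist :: "('n::finite) cvec \<Rightarrow> 'n cvec \<Rightarrow> real"
  where "bergman_dist z w =
    Inf {L. \<exists>\<gamma>. valid_path \<gamma> \<and> path_image \<gamma> \<subseteq> unit_ball \<and> pathstart \<gamma> = z \<and> pathfinish \<gamma> = w \<and>
           ((\<lambda>t. sqrt (bergman_form (\<gamma> t) (vector_derivative \<gamma> (at t)))) has_integral L) {0..1}}"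

definition bergman_ball :: "('n::finite) cvec \<Rightarrow> real \<Rightarrow> 'n cvec set"
  where "bergman_ball a r = {z\<in>unit_ball. bergman_dist z a < r}"

definition carleson_tube :: "('n::finite) cvec \<Rightarrow> real \<Rightarrow> 'n cvec set"
  where "carleson_tube \<zeta> r = {z\<in>unit_ball. cmod (1 - herm z \<zeta>) < r}"


section \<open>The explicit form of the Bergman metric\<close>

text \<open>On the ball the matrix of second derivatives of \<open>log K(z,z)\<close> gives the classical Hermitian form
  of \<open>bergman_form_eq\<close>.\<close>

lemma herm_self: "herm z z = of_real ((norm z)\<^sup>2)"
  for z :: "('n::finite) cvec"
  unfolding herm_def norm_vec_def L2_set_def
  by (simp add: sum_nonneg complex_norm_square [symmetric] of_real_sum)

lemma log_kernel:
  fixes w :: "('n::finite) cvec" assumes "norm w < 1"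
  shows "Ln (bergman_kernel w w) = of_real (- real (CARD('n) + 1) * ln (1 - (norm w)\<^sup>2))"
proof -
  have p: "1 - (norm w)\<^sup>2 > 0" using assms by (simp add: abs_square_less_1)
  have "bergman_kernel w w = of_real (1 / (1 - (norm w)\<^sup>2) ^ (CARD('n) + 1))"
    by (simp add: bergman_kernel_def herm_self)
  also have "Ln \<dots> = of_real (ln (1 / (1 - (norm w)\<^sup>2) ^ (CARD('n) + 1)))"
    using p by (intro Ln_of_real) (simp add: zero_less_power)
  also have "ln (1 / (1 - (norm w)\<^sup>2) ^ (CARD('n) + 1)) = - real (CARD('n) + 1) * ln (1 - (norm w)\<^sup>2)"
    using p by (simp only: ln_div zero_less_power ln_realpow zero_less_one ln_one) (simp add: ln_mult ln_realpow algebra_simps)?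
  finally show ?thesis .
qed

lemma norm_axis_complex: "norm (axis j c :: ('n::finite) cvec) = cmod c"
proof -
  have "axis j c \<bullet> axis j c = c \<bullet> c" by (subst inner_axis) simp
  thus ?thesis by (simp only: norm_eq_sqrt_inner)
qed

lemma norm_add_axis_squared: "(norm (z + axis j c))\<^sup>2 = (norm z)\<^sup>2 + 2 * Re (cnj (z$j) * c) + (cmod c)\<^sup>2"
  for z :: "('n::finite) cvec"
proof -
  have "(norm (axis j c :: 'n cvec)) = cmod c" by (simp add: norm_axis_complex)
  moreover have "z \<bullet> axis j c = Re (cnj (z$j) * c)"
    by (simp add: inner_axis inner_complex_def)
  ultimately show ?thesis by (simp add: power2_norm_eq_inner algebra_simps inner_commute)
       (simp add: power2_norm_eq_inner[symmetric])
qed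

lemma eventually_add_axis_in_ball:
  fixes z :: "('n::finite) cvec" assumes "norm z < 1" "\<And>t. norm (c t) = \<bar>t\<bar>"
  shows "\<forall>\<^sub>F t in nhds 0. norm (z + axis j (c t)) < 1"
  unfolding eventually_nhds_metric
proof (intro exI[of _ "1 - norm z"] conjI allI impI)
  fix t :: real assume "dist t 0 < 1 - norm z"
  moreover have "norm (z + axis j (c t)) \<le> norm z + \<bar>t\<bar>"
    using norm_triangle_ineq[of z "axis j (c t)"] assms(2)[of t] by (simp add: norm_axis_complex)
  ultimately show "norm (z + axis j (c t)) < 1" by simp
qed (use assms in simp)

lemma vector_derivative_log_kernel:
  fixes z :: "('n::finite) cvec" and c :: "real \<Rightarrow> complex" assumes "norm z < 1"
   and c: "c = (\<lambda>t. of_real t * d)" "cmod d = 1"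
  shows "vector_derivative (\<lambda>t. Ln (bergman_kernel (z + axis j (c t)) (z + axis j (c t)))) (at 0)
     = of_real (real (CARD('n) + 1) * 2 * Re (cnj (z$j) * d) / (1 - (norm z)\<^sup>2))"
proof (rule vector_derivative_at)
  have p: "1 - (norm z)\<^sup>2 > 0" using assms by (simp add: abs_square_less_1)
  have ev: "\<forall>\<^sub>F t in nhds 0. norm (z + axis j (c t)) < 1"
    by (rule eventually_add_axis_in_ball) (use assms in \<open>auto simp: norm_mult\<close>)
  define r where "r = 1 - (norm z)\<^sup>2"
  define b where "b = Re (cnj (z$j) * d)"
  define K where "K = real (CARD('n) + 1)"
  have "r > 0" using p by (simp add: r_def)
  hence "((\<lambda>t. - K * ln (r - 2 * t * b - t\<^sup>2)) has_field_derivative K * 2 * b / r) (at 0)"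
    by (auto intro!: derivative_eq_intros simp: field_simps)
  hence "((\<lambda>t. - real (CARD('n) + 1) * ln (1 - ((norm z)\<^sup>2 + 2 * t * Re (cnj (z$j) * d) + t\<^sup>2)))
     has_field_derivative (real (CARD('n) + 1) * 2 * Re (cnj (z$j) * d) / (1 - (norm z)\<^sup>2))) (at 0)"
    unfolding r_def b_def K_def by (simp only: diff_diff_eq add.assoc)
  hence "((\<lambda>t. of_real (- real (CARD('n) + 1) * ln (1 - ((norm z)\<^sup>2 + 2 * t * Re (cnj (z$j) * d) + t\<^sup>2))) :: complex)
     has_vector_derivative of_real (real (CARD('n) + 1) * 2 * Re (cnj (z$j) * d) / (1 - (norm z)\<^sup>2))) (at 0)"
    by (rule has_vector_derivative_of_real)
  moreover have "\<forall>\<^sub>F t in nhds 0. of_real (- real (CARD('n) + 1) * ln (1 - ((norm z)\<^sup>2 + 2 * t * Re (cnj (z$j) * d) + t\<^sup>2))) = Ln (bergman_kernel (z + axis j (c t)) (z + axis j (c t)))"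
    using ev
  proof eventually_elim
    case (elim t)
    have "(norm (z + axis j (c t)))\<^sup>2 = (norm z)\<^sup>2 + 2 * t * Re (cnj (z$j) * d) + t\<^sup>2"
      unfolding norm_add_axis_squared c(1) using c(2) by (simp add: norm_mult algebra_simps)
    thus ?case using log_kernel[OF elim] by simp
  qed
  ultimately show "((\<lambda>t. Ln (bergman_kernel (z + axis j (c t)) (z + axis j (c t)))) has_vector_derivative
    of_real (real (CARD('n) + 1) * 2 * Re (cnj (z$j) * d) / (1 - (norm z)\<^sup>2))) (at 0)"
    by (subst (asm) has_vector_derivative_cong_ev) (auto elim: eventually_mono dest: eventually_nhds_x_imp_x)
qed

lemma wirtinger_bar_log_kernel:
  fixes z :: "('n::finite) cvec" assumes "norm z < 1"
  shows "wirtinger_bar j (\<lambda>w. Ln (bergman_kernel w w)) z = of_nat (CARD('n) + 1) * z$j / of_real (1 - (norm z)\<^sup>2)"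
proof -
  have 1: "vector_derivative (\<lambda>t. Ln (bergman_kernel (z + axis j (of_real t)) (z + axis j (of_real t)))) (at 0)
     = of_real (real (CARD('n) + 1) * 2 * Re (z$j) / (1 - (norm z)\<^sup>2))"
    using vector_derivative_log_kernel[OF assms, of "of_real" 1 j] by (simp add: fun_eq_iff)
  have 2: "vector_derivative (\<lambda>t. Ln (bergman_kernel (z + axis j (of_real t * \<i>)) (z + axis j (of_real t * \<i>)))) (at 0)
     = of_real (real (CARD('n) + 1) * 2 * Im (z$j) / (1 - (norm z)\<^sup>2))"
    using vector_derivative_log_kernel[OF assms, of "\<lambda>t. of_real t * \<i>" \<i> j] by simp
  define r where "r = 1 - (norm z)\<^sup>2"
  define K where "K = real (CARD('n) + 1)"
  have "z$j = of_real (Re (z$j)) + \<i> * of_real (Im (z$j))" by (simp add: complex_eq_iff)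
  moreover have "(of_real (K * 2 * x / r) + \<i> * of_real (K * 2 * y / r)) / 2 =
     of_real K * (of_real x + \<i> * of_real y) / of_real r" for x y
    by (simp add: add_divide_distrib distrib_left)
  moreover have "(of_nat (CARD('n) + 1) :: complex) = of_real K" by (simp add: K_def)
  ultimately show ?thesis unfolding wirtinger_bar_def 1 2 r_def[symmetric] K_def[symmetric]
    by (metis (no_types, lifting))
qed

lemma vector_derivative_wirtinger_bar_log_kernel:
  fixes z :: "('n::finite) cvec" and c :: "real \<Rightarrow> complex" assumes "norm z < 1"
   and c: "c = (\<lambda>t. of_real t * d)" "cmod d = 1"
  shows "vector_derivative (\<lambda>t. wirtinger_bar j (\<lambda>w. Ln (bergman_kernel w w)) (z + axis i (c t))) (at 0)
     = of_nat (CARD('n) + 1) * ((if i = j then d else 0) / of_real (1 - (norm z)\<^sup>2) 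
        + z$j * of_real (2 * Re (cnj (z$i) * d)) / of_real ((1 - (norm z)\<^sup>2)\<^sup>2))"
    (is "_ = ?D")
proof (rule vector_derivative_at)
  have p: "1 - (norm z)\<^sup>2 > 0" using assms by (simp add: abs_square_less_1)
  have ev: "\<forall>\<^sub>F t in nhds 0. norm (z + axis i (c t)) < 1"
    by (rule eventually_add_axis_in_ball) (use assms in \<open>auto simp: norm_mult\<close>)
  define r where "r = complex_of_real (1 - (norm z)\<^sup>2)"
  define e where "e = (if i = j then d else 0)"
  define b where "b = complex_of_real (2 * Re (cnj (z$i) * d))"
  define K where "K = complex_of_nat (CARD('n) + 1)"
  define g where "g = (\<lambda>t. K * (z$j + t * e) / (r - t * b - t\<^sup>2))"
  have nz: "r \<noteq> 0" using p unfolding r_def by (metis of_real_eq_0_iff less_irrefl)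
  have "(g has_field_derivative K * (e / r + z$j * b / r\<^sup>2)) (at 0)"
    unfolding g_def using nz
    by (auto intro!: derivative_eq_intros simp: field_simps power2_eq_square)
  hence "(g has_field_derivative ?D) (at 0)"
    unfolding r_def e_def b_def K_def by (simp only: of_real_power)
  hence "((\<lambda>t. g (of_real t)) has_vector_derivative ?D) (at 0)"
    by (metis has_vector_derivative_real_field of_real_0)
  moreover have "\<forall>\<^sub>F t in nhds 0. g (of_real t) = wirtinger_bar j (\<lambda>w. Ln (bergman_kernel w w)) (z + axis i (c t))"
    using ev
  proof eventually_elim
    case (elim t)
    have "(norm (z + axis i (c t)))\<^sup>2 = (norm z)\<^sup>2 + 2 * t * Re (cnj (z$i) * d) + t\<^sup>2"
      unfolding norm_add_axis_squared c(1) using c(2) by (simp add: norm_mult algebra_simps)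
    thus ?case unfolding wirtinger_bar_log_kernel[OF elim] g_def r_def e_def b_def K_def by (simp add: c axis_def algebra_simps)
  qed
  ultimately show "((\<lambda>t. wirtinger_bar j (\<lambda>w. Ln (bergman_kernel w w)) (z + axis i (c t))) has_vector_derivative ?D) (at 0)"
    by (subst (asm) has_vector_derivative_cong_ev) (auto elim: eventually_mono dest: eventually_nhds_x_imp_x)
qed

lemma bergman_matrix_eq:
  fixes z :: "('n::finite) cvec" assumes "norm z < 1"
  shows "bergman_matrix z i j = (of_real (1 - (norm z)\<^sup>2) * (if i = j then 1 else 0) + cnj (z$i) * z$j) / of_real ((1 - (norm z)\<^sup>2)\<^sup>2)"
proof -
  have "1 - (norm z)\<^sup>2 > 0" using assms by (simp add: abs_square_less_1)
  hence nz: "complex_of_real (1 - (norm z)\<^sup>2) \<noteq> 0"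
    by (metis of_real_eq_0_iff less_irrefl)
  have n2: "of_nat (CARD('n) + 1) \<noteq> (0::complex)" using of_nat_neq_0[of "CARD('n)"] by simp
  have 1: "vector_derivative (\<lambda>t. wirtinger_bar j (\<lambda>w. Ln (bergman_kernel w w)) (z + axis i (of_real t))) (at 0)
    = of_nat (CARD('n) + 1) * ((if i = j then 1 else 0) / of_real (1 - (norm z)\<^sup>2) 
        + z$j * of_real (2 * Re (z$i)) / of_real ((1 - (norm z)\<^sup>2)\<^sup>2))"
    using vector_derivative_wirtinger_bar_log_kernel[OF assms, of "of_real" 1 j i] by (simp add: fun_eq_iff)
  have 2: "vector_derivative (\<lambda>t. wirtinger_bar j (\<lambda>w. Ln (bergman_kernel w w)) (z + axis i (of_real t * \<i>))) (at 0)
    = of_nat (CARD('n) + 1) * ((if i = j then \<i> else 0) / of_real (1 - (norm z)\<^sup>2) 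
        + z$j * of_real (2 * Im (z$i)) / of_real ((1 - (norm z)\<^sup>2)\<^sup>2))"
    using vector_derivative_wirtinger_bar_log_kernel[OF assms, of "\<lambda>t. of_real t * \<i>" \<i> j i] by simp
  have c: "cnj (z$i) = of_real (Re (z$i)) - \<i> * of_real (Im (z$i))" by (simp add: complex_eq_iff)
  define r where "r = complex_of_real (1 - (norm z)\<^sup>2)"
  show ?thesis unfolding bergman_matrix_def wirtinger_def 1 2 c of_real_power r_def[symmetric]
    using nz[folded r_def] n2
    by (cases "i = j") (simp_all add: field_simps power2_eq_square del: of_nat_Suc)
qed

lemma bergman_form_eq:
  fixes z :: "('n::finite) cvec" assumes "norm z < 1"
  shows "bergman_form z \<xi> = ((1 - (norm z)\<^sup>2) * (norm \<xi>)\<^sup>2 + (cmod (herm \<xi> z))\<^sup>2) / (1 - (norm z)\<^sup>2)\<^sup>2"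
proof -
  define r where "r = 1 - (norm z)\<^sup>2"
  have "(\<Sum>i\<in>UNIV. \<Sum>j\<in>UNIV. bergman_matrix z i j * \<xi> $ i * cnj (\<xi> $ j))
    = (\<Sum>i\<in>UNIV. \<Sum>j\<in>UNIV. (if i = j then of_real r * \<xi> $ i * cnj (\<xi> $ i) else 0) / of_real (r\<^sup>2)
       + (\<xi> $ i * cnj (z$i)) * cnj (\<xi> $ j * cnj (z$j)) / of_real (r\<^sup>2))"
    unfolding bergman_matrix_eq[OF assms] r_def[symmetric]
    by (intro sum.cong refl) (auto simp: field_simps add_divide_distrib)
  also have "\<dots> = (of_real r * herm \<xi> \<xi> + herm \<xi> z * cnj (herm \<xi> z)) / of_real (r\<^sup>2)"
  proof -
    have 1: "herm \<xi> z * cnj (herm \<xi> z) =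
        (\<Sum>i\<in>UNIV. \<Sum>j\<in>UNIV. (\<xi> $ i * cnj (z$i)) * cnj (\<xi> $ j * cnj (z$j)))"
      unfolding herm_def cnj_sum sum_product ..
    have 2: "of_real r * herm \<xi> \<xi> =
        (\<Sum>i\<in>UNIV. \<Sum>j\<in>UNIV. if i = j then of_real r * \<xi> $ i * cnj (\<xi> $ i) else 0)"
      by (simp add: herm_def sum_distrib_left mult.assoc)
    show ?thesis unfolding 1 2
      by (simp only: sum.distrib sum_divide_distrib add_divide_distrib)
  qed
  also have "\<dots> = of_real ((r * (norm \<xi>)\<^sup>2 + (cmod (herm \<xi> z))\<^sup>2) / r\<^sup>2)"
    unfolding herm_self complex_norm_square[symmetric] by simp
  finally show ?thesis unfolding bergman_form_def r_def by simp
qed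

end

theory Submission
  imports Defs "HOL-Complex_Analysis.Cauchy_Integral_Formula"
begin

text \<open>
Throughout, \<open>\<delta>(z) = 1 - |z|\<^sup>2\<close> is the \<^emph>\<open>defect\<close> of a point of the ball, and
\<open>\<tau> = (n + 1 + \<alpha> + kp) q / p\<close>. The conditions are linked in the cycle: embedding, Carleson tubes,
Berezin integrals for every \<open>s\<close>, Berezin integrals for some \<open>s\<close>, Carleson tubes, Bergman balls of
every radius, Bergman balls of some radius, embedding.

The links between tubes and Berezin integrals are elementary. On a tube of size \<open>r\<close> around \<open>\<zeta>\<close> the
  kernel with pole \<open>z = (1 - r)\<zeta>\<close> is of
size \<open>1/r\<close>, so the Berezin integral at \<open>z\<close> bounds the measure of the tube
(\<open>berezin_imp_carleson\<close>). Conversely the ball is exhausted by the tubes \<open>Q\<^bsub>2\<^sup>j\<delta>\<^esub>(z/|z|)\<close>, and the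
decay of the kernel turns the tube bounds into a geometric series (\<open>carleson_imp_berezin\<close>). This
argument works for every measure; applied to weighted volume it is the Forelli-Rudin estimate, once
weighted volumes of tubes are known.

From tubes to Bergman balls: along a path of Bergman length \<open>L\<close> the quantity \<open>|1 - \<langle>z,\<zeta>\<rangle>|\<close>
changes at most by the factor \<open>e\<^bsup>4L\<^esup>\<close>, so a Bergman ball lies in a tube whose size is comparable to the
defect of its centre (\<open>bergman_arc_distortion\<close>). In the other direction only short straight segments
are needed: an explicit neighbourhood of \<open>w\<close>, of radius \<open>\<epsilon> \<delta>\<^bsup>1/2\<^esup>\<close> in general and \<open>\<epsilon> \<delta>\<close> in the
complex direction of \<open>w\<close>, has Bergman radius of order \<open>\<epsilon>\<close> (\<open>near_imp_bergman_ball\<close>).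

From Bergman balls to the embedding: \<open>|g(w)|\<^sup>p\<close> is at most a constant times \<open>\<delta>(w)\<^bsup>-(n+1)\<^esup>\<close> times the
integral of \<open>|g|\<^sup>p\<close> over this neighbourhood (\<open>pointwise_estimate\<close>). For the first power this is the
mean value property over a set that is invariant under multiplication by unit scalars; smaller powers
follow by absorbing part of the integrand into a weighted supremum, larger powers by passing to powers
of \<open>g\<close>. Integrating the estimate and exchanging the order of integration gives the embedding into
\<open>L\<^sup>q(\<mu>)\<close> (\<open>carleson_embedding\<close>), and, combined with Cauchy's estimate, the inequality between
consecutive radial derivatives that replaces \<open>R\<^sup>kf\<close> by the derivative in the norm
(\<open>radial_deriv_weighted_Lp\<close>).

From the embedding to tubes: test it on \<open>(1 - \<langle>w,z\<rangle>)\<^bsup>-m\<^esup>\<close> with \<open>m\<close> a large integer. Its radial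
derivatives are combinations of powers of the same kernel, so Forelli-Rudin bounds its norm, and the
highest power dominates on the tube (\<open>embedding_imp_carleson\<close>). Constants and coordinate functions
show that \<open>\<mu>\<close> is finite, which settles tubes that are not small.
\<close>

section \<open>The Hermitian form and the defect\<close>

lemma herm_add_left: "herm (x + y) z = herm x z + herm y z"
  by (simp add: herm_def algebra_simps sum.distrib)

lemma herm_diff_left: "herm (x - y) z = herm x z - herm y z"
  by (simp add: herm_def algebra_simps sum_subtractf)

lemma herm_add_right: "herm z (x + y) = herm z x + herm z y"
  by (simp add: herm_def algebra_simps sum.distrib)

lemma herm_diff_right: "herm z (x - y) = herm z x - herm z y"
  by (simp add: herm_def algebra_simps sum_subtractf)

lemma herm_smult_left: "herm (c *s x) z = c * herm x z"
  by (simp add: herm_def sum_distrib_left mult_ac)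

lemma herm_scaleR_left: "herm (r *\<^sub>R x) z = r * herm x z"
  by (simp add: herm_def sum_distrib_left mult_ac scaleR_conv_of_real[where 'a=complex])

lemma herm_scaleR_right: "herm z (r *\<^sub>R x) = r * herm z x"
  by (simp add: herm_def sum_distrib_left mult_ac scaleR_conv_of_real[where 'a=complex])

lemma herm_zero [simp]: "herm 0 z = 0" "herm z 0 = 0"
  by (simp_all add: herm_def)

lemma cnj_herm: "cnj (herm x y) = herm y x"
  by (simp add: herm_def mult.commute)

lemma cmod_one_minus_herm_commute: "cmod (1 - herm x y) = cmod (1 - herm y x)"
  by (metis cnj_herm complex_cnj_diff complex_cnj_one complex_mod_cnj)

lemma Re_herm: "Re (herm x y) = x \<bullet> y"
  by (simp add: herm_def inner_vec_def inner_complex_def)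

lemma cmod_herm_le: "cmod (herm x y) \<le> norm x * norm y"
proof -
  have "cmod (herm x y) \<le> (\<Sum>j\<in>UNIV. \<bar>norm (x $ j)\<bar> * \<bar>norm (y $ j)\<bar>)"
    unfolding herm_def by (rule order_trans[OF norm_sum]) (simp add: norm_mult)
  also have "\<dots> \<le> norm x * norm y"
    unfolding norm_vec_def by (rule L2_set_mult_ineq)
  finally show ?thesis .
qed

lemma bounded_linear_herm_left: "bounded_linear (\<lambda>x. herm x z)"
  by (rule bounded_linear_intro[where K = "norm z"])
     (auto simp: herm_add_left herm_scaleR_left scaleR_conv_of_real[where 'a=complex] cmod_herm_le)

lemma continuous_on_herm [continuous_intros]:
  assumes "continuous_on S f" "continuous_on S g"
  shows "continuous_on S (\<lambda>x. herm (f x) (g x))"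
  unfolding herm_def using assms by (intro continuous_intros)

lemma norm_smult_vec: "norm (c *s x) = cmod c * norm x" for x :: "('n::finite) cvec"
  by (simp add: norm_vec_def norm_mult L2_set_right_distrib)

lemma continuous_on_smult_vec [continuous_intros]:
  fixes g :: "_ \<Rightarrow> ('n::finite) cvec"
  assumes "continuous_on S f" "continuous_on S g"
  shows "continuous_on S (\<lambda>x. f x *s g x)"
  unfolding vector_scalar_mult_def using assms
  by (intro continuous_intros continuous_on_vec_lambda)

lemma unit_direction_exists:
  "\<exists>\<zeta>\<in>sphere (0::('n::finite) cvec) 1. z = norm z *\<^sub>R \<zeta>"
proof (cases "z = 0")
  case True
  obtain e :: "'n cvec" where "norm e = 1" using vector_choose_size[of 1] by auto
  thus ?thesis using True by (intro bexI[of _ e]) auto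
next
  case False
  thus ?thesis by (intro bexI[of _ "z /\<^sub>R norm z"]) auto
qed

definition defect :: "('n::finite) cvec \<Rightarrow> real"
  where "defect z = 1 - (norm z)\<^sup>2"

lemma continuous_on_defect [continuous_intros]:
  "continuous_on S f \<Longrightarrow> continuous_on S (\<lambda>x. defect (f x))"
  unfolding defect_def by (intro continuous_intros)

lemma measurable_herm [measurable]:
  fixes f g :: "'a \<Rightarrow> ('n::finite) cvec"
  assumes [measurable]: "f \<in> borel_measurable M" "g \<in> borel_measurable M"
  shows "(\<lambda>x. herm (f x) (g x)) \<in> borel_measurable M"
  by (rule borel_measurable_continuous_Pair[OF assms]) (intro continuous_intros)

lemma measurable_defect [measurable]:
  assumes [measurable]: "f \<in> borel_measurable M"
  shows "(\<lambda>x. defect (f x)) \<in> borel_measurable M"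
  unfolding defect_def by measurable

lemma measurable_smult_vec [measurable]:
  fixes g :: "'a \<Rightarrow> ('n::finite) cvec"
  assumes [measurable]: "f \<in> borel_measurable M" "g \<in> borel_measurable M"
  shows "(\<lambda>x. f x *s g x) \<in> borel_measurable M"
  by (rule borel_measurable_continuous_Pair[OF assms]) (intro continuous_intros)

lemma defect_pos: "z \<in> unit_ball \<Longrightarrow> 0 < defect z"
  by (simp add: defect_def abs_square_less_1)

lemma defect_le_1: "defect z \<le> 1"
  by (simp add: defect_def)

lemma defect_bounds:
  assumes "z \<in> unit_ball" shows "1 - norm z \<le> defect z" "defect z \<le> 2 * (1 - norm z)"
proof -
  have e: "defect z = (1 - norm z) * (1 + norm z)"
    by (simp add: defect_def power2_eq_square algebra_simps)
  have n: "0 \<le> norm z" "norm z < 1" using assms by auto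
  show "1 - norm z \<le> defect z" unfolding e using n by (simp add: mult_le_cancel_left1)
  show "defect z \<le> 2 * (1 - norm z)" unfolding e
    using mult_left_mono[of "1 + norm z" 2 "1 - norm z"] n by simp
qed

lemma one_minus_norm_le_cmod_one_minus_herm:
  assumes "norm w \<le> 1" shows "1 - norm z \<le> cmod (1 - herm z w)"
proof -
  have "cmod (herm z w) \<le> norm z * 1"
    using cmod_herm_le[of z w] mult_left_mono[OF assms, of "norm z"] by simp
  thus ?thesis using norm_triangle_ineq2[of 1 "herm z w"] by simp
qed

text \<open>Expanding the square shows that \<open>|1 - \<langle>z,w\<rangle>|\<close> controls the square of the Euclidean distance;
this is the anisotropy of the balls \<open>Q\<^sub>r(\<zeta>)\<close>, which have width \<open>r\<close> in the complex direction of \<open>\<zeta>\<close> and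
width \<open>r\<^bsup>1/2\<^esup>\<close> in the others.\<close>

lemma norm_diff_squared_le:
  assumes "norm z \<le> 1" "norm w \<le> 1" shows "(norm (w - z))\<^sup>2 \<le> 2 * cmod (1 - herm z w)"
proof -
  have "(norm (w - z))\<^sup>2 = (norm w)\<^sup>2 + (norm z)\<^sup>2 - 2 * Re (herm z w)"
    unfolding Re_herm by (simp add: power2_norm_eq_inner algebra_simps inner_commute)
  also have "\<dots> \<le> 2 * Re (1 - herm z w)"
    using assms power_le_one[of "norm z" 2] power_le_one[of "norm w" 2] by simp
  also have "\<dots> \<le> 2 * cmod (1 - herm z w)" using complex_Re_le_cmod[of "1 - herm z w"] by simp
  finally show ?thesis .
qed

section \<open>Volumes of slabs\<close>

lemma nn_integral_lborel_shift:
  fixes f :: "'a::euclidean_space \<Rightarrow> ennreal"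
  assumes [measurable]: "f \<in> borel_measurable borel"
  shows "(\<integral>\<^sup>+x. f (x + c) \<partial>lborel) = (\<integral>\<^sup>+x. f x \<partial>lborel)"
proof -
  have "(\<integral>\<^sup>+x. f x \<partial>lborel) = (\<integral>\<^sup>+x. f x \<partial>distr lborel borel (\<lambda>x. c + x))"
    by (simp add: lborel_distr_plus)
  also have "\<dots> = (\<integral>\<^sup>+x. f (x + c) \<partial>lborel)" by (subst nn_integral_distr) (auto simp: add.commute)
  finally show ?thesis ..
qed

lemma nn_integral_lborel_diff:
  fixes f :: "'a::euclidean_space \<Rightarrow> ennreal"
  assumes "f \<in> borel_measurable borel"
  shows "(\<integral>\<^sup>+x. f (x - c) \<partial>lborel) = (\<integral>\<^sup>+x. f x \<partial>lborel)"
  using nn_integral_lborel_shift[OF assms, of "-c"] by simp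

text \<open>Up to constants, a nonisotropic ball moved to the origin, when \<open>\<zeta>\<close> is a unit vector and \<open>B\<close> is of
order \<open>A\<^sup>2\<close>.\<close>

definition slab :: "('n::finite) cvec \<Rightarrow> real \<Rightarrow> real \<Rightarrow> 'n cvec set"
  where "slab \<zeta> A B = {\<xi>. norm \<xi> < A \<and> cmod (herm \<xi> \<zeta>) < B}"

lemma slab_borel [measurable]: "slab \<zeta> A B \<in> sets borel"
  unfolding slab_def by measurable

text \<open>The volume of a slab is found without rotating coordinates: the translates by
\<open>\<lambda>\<zeta>\<close>, with \<open>\<lambda>\<close> in a disc, sweep out a ball. Integrating their indicator functions over \<open>\<lambda>\<close> and \<open>\<xi>\<close>
in both orders compares the volume of the slab with that of the ball.\<close>

lemma slab_translates:
  fixes \<zeta> :: "('n::finite) cvec"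
  assumes "A \<ge> 0"
  shows "emeasure lborel (ball (0::complex) L) * emeasure lborel (slab \<zeta> A B)
    = (\<integral>\<^sup>+\<xi>. emeasure lborel (ball (0::complex) L \<inter> {l. \<xi> - l *s \<zeta> \<in> slab \<zeta> A B}) \<partial>lborel)"
proof -
  define g where "g = (\<lambda>(l::complex, \<xi>::'n cvec). indicator (ball 0 L) l
    * indicator (slab \<zeta> A B) (\<xi> - l *s \<zeta>) :: ennreal)"
  have [measurable]: "g \<in> borel_measurable (lborel \<Otimes>\<^sub>M lborel)"
  proof -
    have [measurable]: "ball (0::complex) L \<in> sets lborel" by simp
    show ?thesis unfolding g_def case_prod_unfold by measurable
  qed
  have "(\<integral>\<^sup>+\<xi>. emeasure lborel (ball (0::complex) L \<inter> {l. \<xi> - l *s \<zeta> \<in> slab \<zeta> A B}) \<partial>lborel)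
     = (\<integral>\<^sup>+\<xi>. \<integral>\<^sup>+l. g (l, \<xi>) \<partial>lborel \<partial>lborel)"
  proof (rule nn_integral_cong)
    fix \<xi> :: "'n cvec"
    have "ball (0::complex) L \<inter> {l. \<xi> - l *s \<zeta> \<in> slab \<zeta> A B} \<in> sets lborel" by measurable
    hence "emeasure lborel (ball (0::complex) L \<inter> {l. \<xi> - l *s \<zeta> \<in> slab \<zeta> A B}) =
       (\<integral>\<^sup>+l. indicator (ball (0::complex) L \<inter> {l. \<xi> - l *s \<zeta> \<in> slab \<zeta> A B}) l \<partial>lborel)" by simp
    also have "\<dots> = (\<integral>\<^sup>+l. g (l, \<xi>) \<partial>lborel)"
      unfolding g_def by (intro nn_integral_cong) (auto simp: indicator_def)
    finally show "emeasure lborel (ball (0::complex) L \<inter> {l. \<xi> - l *s \<zeta> \<in> slab \<zeta> A B})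
      = (\<integral>\<^sup>+l. g (l, \<xi>) \<partial>lborel)" .
  qed
  also have "\<dots> = (\<integral>\<^sup>+l. \<integral>\<^sup>+\<xi>. g (l, \<xi>) \<partial>lborel \<partial>lborel)"
    by (rule lborel_pair.Fubini') measurable
  also have "\<dots> = (\<integral>\<^sup>+l. indicator (ball 0 L) (l::complex) * emeasure lborel (slab \<zeta> A B) \<partial>lborel)"
  proof (rule nn_integral_cong)
    fix l :: complex
    have "(\<integral>\<^sup>+\<xi>. g (l, \<xi>) \<partial>lborel) = indicator (ball 0 L) l
      * (\<integral>\<^sup>+\<xi>. indicator (slab \<zeta> A B) (\<xi> - l *s \<zeta>) \<partial>lborel)"
      unfolding g_def by (simp add: nn_integral_cmult)
    also have "(\<integral>\<^sup>+\<xi>. indicator (slab \<zeta> A B) (\<xi> - l *s \<zeta>) \<partial>lborel)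
      = (\<integral>\<^sup>+\<xi>. indicator (slab \<zeta> A B) \<xi> \<partial>lborel)"
      by (rule nn_integral_lborel_diff) measurable
    finally show "(\<integral>\<^sup>+\<xi>. g (l, \<xi>) \<partial>lborel) = indicator (ball 0 L) l * emeasure lborel (slab \<zeta> A B)"
      by simp
  qed
  also have "\<dots> = emeasure lborel (ball (0::complex) L) * emeasure lborel (slab \<zeta> A B)"
    by (subst nn_integral_multc) (auto intro!: borel_measurable_indicator)
  finally show ?thesis ..
qed

lemma power_twice_card: "(A::real) ^ (2 * CARD('n::finite)) = A ^ (2 * CARD('n) - 2) * A\<^sup>2"
proof -
  have "2 * CARD('n) = (2 * CARD('n) - 2) + 2" using zero_less_card_finite[where 'a='n] by linarith
  thus ?thesis by (metis power_add)
qed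

lemma emeasure_ball_complex: "r \<ge> 0 \<Longrightarrow> emeasure lborel (ball (c::complex) r) = ennreal (pi * r\<^sup>2)"
  by (subst emeasure_ball) (auto simp: unit_ball_vol_2)

lemma emeasure_ball_cvec:
  "r \<ge> 0 \<Longrightarrow> emeasure lborel (ball (c::('n::finite) cvec) r) =
    ennreal (unit_ball_vol (2 * CARD('n)) * r ^ (2 * CARD('n)))"
  by (subst emeasure_ball) (auto simp: mult.commute)

text \<open>A point \<open>\<xi>\<close> lies in the translate by \<open>\<lambda>\<zeta>\<close> only if \<open>\<lambda>\<close> is within \<open>B\<close> of \<open>\<langle>\<xi>,\<zeta>\<rangle>\<close>, and, for
\<open>|\<lambda>| < A\<close>, only if \<open>|\<xi>| < 2A\<close>.\<close>

lemma emeasure_slab_upper: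
  fixes \<zeta> :: "('n::finite) cvec"
  assumes "norm \<zeta> = 1" "A > 0" "B > 0"
  shows "emeasure lborel (slab \<zeta> A B) \<le>
    ennreal (unit_ball_vol (2 * CARD('n)) * 2 ^ (2 * CARD('n)) * A ^ (2 * CARD('n) - 2) * B\<^sup>2)"
proof -
  have hz: "herm \<zeta> \<zeta> = 1" using assms by (simp add: herm_self)
  have "ennreal (pi * A\<^sup>2) * emeasure lborel (slab \<zeta> A B) =
     (\<integral>\<^sup>+\<xi>. emeasure lborel (ball (0::complex) A \<inter> {l. \<xi> - l *s \<zeta> \<in> slab \<zeta> A B}) \<partial>lborel)"
    using slab_translates[of A A \<zeta> B] assms by (simp add: emeasure_ball_complex)
  also have "\<dots> \<le> (\<integral>\<^sup>+\<xi>. ennreal (pi * B\<^sup>2) * indicator (ball 0 (2 * A)) (\<xi>::'n cvec) \<partial>lborel)"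
  proof (rule nn_integral_mono)
    fix \<xi> :: "'n cvec"
    show "emeasure lborel (ball (0::complex) A \<inter> {l. \<xi> - l *s \<zeta> \<in> slab \<zeta> A B})
      \<le> ennreal (pi * B\<^sup>2) * indicator (ball 0 (2 * A)) \<xi>"
    proof (cases "norm \<xi> < 2 * A")
      case True
      have "emeasure lborel (ball (0::complex) A \<inter> {l. \<xi> - l *s \<zeta> \<in> slab \<zeta> A B})
        \<le> emeasure lborel (ball (herm \<xi> \<zeta>) B)"
        by (rule emeasure_mono) (auto simp: slab_def herm_diff_left herm_smult_left hz dist_norm)
      thus ?thesis using True assms by (simp add: emeasure_ball_complex)
    next
      case False
      have "ball (0::complex) A \<inter> {l. \<xi> - l *s \<zeta> \<in> slab \<zeta> A B} = {}"
      proof (intro equals0I)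
        fix l assume "l \<in> ball (0::complex) A \<inter> {l. \<xi> - l *s \<zeta> \<in> slab \<zeta> A B}"
        hence "cmod l < A" "norm (\<xi> - l *s \<zeta>) < A" by (auto simp: slab_def)
        moreover have "norm \<xi> \<le> norm (\<xi> - l *s \<zeta>) + norm (l *s \<zeta>)"
          using norm_triangle_ineq[of "\<xi> - l *s \<zeta>" "l *s \<zeta>"] by simp
        ultimately show False using False assms by (simp add: norm_smult_vec)
      qed
      thus ?thesis by simp
    qed
  qed
  also have "\<dots> = ennreal (pi * B\<^sup>2) * ennreal (unit_ball_vol (2 * CARD('n)) * (2 * A) ^ (2 * CARD('n)))"
    using assms by (subst nn_integral_cmult) (auto simp: emeasure_ball_cvec intro!:
      borel_measurable_indicator)
  also have "\<dots> = ennreal (pi * A\<^sup>2) *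
     ennreal (unit_ball_vol (2 * CARD('n)) * 2 ^ (2 * CARD('n)) * A ^ (2 * CARD('n) - 2) * B\<^sup>2)"
  proof -
    have "A ^ (2 * CARD('n)) = A ^ (2 * CARD('n) - 2) * A\<^sup>2"
      by (rule power_twice_card)
    thus ?thesis using assms
      by (simp add: ennreal_mult[symmetric] power_mult_distrib mult_ac)
  qed
  finally show ?thesis
    using assms by (subst (asm) ennreal_mult_le_mult_iff) auto
qed

text \<open>Every \<open>\<xi>\<close> with \<open>|\<xi>| < A/3\<close> lies in the translates by \<open>\<lambda>\<zeta>\<close> for a whole disc of \<open>\<lambda>\<close> around
\<open>\<langle>\<xi>,\<zeta>\<rangle>\<close>. The case of a unit vector suffices because a slab grows when \<open>\<zeta>\<close> is shrunk.\<close>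

lemma emeasure_slab_lower:
  fixes \<zeta> :: "('n::finite) cvec"
  assumes "norm \<zeta> \<le> 1" "0 < B" "B \<le> A"
  shows "ennreal (unit_ball_vol (2 * CARD('n)) / (36 * 3 ^ (2 * CARD('n))) * A ^ (2 * CARD('n) - 2)
    * B\<^sup>2)
     \<le> emeasure lborel (slab \<zeta> A B)"
proof -
  have unit: "ennreal (unit_ball_vol (2 * CARD('n)) / (36 * 3 ^ (2 * CARD('n)))
    * A ^ (2 * CARD('n) - 2) * B\<^sup>2)
     \<le> emeasure lborel (slab \<eta> A B)" if n: "norm \<eta> = 1" for \<eta> :: "'n cvec"
  proof -
    have hz: "herm \<eta> \<eta> = 1" using n by (simp add: herm_self)
    have "ennreal (pi * (B/3)\<^sup>2) * ennreal (unit_ball_vol (2 * CARD('n)) * (A/3) ^ (2 * CARD('n)))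
       = (\<integral>\<^sup>+\<xi>. ennreal (pi * (B/3)\<^sup>2) * indicator (ball 0 (A/3)) (\<xi>::'n cvec) \<partial>lborel)"
      using assms by (subst nn_integral_cmult)
        (auto simp: emeasure_ball_cvec intro!: borel_measurable_indicator)
    also have "\<dots> \<le> (\<integral>\<^sup>+\<xi>. emeasure lborel (ball (0::complex) (2*A) \<inter> {l. \<xi> - l *s \<eta> \<in> slab \<eta> A B})
      \<partial>lborel)"
    proof (rule nn_integral_mono)
      fix \<xi> :: "'n cvec"
      show "ennreal (pi * (B/3)\<^sup>2) * indicator (ball 0 (A/3)) \<xi>
        \<le> emeasure lborel (ball (0::complex) (2*A) \<inter> {l. \<xi> - l *s \<eta> \<in> slab \<eta> A B})"
      proof (cases "norm \<xi> < A/3")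
        case True
        \<comment> \<open>With \<open>B \<le> A\<close> the three thirds \<open>|\<xi>|\<close>, \<open>|\<langle>\<xi>,\<eta>\<rangle>|\<close> and \<open>B/3\<close> add up to at most \<open>A\<close>.\<close>
        have "ball (herm \<xi> \<eta>) (B/3) \<subseteq> ball (0::complex) (2*A) \<inter> {l. \<xi> - l *s \<eta> \<in> slab \<eta> A B}"
        proof
          fix l assume "l \<in> ball (herm \<xi> \<eta>) (B/3)"
          hence l: "cmod (herm \<xi> \<eta> - l) < B/3" by (simp add: dist_norm)
          have "cmod (herm \<xi> \<eta>) < A/3" using cmod_herm_le[of \<xi> \<eta>] True n by simp
          hence l2: "cmod l < A/3 + B/3"
            using l norm_triangle_ineq4[of "herm \<xi> \<eta>" "herm \<xi> \<eta> - l"] by simp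
          have "norm (\<xi> - l *s \<eta>) \<le> norm \<xi> + cmod l"
            using norm_triangle_ineq4[of \<xi> "l *s \<eta>"] n by (simp add: norm_smult_vec)
          thus "l \<in> ball (0::complex) (2*A) \<inter> {l. \<xi> - l *s \<eta> \<in> slab \<eta> A B}"
            using l l2 True assms
            by (auto simp: slab_def herm_diff_left herm_smult_left hz)
        qed
        hence "emeasure lborel (ball (herm \<xi> \<eta>) (B/3))
          \<le> emeasure lborel (ball (0::complex) (2*A) \<inter> {l. \<xi> - l *s \<eta> \<in> slab \<eta> A B})"
          by (rule emeasure_mono) measurable
        thus ?thesis using True assms by (simp add: emeasure_ball_complex)
      qed simp
    qed
    also have "\<dots> = ennreal (pi * (2*A)\<^sup>2) * emeasure lborel (slab \<eta> A B)"
      using slab_translates[of A "2*A" \<eta> B] assms by (simp add: emeasure_ball_complex)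
    also have "ennreal (pi * (B/3)\<^sup>2) * ennreal (unit_ball_vol (2 * CARD('n)) * (A/3) ^ (2 * CARD('n)))
       = ennreal (pi * (2*A)\<^sup>2) *
     ennreal (unit_ball_vol (2 * CARD('n)) / (36 * 3 ^ (2 * CARD('n))) * A ^ (2 * CARD('n) - 2) * B\<^sup>2)"
    proof -
      have "A ^ (2 * CARD('n)) = A ^ (2 * CARD('n) - 2) * A\<^sup>2"
        by (rule power_twice_card)
      thus ?thesis using assms
        by (simp add: ennreal_mult[symmetric] power_mult_distrib power_divide mult_ac)
    qed
    finally show ?thesis
      using assms by (subst (asm) ennreal_mult_le_mult_iff) auto
  qed
  obtain \<eta> where \<eta>: "norm \<eta> = 1" "\<zeta> = norm \<zeta> *\<^sub>R \<eta>"
    using unit_direction_exists[of \<zeta>] by auto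
  have "slab \<eta> A B \<subseteq> slab \<zeta> A B"
  proof
    fix \<xi> assume x: "\<xi> \<in> slab \<eta> A B"
    have "cmod (herm \<xi> \<zeta>) = norm \<zeta> * cmod (herm \<xi> \<eta>)"
      by (subst \<eta>(2)) (simp add: herm_scaleR_right norm_mult)
    also have "\<dots> \<le> cmod (herm \<xi> \<eta>)" using assms(1) by (simp add: mult_left_le_one_le)
    finally show "\<xi> \<in> slab \<zeta> A B" using x by (auto simp: slab_def)
  qed
  hence "emeasure lborel (slab \<eta> A B) \<le> emeasure lborel (slab \<zeta> A B)"
    by (rule emeasure_mono) measurable
  with unit[OF \<eta>(1)] show ?thesis by (rule order_trans)
qed

section \<open>Weighted volumes of Carleson tubes\<close>

abbreviation ball_integral :: "('n::finite) cvec measure \<Rightarrow> ('n cvec \<Rightarrow> real) \<Rightarrow> ennreal"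
  where "ball_integral M f \<equiv> (\<integral>\<^sup>+w. ennreal (f w) * indicator unit_ball w \<partial>M)"

text \<open>Comparable quantities have comparable real powers, whatever the sign of the exponent.\<close>

lemma powr_ratio_bound:
  fixes a b t :: real
  assumes "0 < a" "0 < b" "a \<le> L * b" "b \<le> L * a" "1 \<le> L"
  shows "a powr t \<le> L powr \<bar>t\<bar> * b powr t"
proof (cases "t \<ge> 0")
  case True
  have "a powr t \<le> (L * b) powr t" using assms True by (intro powr_mono2) auto
  thus ?thesis using True assms by (simp add: powr_mult)
next
  case False
  have "a powr t \<le> (b / L) powr t" using assms False by (intro powr_mono2') (auto simp: field_simps)
  also have "\<dots> = L powr \<bar>t\<bar> * b powr t"
    using False assms by (simp add: powr_divide powr_minus field_simps)
  finally show ?thesis .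
qed

lemma power_powr_swap: "0 < x \<Longrightarrow> (x ^ j) powr a = (x powr a) ^ j" for x a :: real
  by (simp add: powr_def ln_realpow exp_of_nat_mult[symmetric] mult_ac)

lemma nn_integral_lborel_scale:
  fixes f :: "'a::euclidean_space \<Rightarrow> ennreal"
  assumes [measurable]: "f \<in> borel_measurable borel" and "c > 0"
  shows "(\<integral>\<^sup>+x. f x \<partial>lborel) = ennreal (c ^ DIM('a)) * (\<integral>\<^sup>+x. f (c *\<^sub>R x) \<partial>lborel)"
proof -
  have "(\<integral>\<^sup>+x. f x \<partial>lborel) = (\<integral>\<^sup>+x. f x \<partial>density (distr lborel borel (\<lambda>x. 0 + c *\<^sub>R x))
    (\<lambda>_. ennreal (\<bar>c\<bar> ^ DIM('a))))"
    using lborel_affine[of c "0::'a"] assms(2) by simp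
  also have "\<dots> = ennreal (c ^ DIM('a)) * (\<integral>\<^sup>+x. f (c *\<^sub>R x) \<partial>lborel)"
    using assms(2) by (simp add: nn_integral_density nn_integral_distr nn_integral_cmult)
  finally show ?thesis .
qed

definition real_cone :: "'a::real_vector set \<Rightarrow> bool"
  where "real_cone K \<longleftrightarrow> (\<forall>z c. c > 0 \<longrightarrow> (c *\<^sub>R z \<in> K \<longleftrightarrow> z \<in> K))"

lemma emeasure_cone_ball:
  fixes K :: "('n::finite) cvec set"
  assumes K: "real_cone K" "K \<in> sets borel" and "0 < c"
  shows "emeasure lborel (K \<inter> ball 0 c) = ennreal (c ^ (2 * CARD('n)))
    * emeasure lborel (K \<inter> unit_ball)"
proof -
  note [measurable] = K(2)
  have "emeasure lborel (K \<inter> ball 0 c) = (\<integral>\<^sup>+x. indicator (K \<inter> ball 0 c) x \<partial>lborel)"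
    by (subst nn_integral_indicator) (use K in auto)
  also have "\<dots> = ennreal (c ^ DIM('n cvec)) * (\<integral>\<^sup>+x. indicator (K \<inter> ball 0 c) (c *\<^sub>R x) \<partial>lborel)"
    by (rule nn_integral_lborel_scale) (use K assms in \<open>auto intro!: borel_measurable_indicator\<close>)
  also have "(\<lambda>x. indicator (K \<inter> ball 0 c) (c *\<^sub>R x) :: ennreal) = indicator (K \<inter> unit_ball)"
    using K(1) \<open>0 < c\<close> by (auto simp: indicator_def real_cone_def fun_eq_iff)
  also have "(\<integral>\<^sup>+x. indicator (K \<inter> unit_ball) x \<partial>lborel) = emeasure lborel (K \<inter> unit_ball)"
    by (subst nn_integral_indicator) (use K in auto)
  finally show ?thesis by (simp add: mult.commute)
qed

lemma emeasure_cone_unit_finite: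
  "emeasure lborel (K \<inter> (unit_ball :: ('n::finite) cvec set)) < \<infinity>"
  using emeasure_mono[of "K \<inter> unit_ball" "unit_ball :: 'n cvec set" lborel]
    emeasure_lborel_ball_finite[of "0::'n cvec" 1]
  by (auto intro: le_less_trans)

text \<open>A cone and its dilates determine the volumes of all its shells, since dilation by \<open>c\<close> multiplies
volume by \<open>c\<^bsup>2n\<^esup>\<close>.\<close>

lemma emeasure_cone_shell:
  fixes K :: "('n::finite) cvec set" and s :: real
  assumes K: "real_cone K" "K \<in> sets borel" and "0 < s" "s \<le> 1"
  shows "emeasure lborel (K \<inter> unit_ball - ball 0 (1 - s)) =
    ennreal (1 - (1 - s) ^ (2 * CARD('n))) * emeasure lborel (K \<inter> unit_ball)"
proof (cases "s = 1")
  case True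
  thus ?thesis by (simp add: zero_power)
next
  case False
  let ?V = "emeasure lborel (K \<inter> unit_ball)" and ?c = "(1 - s) ^ (2 * CARD('n))"
  obtain v where v: "?V = ennreal v" "v \<ge> 0"
    using emeasure_cone_unit_finite[of K] by (cases ?V) auto
  have sub: "K \<inter> ball 0 (1 - s) \<subseteq> K \<inter> unit_ball" using assms by auto
  have c: "emeasure lborel (K \<inter> ball 0 (1 - s)) = ennreal ?c * ?V"
    using emeasure_cone_ball[OF K, of "1 - s"] assms False by simp
  have "K \<inter> unit_ball - ball 0 (1 - s) = K \<inter> unit_ball - K \<inter> ball 0 (1 - s)" by auto
  hence "emeasure lborel (K \<inter> unit_ball - ball 0 (1 - s)) = ?V - ennreal ?c * ?V"
    using K sub c v assms
    by (simp only:, subst emeasure_Diff) (auto simp: ennreal_mult_eq_top_iff v)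
  also have "\<dots> = ennreal ((1 - ?c) * v)"
    using v assms by (simp add: ennreal_mult[symmetric] ennreal_minus algebra_simps)
  also have "\<dots> = ennreal (1 - ?c) * ?V"
    using v assms by (simp add: ennreal_mult power_le_one)
  finally show ?thesis .
qed

lemma emeasure_cone_shell_le:
  fixes K :: "('n::finite) cvec set" and s :: real
  assumes K: "real_cone K" "K \<in> sets borel" and "0 < s"
  shows "emeasure lborel (K \<inter> unit_ball - ball 0 (1 - s))
    \<le> ennreal (2 * CARD('n) * s) * emeasure lborel (K \<inter> unit_ball)"
proof (cases "s \<le> 1")
  case True
  have "1 + real (2 * CARD('n)) * (- s) \<le> (1 + (- s)) ^ (2 * CARD('n))"
    by (rule Bernoulli_inequality) (use True in auto)
  hence "1 - (1 - s) ^ (2 * CARD('n)) \<le> 2 * CARD('n) * s" by simp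
  thus ?thesis using emeasure_cone_shell[OF K \<open>0 < s\<close> True]
    by (simp add: mult_right_mono ennreal_leI)
next
  case False
  have "1 \<le> 2 * real CARD('n)" using zero_less_card_finite[where 'a='n] by linarith
  hence "1 * 1 \<le> (2 * real CARD('n)) * s" by (rule mult_mono) (use False in auto)
  hence "1 * emeasure lborel (K \<inter> unit_ball) \<le> ennreal (2 * CARD('n) * s)
    * emeasure lborel (K \<inter> unit_ball)"
    by (intro mult_right_mono) (auto simp: ennreal_1[symmetric] simp del: ennreal_1 intro!: ennreal_leI)
  moreover have "K \<inter> unit_ball - ball 0 (1 - s) = K \<inter> unit_ball"
  proof -
    have "ball (0::'n cvec) (1 - s) = {}" using False by (simp add: ball_empty)
    thus ?thesis by (simp only: Diff_empty)
  qed
  ultimately show ?thesis by simp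
qed

lemma emeasure_cone_shell_ge:
  fixes K :: "('n::finite) cvec set" and s :: real
  assumes K: "real_cone K" "K \<in> sets borel" and "0 < s" "s \<le> 1"
  shows "ennreal s * emeasure lborel (K \<inter> unit_ball) \<le> emeasure lborel (K \<inter> unit_ball - ball 0 (1 - s))"
proof -
  have "(1 - s) ^ (2 * CARD('n)) \<le> (1 - s) ^ 1"
    using assms by (intro power_decreasing) (auto simp: Suc_leI)
  hence "s \<le> 1 - (1 - s) ^ (2 * CARD('n))" by simp
  thus ?thesis using emeasure_cone_shell[OF assms]
    by (simp add: mult_right_mono ennreal_leI)
qed

lemma dyadic_scale_exists:
  fixes x s :: real assumes "0 < x" "x \<le> s"
  shows "\<exists>j. s / 2 ^ Suc j < x \<and> x \<le> s / 2 ^ j"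
proof -
  obtain i where i: "s / x < 2 ^ i" using real_arch_pow[of 2 "s / x"] by auto
  define P where "P = (\<lambda>j. s / 2 ^ Suc j < x)"
  have "P i" using i assms by (auto simp: P_def field_simps)
  hence L: "P (Least P)" by (rule LeastI)
  show ?thesis
  proof (intro exI conjI)
    show "s / 2 ^ Suc (Least P) < x" using L by (simp add: P_def)
    show "x \<le> s / 2 ^ Least P"
    proof (cases "Least P")
      case (Suc k)
      hence "\<not> P k" using not_less_Least[of k P] by simp
      hence "x \<le> s / 2 ^ Suc k" unfolding P_def by simp
      thus ?thesis unfolding Suc .
    qed (use assms in simp)
  qed
qed

lemma suminf_geometric_ennreal:
  fixes x c :: real assumes "0 \<le> x" "x < 1" "0 \<le> c"
  shows "(\<Sum>j. ennreal (c * x ^ j)) = ennreal (c / (1 - x))"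
proof -
  have "(\<lambda>j. c * x ^ j) sums (c * (1 / (1 - x)))"
    using assms by (intro sums_mult geometric_sums) auto
  thus ?thesis using assms by (subst suminf_ennreal_eq) auto
qed

text \<open>On the part of the cone where \<open>1 - |z|\<close> is about \<open>2\<^bsup>-j\<^esup>s\<close> the weight is about \<open>(2\<^bsup>-j\<^esup>s)\<^sup>t\<close> and
the volume is at most of order \<open>2\<^bsup>-j\<^esup>s\<close> times that of the cone. Summing over \<open>j\<close> gives a geometric
series, convergent exactly because \<open>t > -1\<close>.\<close>

lemma cone_weighted_volume:
  fixes t :: real assumes t: "t > -1"
  shows "\<exists>C>0. \<forall>K s. real_cone (K::('n::finite) cvec set) \<longrightarrow> K \<in> sets borel \<longrightarrow> 0 < s \<longrightarrow>
    (\<integral>\<^sup>+z. ennreal (defect z powr t) * indicator (K \<inter> unit_ball - ball 0 (1 - s)) z \<partial>lborel)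
      \<le> ennreal (C * s powr (1 + t)) * emeasure lborel (K \<inter> unit_ball)"
proof -
  define q where "q = (1/2) powr (1 + t)"
  have q: "0 \<le> q" "q < 1" unfolding q_def using t powr_less_mono2[of "1 + t" "1/2" 1] by auto
  define A where "A = 2 powr \<bar>t\<bar> * (2 * CARD('n))"
  have A: "A > 0" unfolding A_def by simp
  show ?thesis
  proof (intro exI[of _ "A / (1 - q)"] conjI allI impI)
    show "0 < A / (1 - q)" using q A by simp
    fix K :: "'n cvec set" and s :: real
    assume K: "real_cone K" "K \<in> sets borel" and s: "0 < s"
    note [measurable] = K(2)
    let ?V = "emeasure lborel (K \<inter> unit_ball)"
    define S where "S = (\<lambda>j::nat. K \<inter> unit_ball - ball 0 (1 - s / 2 ^ j))"
    have S [measurable]: "S j \<in> sets borel" for j unfolding S_def using K by auto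
    have "(\<integral>\<^sup>+z. ennreal (defect z powr t) * indicator (K \<inter> unit_ball - ball 0 (1 - s)) z \<partial>lborel)
      \<le> (\<integral>\<^sup>+z. (\<Sum>j. ennreal (2 powr \<bar>t\<bar> * (s / 2 ^ j) powr t) * indicator (S j) z) \<partial>lborel)"
    proof (rule nn_integral_mono)
      fix z :: "'n cvec"
      show "ennreal (defect z powr t) * indicator (K \<inter> unit_ball - ball 0 (1 - s)) z
        \<le> (\<Sum>j. ennreal (2 powr \<bar>t\<bar> * (s / 2 ^ j) powr t) * indicator (S j) z)"
      proof (cases "z \<in> K \<inter> unit_ball - ball 0 (1 - s)")
        case True
        hence z: "z \<in> K" "norm z < 1" "1 - norm z \<le> s" by auto
        obtain j where j: "s / 2 ^ Suc j < 1 - norm z" "1 - norm z \<le> s / 2 ^ j"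
          using dyadic_scale_exists[of "1 - norm z" s] z by auto
        have zS: "z \<in> S j" using z j by (auto simp: S_def)
        have d: "0 < defect z" "1 - norm z \<le> defect z" "defect z \<le> 2 * (1 - norm z)"
          using defect_pos[of z] defect_bounds[of z] z by auto
        have "defect z powr t \<le> 2 powr \<bar>t\<bar> * (s / 2 ^ j) powr t"
          by (rule powr_ratio_bound) (use d j s in auto)
        hence "ennreal (defect z powr t) * indicator (K \<inter> unit_ball - ball 0 (1 - s)) z \<le>
           ennreal (2 powr \<bar>t\<bar> * (s / 2 ^ j) powr t) * indicator (S j) z"
          using True zS by (simp add: ennreal_leI)
        also have "\<dots> = (\<Sum>j\<in>{j}. ennreal (2 powr \<bar>t\<bar> * (s / 2 ^ j) powr t) * indicator (S j) z)"
          by (subst sum.insert) auto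
        also have "\<dots> \<le> (\<Sum>j. ennreal (2 powr \<bar>t\<bar> * (s / 2 ^ j) powr t) * indicator (S j) z)"
          by (rule sum_le_suminf) auto
        finally show ?thesis .
      qed simp
    qed
    also have "\<dots> = (\<Sum>j. ennreal (2 powr \<bar>t\<bar> * (s / 2 ^ j) powr t) * emeasure lborel (S j))"
      by (subst nn_integral_suminf) (auto simp: nn_integral_cmult)
    also have "\<dots> \<le> (\<Sum>j. ennreal (A * s powr (1 + t) * q ^ j) * ?V)"
    proof (rule suminf_le)
      fix j
      have "ennreal (2 powr \<bar>t\<bar> * (s / 2 ^ j) powr t) * emeasure lborel (S j)
        \<le> ennreal (2 powr \<bar>t\<bar> * (s / 2 ^ j) powr t) * (ennreal (2 * CARD('n) * (s / 2 ^ j)) * ?V)"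
        unfolding S_def by (intro mult_left_mono emeasure_cone_shell_le K) (use s in auto)
      also have "\<dots> = ennreal (A * ((s / 2 ^ j) powr t * (s / 2 ^ j))) * ?V"
        using s unfolding A_def by (simp add: ennreal_mult[symmetric] mult.assoc[symmetric])
          (simp add: mult_ac)
      also have "(s / 2 ^ j) powr t * (s / 2 ^ j) = (s / 2 ^ j) powr (1 + t)"
        using s by (simp add: powr_add)
      also have "\<dots> = s powr (1 + t) * q ^ j"
      proof -
        have "s / 2 ^ j = s * (1/2) ^ j" by (simp add: power_divide)
        thus ?thesis using s unfolding q_def by (simp add: powr_mult power_powr_swap)
      qed
      finally show "ennreal (2 powr \<bar>t\<bar> * (s / 2 ^ j) powr t) * emeasure lborel (S j)
        \<le> ennreal (A * s powr (1 + t) * q ^ j) * ?V"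
        by (simp add: mult_ac)
    qed auto
    also have "\<dots> = ennreal (A / (1 - q) * s powr (1 + t)) * ?V"
    proof -
      have "(\<Sum>j. ennreal (A * s powr (1 + t) * q ^ j)) = ennreal (A * s powr (1 + t) / (1 - q))"
        by (rule suminf_geometric_ennreal) (use q A in auto)
      moreover have "A * s powr (1 + t) / (1 - q) = A / (1 - q) * s powr (1 + t)" by simp
      ultimately show ?thesis by (simp only: ennreal_suminf_multc)
    qed
    finally show "(\<integral>\<^sup>+z. ennreal (defect z powr t)
      * indicator (K \<inter> unit_ball - ball 0 (1 - s)) z \<partial>lborel)
      \<le> ennreal (A / (1 - q) * s powr (1 + t)) * emeasure lborel (K \<inter> unit_ball)" .
  qed
qed

lemma carleson_tube_borel [measurable]: "carleson_tube \<zeta> r \<in> sets borel"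
proof -
  have "carleson_tube \<zeta> r = unit_ball \<inter> {z. cmod (1 - herm z \<zeta>) < r}"
    by (auto simp: carleson_tube_def)
  moreover have "{z. cmod (1 - herm z \<zeta>) < r} \<in> sets borel" by measurable
  ultimately show ?thesis by simp
qed

text \<open>After translation by \<open>-\<zeta>\<close> the tube lies in the slab with \<open>A = (2r)\<^bsup>1/2\<^esup>\<close> and \<open>B = r\<close>.\<close>

lemma emeasure_carleson_tube_le:
  "\<exists>C>0. \<forall>r>0. \<forall>\<zeta>\<in>sphere (0::('n::finite) cvec) 1.
     emeasure lborel (carleson_tube \<zeta> r) \<le> ennreal (C * r ^ (CARD('n) + 1))"
proof -
  let ?b = "unit_ball_vol (2 * CARD('n)) * 2 ^ (2 * CARD('n)) :: real"
  define C where "C = ?b * 2 ^ (CARD('n) - 1)"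
  show ?thesis
  proof (intro exI[of _ C] conjI allI impI ballI)
    show "C > 0" unfolding C_def by simp
    fix r :: real and \<zeta> :: "'n cvec"
    assume r: "r > 0" and "\<zeta> \<in> sphere 0 1"
    hence z: "norm \<zeta> = 1" by simp
    have "carleson_tube \<zeta> r \<subseteq> {z. z - \<zeta> \<in> slab \<zeta> (sqrt (2 * r)) r}"
    proof
      fix z assume "z \<in> carleson_tube \<zeta> r"
      hence h: "norm z < 1" "cmod (1 - herm z \<zeta>) < r" by (auto simp: carleson_tube_def)
      have "(norm (\<zeta> - z))\<^sup>2 < 2 * r"
        using norm_diff_squared_le[of z \<zeta>] h z by simp
      hence "norm (z - \<zeta>) < sqrt (2 * r)" by (simp add: norm_minus_commute real_less_rsqrt)
      moreover have "cmod (herm (z - \<zeta>) \<zeta>) < r"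
        using h z by (simp add: herm_diff_left herm_self norm_minus_commute)
      ultimately show "z \<in> {z. z - \<zeta> \<in> slab \<zeta> (sqrt (2 * r)) r}" by (simp add: slab_def)
    qed
    hence "emeasure lborel (carleson_tube \<zeta> r) \<le> emeasure lborel {z. z - \<zeta> \<in> slab \<zeta> (sqrt (2 * r)) r}"
      by (rule emeasure_mono) measurable
    also have "\<dots> = (\<integral>\<^sup>+z. indicator {z. z - \<zeta> \<in> slab \<zeta> (sqrt (2 * r)) r} z \<partial>lborel)"
      by (subst nn_integral_indicator) measurable
    also have "\<dots> = (\<integral>\<^sup>+z. indicator (slab \<zeta> (sqrt (2 * r)) r) (z - \<zeta>) \<partial>lborel)"
      by (intro nn_integral_cong) (simp add: indicator_def)
    also have "\<dots> = emeasure lborel (slab \<zeta> (sqrt (2 * r)) r)"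
      by (subst nn_integral_lborel_diff) auto
    also have "\<dots> \<le> ennreal (?b * sqrt (2 * r) ^ (2 * CARD('n) - 2) * r\<^sup>2)"
      by (rule emeasure_slab_upper) (use z r in auto)
    also have "sqrt (2 * r) ^ (2 * CARD('n) - 2) = (2 * r) ^ (CARD('n) - 1)"
    proof -
      have "sqrt (2 * r) ^ (2 * (CARD('n) - 1)) = (2 * r) ^ (CARD('n) - 1)"
        using r by (simp only: power_mult) simp
      thus ?thesis by (simp add: right_diff_distrib')
    qed
    also have "?b * (2 * r) ^ (CARD('n) - 1) * r\<^sup>2 = C * r ^ (CARD('n) + 1)"
    proof -
      have "CARD('n) + 1 = (CARD('n) - 1) + 2" using zero_less_card_finite[where 'a='n] by linarith
      hence "r ^ (CARD('n) + 1) = r ^ (CARD('n) - 1) * r\<^sup>2" by (metis power_add)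
      thus ?thesis by (simp add: C_def power_mult_distrib)
    qed
    finally show "emeasure lborel (carleson_tube \<zeta> r) \<le> ennreal (C * r ^ (CARD('n) + 1))" .
  qed
qed

text \<open>The cone over the cap \<open>|1 - \<langle>\<eta>,\<zeta>\<rangle>| \<le> r\<close> of the sphere. Clearing the denominator \<open>|z|\<close> makes the
condition visibly homogeneous.\<close>

definition cap_cone :: "('n::finite) cvec \<Rightarrow> real \<Rightarrow> 'n cvec set"
  where "cap_cone \<zeta> r = {z. cmod (of_real (norm z) - herm z \<zeta>) \<le> r * norm z}"

lemma cap_cone_borel [measurable]: "cap_cone \<zeta> r \<in> sets borel"
  unfolding cap_cone_def by measurable

lemma real_cone_cap_cone: "real_cone (cap_cone \<zeta> r)"
  unfolding real_cone_def
proof (intro allI impI)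
  fix z c assume c: "(c::real) > 0"
  have "of_real (norm (c *\<^sub>R z)) - herm (c *\<^sub>R z) \<zeta> = c *\<^sub>R (of_real (norm z) - herm z \<zeta>)"
    using c by (simp add: herm_scaleR_left scaleR_conv_of_real[where 'a=complex] algebra_simps)
  hence "cmod (of_real (norm (c *\<^sub>R z)) - herm (c *\<^sub>R z) \<zeta>) = c * cmod (of_real (norm z) - herm z \<zeta>)"
    using c by (simp only: norm_scaleR; simp)
  thus "(c *\<^sub>R z \<in> cap_cone \<zeta> r) = (z \<in> cap_cone \<zeta> r)"
    using c by (simp add: cap_cone_def mult.left_commute)
qed

text \<open>For \<open>r \<le> 1\<close> the outer shell of thickness \<open>r\<close> contains at least the fraction \<open>r\<close> of the cone,
  and it lies in a
tube of volume at most of order \<open>r\<^bsup>n+1\<^esup>\<close>.\<close>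

lemma emeasure_cap_cone_le:
  "\<exists>C>0. \<forall>r>0. \<forall>\<zeta>\<in>sphere (0::('n::finite) cvec) 1.
     emeasure lborel (cap_cone \<zeta> r \<inter> unit_ball) \<le> ennreal (C * r ^ CARD('n))"
proof -
  obtain C0 where C0: "C0 > 0" "\<And>r \<zeta>. r > 0 \<Longrightarrow> \<zeta> \<in> sphere (0::'n cvec) 1 \<Longrightarrow>
     emeasure lborel (carleson_tube \<zeta> r) \<le> ennreal (C0 * r ^ (CARD('n) + 1))"
    using emeasure_carleson_tube_le by blast
  define B where "B = unit_ball_vol (2 * CARD('n)) + C0 * 2 ^ (CARD('n) + 1)"
  show ?thesis
  proof (intro exI[of _ B] conjI allI impI ballI)
    show "B > 0" unfolding B_def using C0(1) by (simp add: add_pos_pos)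
    fix r :: real and \<zeta> :: "'n cvec"
    assume r: "r > 0" and z: "\<zeta> \<in> sphere 0 1"
    let ?V = "emeasure lborel (cap_cone \<zeta> r \<inter> unit_ball)"
    show "?V \<le> ennreal (B * r ^ CARD('n))"
    proof (cases "r \<le> 1")
      case True
      have "ennreal r * ?V \<le> emeasure lborel (cap_cone \<zeta> r \<inter> unit_ball - ball 0 (1 - r))"
        by (rule emeasure_cone_shell_ge) (use r True real_cone_cap_cone in auto)
      also have "\<dots> \<le> emeasure lborel (carleson_tube \<zeta> (2 * r))"
      proof (rule emeasure_mono)
        show "cap_cone \<zeta> r \<inter> unit_ball - ball 0 (1 - r) \<subseteq> carleson_tube \<zeta> (2 * r)"
        proof
          fix w assume "w \<in> cap_cone \<zeta> r \<inter> unit_ball - ball 0 (1 - r)"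
          hence w: "cmod (of_real (norm w) - herm w \<zeta>) \<le> r * norm w" "norm w < 1" "1 - r \<le> norm w"
            by (auto simp: cap_cone_def)
          have "1 - herm w \<zeta> = of_real (1 - norm w) + (of_real (norm w) - herm w \<zeta>)" by simp
          hence "cmod (1 - herm w \<zeta>) \<le> (1 - norm w) + cmod (of_real (norm w) - herm w \<zeta>)"
            using norm_triangle_ineq[of "of_real (1 - norm w)" "of_real (norm w) - herm w \<zeta>"] w
              by (simp only: norm_of_real; simp)
          also have "\<dots> < 2 * r"
            using w mult_strict_left_mono[of "norm w" 1 r, OF _ r] by linarith
          finally show "w \<in> carleson_tube \<zeta> (2 * r)" using w by (simp add: carleson_tube_def)
        qed
      qed simp
      also have "\<dots> \<le> ennreal (C0 * (2 * r) ^ (CARD('n) + 1))" using C0(2)[of "2 * r"] r z by simp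
      also have "\<dots> \<le> ennreal r * ennreal (B * r ^ CARD('n))"
      proof -
        have "C0 * (2 * r) ^ (CARD('n) + 1) = r * (C0 * 2 ^ (CARD('n) + 1) * r ^ CARD('n))"
          by (simp add: power_mult_distrib)
        also have "\<dots> \<le> r * (B * r ^ CARD('n))"
          unfolding B_def using r C0(1) by (intro mult_left_mono mult_right_mono) auto
        finally show ?thesis using r C0(1) by (simp add: ennreal_mult'[symmetric] ennreal_leI)
      qed
      finally show ?thesis using r by (subst (asm) ennreal_mult_le_mult_iff) auto
    next
      case False
      have "?V \<le> emeasure lborel (unit_ball :: 'n cvec set)" by (rule emeasure_mono) auto
      also have "\<dots> = ennreal (unit_ball_vol (2 * CARD('n)))" by (subst emeasure_ball_cvec) auto
      also have "\<dots> \<le> ennreal (B * r ^ CARD('n))"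
      proof (rule ennreal_leI)
        have "B * 1 \<le> B * r ^ CARD('n)"
          using False \<open>B > 0\<close> by (intro mult_left_mono one_le_power) auto
        moreover have "unit_ball_vol (2 * CARD('n)) \<le> B" using C0(1) unfolding B_def by simp
        ultimately show "unit_ball_vol (2 * CARD('n)) \<le> B * r ^ CARD('n)" by simp
      qed
      finally show ?thesis .
    qed
  qed
qed

lemma carleson_tube_subset_cap_cone:
  assumes "norm \<zeta> = 1"
  shows "carleson_tube \<zeta> r \<subseteq> cap_cone \<zeta> (4 * r) \<inter> unit_ball - ball 0 (1 - r)"
proof
  fix z assume "z \<in> carleson_tube \<zeta> r"
  hence z: "norm z < 1" "cmod (1 - herm z \<zeta>) < r" by (auto simp: carleson_tube_def)
  have n: "1 - norm z < r" using one_minus_norm_le_cmod_one_minus_herm[of \<zeta> z] assms z by simp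
  have "cmod (of_real (norm z) - herm z \<zeta>) \<le> 4 * r * norm z"
  proof (cases "r \<le> 1/2")
    case True
    have "of_real (norm z) - herm z \<zeta> = (1 - herm z \<zeta>) - of_real (1 - norm z)" by simp
    hence "cmod (of_real (norm z) - herm z \<zeta>) \<le> cmod (1 - herm z \<zeta>) + (1 - norm z)"
      using norm_triangle_ineq4[of "1 - herm z \<zeta>" "of_real (1 - norm z)"] z
        by (simp only: norm_of_real; simp)
    also have "\<dots> \<le> 2 * r * (2 * norm z)"
      using z n True mult_left_mono[of 1 "2 * norm z" "2 * r"] by linarith
    finally show ?thesis by simp
  next
    case False
    have "cmod (of_real (norm z) - herm z \<zeta>) \<le> norm z + norm z"
      using norm_triangle_ineq4[of "of_real (norm z)" "herm z \<zeta>"] cmod_herm_le[of z \<zeta>] assms by simp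
    also have "\<dots> \<le> 4 * r * norm z" using False mult_right_mono[of 2 "4 * r" "norm z"] by simp
    finally show ?thesis .
  qed
  thus "z \<in> cap_cone \<zeta> (4 * r) \<inter> unit_ball - ball 0 (1 - r)" using z n by (auto simp: cap_cone_def)
qed

text \<open>A tube lies in the shell of thickness \<open>r\<close> of a cone over a comparable cap. The shell contributes
\<open>r\<^bsup>1+t\<^esup>\<close> and the volume of the cone \<open>r\<^sup>n\<close>.\<close>

lemma weighted_volume_carleson_tube_le:
  fixes t :: real
  assumes "t > -1"
  shows "\<exists>C>0. \<forall>r>0. \<forall>\<zeta>\<in>sphere (0::('n::finite) cvec) 1.
     (\<integral>\<^sup>+z. ennreal (defect z powr t) * indicator (carleson_tube \<zeta> r) z \<partial>lborel)
       \<le> ennreal (C * r powr (CARD('n) + 1 + t))"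
proof -
  obtain C1 where C1: "C1 > 0" "\<And>r \<zeta>. r > 0 \<Longrightarrow> \<zeta> \<in> sphere (0::'n cvec) 1 \<Longrightarrow>
     emeasure lborel (cap_cone \<zeta> r \<inter> unit_ball) \<le> ennreal (C1 * r ^ CARD('n))"
    using emeasure_cap_cone_le by blast
  obtain C2 where C2: "C2 > 0" "\<forall>K s. real_cone (K::'n cvec set) \<longrightarrow> K \<in> sets borel \<longrightarrow> 0 < s \<longrightarrow>
    (\<integral>\<^sup>+z. ennreal (defect z powr t) * indicator (K \<inter> unit_ball - ball 0 (1 - s)) z \<partial>lborel)
      \<le> ennreal (C2 * s powr (1 + t)) * emeasure lborel (K \<inter> unit_ball)"
    using cone_weighted_volume[OF assms, where 'n='n] by (elim exE conjE) (rule that)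
  show ?thesis
  proof (intro exI[of _ "C2 * C1 * 4 ^ CARD('n)"] conjI allI impI ballI)
    show "0 < C2 * C1 * 4 ^ CARD('n)" using C1 C2 by simp
    fix r :: real and \<zeta> :: "'n cvec"
    assume r: "r > 0" and z: "\<zeta> \<in> sphere 0 1"
    have "(\<integral>\<^sup>+z. ennreal (defect z powr t) * indicator (carleson_tube \<zeta> r) z \<partial>lborel) \<le>
      (\<integral>\<^sup>+z. ennreal (defect z powr t) * indicator (cap_cone \<zeta> (4 * r) \<inter> unit_ball
        - ball 0 (1 - r)) z \<partial>lborel)"
      using carleson_tube_subset_cap_cone[of \<zeta> r] z
      by (intro nn_integral_mono mult_left_mono) (auto simp: indicator_def)
    also have "\<dots> \<le> ennreal (C2 * r powr (1 + t)) * emeasure lborel (cap_cone \<zeta> (4 * r) \<inter> unit_ball)"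
      using C2(2)[rule_format, OF real_cone_cap_cone _ r] by simp
    also have "\<dots> \<le> ennreal (C2 * r powr (1 + t)) * ennreal (C1 * (4 * r) ^ CARD('n))"
      using C1(2)[of "4 * r" \<zeta>] r z by (intro mult_left_mono) auto
    also have "\<dots> = ennreal (C2 * C1 * 4 ^ CARD('n) * r powr (CARD('n) + 1 + t))"
    proof -
      have "r powr (CARD('n) + 1 + t) = r powr (1 + t) * r ^ CARD('n)"
      proof -
        have "r ^ CARD('n) = r powr CARD('n)" using r by (simp add: powr_realpow)
        thus ?thesis by (simp only: powr_add[symmetric]) (simp add: algebra_simps)
      qed
      hence "C2 * C1 * 4 ^ CARD('n) * r powr (CARD('n) + 1 + t)
        = (C2 * r powr (1 + t)) * (C1 * (4 * r) ^ CARD('n))"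
        by (simp only: power_mult_distrib mult_ac)
      thus ?thesis using r C1(1) C2(1) by (simp only:) (rule ennreal_mult[symmetric], auto)
    qed
    finally show "(\<integral>\<^sup>+z. ennreal (defect z powr t) * indicator (carleson_tube \<zeta> r) z \<partial>lborel)
       \<le> ennreal (C2 * C1 * 4 ^ CARD('n) * r powr (CARD('n) + 1 + t))" .
  qed
qed

section \<open>Carleson tubes and Berezin-type integrals\<close>

text \<open>Moving the pole from \<open>\<zeta>\<close> to \<open>c\<zeta>\<close> inside the ball changes \<open>1 - \<langle>w,\<zeta>\<rangle>\<close> by at most
\<open>1 - c\<close>, which is itself dominated by \<open>|1 - \<langle>w,c\<zeta>\<rangle>|\<close>.\<close>

lemma cmod_one_minus_herm_radial_le:
  assumes "norm \<zeta> = 1" "norm w \<le> 1" "0 \<le> c" "c \<le> 1"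
  shows "cmod (1 - herm w \<zeta>) \<le> 2 * cmod (1 - herm w (c *\<^sub>R \<zeta>))"
    and "cmod (1 - herm w (c *\<^sub>R \<zeta>)) \<le> cmod (1 - herm w \<zeta>) + (1 - c)"
proof -
  have h: "cmod (herm w \<zeta>) \<le> 1" using cmod_herm_le[of w \<zeta>] assms by simp
  have e: "herm w (c *\<^sub>R \<zeta>) = of_real c * herm w \<zeta>" by (simp add: herm_scaleR_right)
  have d: "cmod (of_real (1 - c) * herm w \<zeta>) \<le> 1 - c"
    using mult_left_mono[OF h, of "1 - c"] assms(4) by (simp only: norm_mult norm_of_real) simp
  have "1 - herm w (c *\<^sub>R \<zeta>) = (1 - herm w \<zeta>) + of_real (1 - c) * herm w \<zeta>"
    unfolding e by (simp add: algebra_simps)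
  moreover from this have "1 - herm w \<zeta> = (1 - herm w (c *\<^sub>R \<zeta>)) - of_real (1 - c) * herm w \<zeta>"
    by simp
  ultimately have "cmod (1 - herm w (c *\<^sub>R \<zeta>))
    \<le> cmod (1 - herm w \<zeta>) + cmod (of_real (1 - c) * herm w \<zeta>)"
    and "cmod (1 - herm w \<zeta>) \<le> cmod (1 - herm w (c *\<^sub>R \<zeta>)) + cmod (of_real (1 - c) * herm w \<zeta>)"
    by (metis norm_triangle_ineq, metis norm_triangle_ineq4)
  with d have a: "cmod (1 - herm w (c *\<^sub>R \<zeta>)) \<le> cmod (1 - herm w \<zeta>) + (1 - c)"
    and b: "cmod (1 - herm w \<zeta>) \<le> cmod (1 - herm w (c *\<^sub>R \<zeta>)) + (1 - c)"
    by linarith+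
  show "cmod (1 - herm w (c *\<^sub>R \<zeta>)) \<le> cmod (1 - herm w \<zeta>) + (1 - c)" by (rule a)
  have "1 - c \<le> cmod (1 - herm w (c *\<^sub>R \<zeta>))"
    using one_minus_norm_le_cmod_one_minus_herm[of w "c *\<^sub>R \<zeta>"] assms
    by (subst cmod_one_minus_herm_commute) simp
  with b show "cmod (1 - herm w \<zeta>) \<le> 2 * cmod (1 - herm w (c *\<^sub>R \<zeta>))" by simp
qed

text \<open>With \<open>d = 1 - |z|\<close>, a point \<open>w\<close> of the tube of size \<open>2\<^bsup>j+1\<^esup>d\<close> outside the preceding one has
\<open>|1 - \<langle>z,w\<rangle>|\<close> at least \<open>2\<^bsup>j-1\<^esup>d\<close>. The contribution of the \<open>j\<close>-th tube is then of order \<open>2\<^bsup>-js\<^esup>\<close>.\<close>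

lemma carleson_imp_berezin:
  fixes \<nu> :: "('n::finite) cvec measure" and s \<tau> C :: real
  assumes sets [measurable_cong]: "sets \<nu> = sets borel" and s: "s > 0" and \<tau>: "\<tau> > 0" and C: "C > 0"
    and car: "\<And>r \<zeta>. r > 0 \<Longrightarrow> \<zeta> \<in> sphere 0 1 \<Longrightarrow> emeasure \<nu> (carleson_tube \<zeta> r) \<le> ennreal (C * r powr \<tau>)"
  shows "\<exists>B>0. \<forall>z\<in>unit_ball.
    ball_integral \<nu> (\<lambda>w. defect z powr s / cmod (1 - herm z w) powr (s + \<tau>)) \<le> ennreal B"
proof -
  define q where "q = 2 powr (-s)"
  have q: "0 \<le> q" "q < 1" using s powr_less_mono[of "-s" 0 "2::real"] by (auto simp: q_def)
  define A where "A = C * (2 powr s * 2 powr (s + \<tau>) * 2 powr \<tau>)"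
  have A: "A > 0" using C by (simp add: A_def)
  show ?thesis
  proof (intro exI[of _ "A / (1 - q)"] conjI ballI)
    show "0 < A / (1 - q)" using A q by simp
    fix z :: "'n cvec" assume z: "z \<in> unit_ball"
    obtain \<zeta> where \<zeta>: "\<zeta> \<in> sphere 0 1" "z = norm z *\<^sub>R \<zeta>" using unit_direction_exists[of z] by blast
    define d where "d = 1 - norm z"
    have d: "d > 0" "defect z \<le> 2 * d" "0 < defect z"
      using z defect_bounds(2)[OF z] defect_pos[OF z] by (auto simp: d_def)
    define T where "T = (\<lambda>j::nat. carleson_tube \<zeta> (2 * 2 ^ j * d))"
    define c where "c = (\<lambda>j::nat. (2 * d) powr s * (2 ^ j * d / 2) powr (- (s + \<tau>)))"
    have "ball_integral \<nu> (\<lambda>w. defect z powr s / cmod (1 - herm z w) powr (s + \<tau>))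
      \<le> (\<integral>\<^sup>+w. (\<Sum>j. ennreal (c j) * indicator (T j) w) \<partial>\<nu>)"
    proof (rule nn_integral_mono)
      fix w :: "'n cvec"
      show "ennreal (defect z powr s / cmod (1 - herm z w) powr (s + \<tau>)) * indicator unit_ball w
        \<le> (\<Sum>j. ennreal (c j) * indicator (T j) w)"
      proof (cases "w \<in> unit_ball")
        case True
        define x y where "x = cmod (1 - herm w \<zeta>)" and "y = cmod (1 - herm z w)"
        have yy: "y = cmod (1 - herm w (norm z *\<^sub>R \<zeta>))"
          unfolding y_def by (subst \<zeta>(2)[symmetric]) (rule cmod_one_minus_herm_commute)
        have xy: "x \<le> 2 * y" unfolding yy x_def
          by (rule cmod_one_minus_herm_radial_le) (use \<zeta> z True in auto)
        have yd: "d \<le> y" unfolding y_def d_def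
          by (rule one_minus_norm_le_cmod_one_minus_herm) (use True in auto)
        \<comment> \<open>The first tube containing \<open>w\<close>: either \<open>j = 0\<close> and \<open>y \<ge> d\<close>, or \<open>x \<ge> 2\<^sup>jd\<close> and \<open>y \<ge> x/2\<close>.\<close>
        define P where "P = (\<lambda>j. x < 2 * 2 ^ j * d)"
        obtain i where "x / d < 2 ^ i" using real_arch_pow[of 2 "x / d"] by auto
        hence "x < 2 ^ i * d" using d by (simp add: field_simps)
        also have "\<dots> \<le> 2 * 2 ^ i * d" using d by simp
        finally have "P i" by (simp add: P_def)
        define j where "j = Least P"
        have j: "P j" unfolding j_def by (rule LeastI) fact
        have yj: "2 ^ j * d / 2 \<le> y"
        proof (cases j)
          case 0 thus ?thesis using yd d by simp
        next
          case (Suc k)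
          hence "\<not> P k" using not_less_Least[of k P] j_def by simp
          thus ?thesis using xy by (simp add: P_def Suc)
        qed
        have "defect z powr s / y powr (s + \<tau>) = defect z powr s * y powr (- (s + \<tau>))"
          by (simp only: powr_minus_divide) simp
        also have "\<dots> \<le> c j" unfolding c_def
          using d s \<tau> yj by (intro mult_mono powr_mono2 powr_mono2') auto
        finally have "ennreal (defect z powr s / y powr (s + \<tau>)) * indicator unit_ball w
           \<le> ennreal (c j) * indicator (T j) w"
          using True j by (auto simp: T_def carleson_tube_def P_def x_def ennreal_leI)
        also have "\<dots> = (\<Sum>j\<in>{j}. ennreal (c j) * indicator (T j) w)" by (subst sum.insert) auto
        also have "\<dots> \<le> (\<Sum>j. ennreal (c j) * indicator (T j) w)" by (rule sum_le_suminf) auto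
        finally show ?thesis by (simp add: y_def)
      qed simp
    qed
    also have "\<dots> = (\<Sum>j. ennreal (c j) * emeasure \<nu> (T j))"
      unfolding T_def by (subst nn_integral_suminf)
        (auto simp: nn_integral_cmult sets intro!: borel_measurable_indicator)
    also have "\<dots> \<le> (\<Sum>j. ennreal (A * q ^ j))"
    proof (rule suminf_le)
      fix j
      have "ennreal (c j) * emeasure \<nu> (T j) \<le> ennreal (c j) * ennreal (C * (2 * 2 ^ j * d) powr \<tau>)"
        unfolding T_def by (intro mult_left_mono car) (use \<zeta> d in auto)
      also have "\<dots> = ennreal (c j * (C * (2 * 2 ^ j * d) powr \<tau>))"
        using C by (intro ennreal_mult[symmetric]) (auto simp: c_def)
      also have "c j * (C * (2 * 2 ^ j * d) powr \<tau>) = A * q ^ j"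
      proof -
        \<comment> \<open>All powers of \<open>d\<close> cancel, which makes the bound uniform in \<open>z\<close>.\<close>
        have gen: "(2 * d) powr s * (a * d / 2) powr (- (s + \<tau>)) * (2 * a * d) powr \<tau>
          = 2 powr s * 2 powr (s + \<tau>) * 2 powr \<tau> * a powr (-s)" if "a > 0" for a :: real
          using d that by (simp add: powr_def ln_mult ln_div mult_exp_exp algebra_simps)
        have "q ^ j = (2 ^ j) powr (-s)" unfolding q_def by (subst power_powr_swap) auto
        thus ?thesis using gen[of "2 ^ j"] by (simp add: c_def A_def mult_ac)
      qed
      finally show "ennreal (c j) * emeasure \<nu> (T j) \<le> ennreal (A * q ^ j)" .
    qed auto
    also have "\<dots> = ennreal (A / (1 - q))"
      by (rule suminf_geometric_ennreal) (use q A in auto)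
    finally show "ball_integral \<nu> (\<lambda>w. defect z powr s / cmod (1 - herm z w) powr (s + \<tau>))
      \<le> ennreal (A / (1 - q))" .
  qed
qed

text \<open>The Berezin integral is evaluated at \<open>z = (1 - r)\<zeta>\<close>; when \<open>r \<ge> 1\<close> the integral at \<open>z = 0\<close>,
which is the total mass of the ball, is enough.\<close>

lemma berezin_imp_carleson:
  fixes \<nu> :: "('n::finite) cvec measure" and s \<tau> B :: real
  assumes sets [measurable_cong]: "sets \<nu> = sets borel" and s: "s > 0" and \<tau>: "\<tau> > 0" and B: "B > 0"
    and ber: "\<And>z. z \<in> unit_ball \<Longrightarrow>
      ball_integral \<nu> (\<lambda>w. defect z powr s / cmod (1 - herm z w) powr (s + \<tau>)) \<le> ennreal B"
    and r: "r > 0" and \<zeta>: "\<zeta> \<in> sphere 0 1"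
  shows "emeasure \<nu> (carleson_tube \<zeta> r) \<le> ennreal (B * 2 powr (s + \<tau>) * r powr \<tau>)"
proof (cases "r < 1")
  case True
  define z where "z = (1 - r) *\<^sub>R \<zeta>"
  have nz: "norm z = 1 - r" using True \<zeta> by (simp add: z_def)
  hence z: "z \<in> unit_ball" using r by simp
  have "ennreal (r powr s * (2 * r) powr (- (s + \<tau>))) * emeasure \<nu> (carleson_tube \<zeta> r)
     = (\<integral>\<^sup>+w. ennreal (r powr s * (2 * r) powr (- (s + \<tau>))) * indicator (carleson_tube \<zeta> r) w \<partial>\<nu>)"
    by (subst nn_integral_cmult) (auto simp: sets intro!: borel_measurable_indicator)
  also have "\<dots> \<le> ball_integral \<nu> (\<lambda>w. defect z powr s / cmod (1 - herm z w) powr (s + \<tau>))"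
  proof (rule nn_integral_mono)
    fix w :: "'n cvec"
    show "ennreal (r powr s * (2 * r) powr (- (s + \<tau>))) * indicator (carleson_tube \<zeta> r) w \<le>
      ennreal (defect z powr s / cmod (1 - herm z w) powr (s + \<tau>)) * indicator unit_ball w"
    proof (cases "w \<in> carleson_tube \<zeta> r")
      case True
      hence w: "norm w < 1" "cmod (1 - herm w \<zeta>) < r" by (auto simp: carleson_tube_def)
      have y: "cmod (1 - herm z w) \<le> 2 * r"
        using cmod_one_minus_herm_radial_le(2)[of \<zeta> w "1 - r"] w \<zeta> r \<open>r < 1\<close>
        by (subst cmod_one_minus_herm_commute) (simp add: z_def)
      have y0: "0 < cmod (1 - herm z w)"
        using one_minus_norm_le_cmod_one_minus_herm[of w z] w z unfolding mem_ball dist_0_norm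
          by linarith
      have "r \<le> defect z" using defect_bounds(1)[OF z] nz by simp
      hence "r powr s * (2 * r) powr (- (s + \<tau>))
        \<le> defect z powr s * cmod (1 - herm z w) powr (- (s + \<tau>))"
        using y y0 r s \<tau> by (intro mult_mono powr_mono2 powr_mono2') auto
      also have "\<dots> = defect z powr s / cmod (1 - herm z w) powr (s + \<tau>)"
        by (simp only: powr_minus_divide) simp
      finally show ?thesis using w by (simp add: ennreal_leI True)
    qed simp
  qed
  also have "\<dots> \<le> ennreal B" by (rule ber[OF z])
  also have "B = (r powr s * (2 * r) powr (- (s + \<tau>))) * (B * 2 powr (s + \<tau>) * r powr \<tau>)"
    using r by (simp add: powr_def ln_mult mult_exp_exp algebra_simps)
  also have "ennreal \<dots> = ennreal (r powr s * (2 * r) powr (- (s + \<tau>)))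
    * ennreal (B * 2 powr (s + \<tau>) * r powr \<tau>)"
    using B by (intro ennreal_mult) auto
  finally show ?thesis
    using r by (subst (asm) ennreal_mult_le_mult_iff) auto
next
  case False
  have "emeasure \<nu> (carleson_tube \<zeta> r) \<le> emeasure \<nu> unit_ball"
    by (rule emeasure_mono) (auto simp: carleson_tube_def sets)
  also have "\<dots> = (\<integral>\<^sup>+w. indicator unit_ball w \<partial>\<nu>)"
    by (subst nn_integral_indicator) (auto simp: sets)
  also have "\<dots> \<le> ennreal B" using ber[of 0] by (simp add: defect_def)
  also have "\<dots> \<le> ennreal (B * (2 powr (s + \<tau>) * r powr \<tau>))"
  proof (rule ennreal_leI)
    have "1 * 1 \<le> 2 powr (s + \<tau>) * r powr \<tau>"
      using s \<tau> False by (intro mult_mono ge_one_powr_ge_zero) auto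
    thus "B \<le> B * (2 powr (s + \<tau>) * r powr \<tau>)" using B by simp
  qed
  finally show ?thesis by (simp add: mult_ac)
qed

text \<open>The Forelli-Rudin estimate: weighted volume satisfies the tube condition with exponent
\<open>n + 1 + t\<close>, so its Berezin integrals are bounded.\<close>

lemma forelli_rudin:
  fixes t s :: real
  assumes t: "t > -1" and s: "s > 0"
  shows "\<exists>B>0. \<forall>z\<in>(unit_ball :: ('n::finite) cvec set).
    ball_integral lborel (\<lambda>w. defect w powr t / cmod (1 - herm w z) powr (CARD('n) + 1 + t + s))
      \<le> ennreal (B * defect z powr (-s))"
proof -
  define \<nu> :: "'n cvec measure" where "\<nu> = density lborel (\<lambda>w. ennreal (defect w powr t))"
  have sets: "sets \<nu> = sets borel" by (simp add: \<nu>_def)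
  obtain C where C: "C > 0" "\<And>r \<zeta>. r > 0 \<Longrightarrow> \<zeta> \<in> sphere (0::'n cvec) 1 \<Longrightarrow>
     (\<integral>\<^sup>+z. ennreal (defect z powr t) * indicator (carleson_tube \<zeta> r) z \<partial>lborel)
       \<le> ennreal (C * r powr (CARD('n) + 1 + t))"
    using weighted_volume_carleson_tube_le[OF t, where 'n='n] by (auto simp: mult_ac)
  have "CARD('n) + 1 + t > 0" using t by (simp add: add_nonneg_pos)
  moreover have "emeasure \<nu> (carleson_tube \<zeta> r) \<le> ennreal (C * r powr (CARD('n) + 1 + t))"
    if "r > 0" "\<zeta> \<in> sphere 0 1" for r \<zeta>
    using C(2)[OF that] by (simp add: \<nu>_def emeasure_density)
  ultimately obtain B where B: "B > 0" "\<And>z. z \<in> unit_ball \<Longrightarrow>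
    ball_integral \<nu> (\<lambda>w. defect z powr s / cmod (1 - herm z w) powr (s + (CARD('n) + 1 + t)))
      \<le> ennreal B"
    using carleson_imp_berezin[OF sets s _ C(1), of "CARD('n) + 1 + t"] by blast
  show ?thesis
  proof (intro exI[of _ B] conjI ballI)
    fix z :: "'n cvec" assume z: "z \<in> unit_ball"
    let ?J = "\<integral>\<^sup>+w. ennreal (defect w powr t / cmod (1 - herm w z) powr (CARD('n) + 1 + t + s))
      * indicator unit_ball w \<partial>lborel"
    have dz: "defect z > 0" by (rule defect_pos[OF z])
    have "ennreal (defect z powr s) * ?J = (\<integral>\<^sup>+w. ennreal (defect z powr s)
      * (ennreal (defect w powr t / cmod (1 - herm w z) powr (CARD('n) + 1 + t + s))
      * indicator unit_ball w) \<partial>lborel)"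
      by (subst nn_integral_cmult) (auto intro!: borel_measurable_indicator
        borel_measurable_times_ennreal)
    also have "\<dots> = (\<integral>\<^sup>+w. ennreal (defect w powr t)
      * (ennreal (defect z powr s / cmod (1 - herm z w) powr (s + (CARD('n) + 1 + t)))
      * indicator unit_ball w) \<partial>lborel)"
    proof (rule nn_integral_cong)
      fix w :: "'n cvec"
      have "CARD('n) + 1 + t + s = s + (CARD('n) + 1 + t)" by simp
      hence "defect z powr s * (defect w powr t / cmod (1 - herm w z) powr (CARD('n) + 1 + t + s)) =
         defect w powr t * (defect z powr s / cmod (1 - herm z w) powr (s + (CARD('n) + 1 + t)))"
        unfolding cmod_one_minus_herm_commute[of w z] by (simp only: times_divide_eq_right mult.commute)
      thus "ennreal (defect z powr s) * (ennreal (defect w powr t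
        / cmod (1 - herm w z) powr (CARD('n) + 1 + t + s)) * indicator unit_ball w) =
        ennreal (defect w powr t) * (ennreal (defect z powr s
          / cmod (1 - herm z w) powr (s + (CARD('n) + 1 + t))) * indicator unit_ball w)"
        unfolding mult.assoc[symmetric] by (simp only: ennreal_mult'[symmetric] powr_ge_zero)
    qed
    also have "\<dots> = ball_integral \<nu> (\<lambda>w. defect z powr s
      / cmod (1 - herm z w) powr (s + (CARD('n) + 1 + t)))"
    proof -
      have [measurable]: "(unit_ball :: 'n cvec set) \<in> sets lborel" by simp
      show ?thesis unfolding \<nu>_def by (rule nn_integral_density[symmetric]) measurable
    qed
    also have "\<dots> \<le> ennreal B" by (rule B(2)[OF z])
    also have "B = defect z powr s * (B * defect z powr (-s))"
      using dz by (simp add: powr_minus field_simps)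
    also have "ennreal \<dots> = ennreal (defect z powr s) * ennreal (B * defect z powr (-s))"
      using B(1) by (intro ennreal_mult) auto
    finally show "?J \<le> ennreal (B * defect z powr (-s))"
      using dz by (subst (asm) ennreal_mult_le_mult_iff) auto
  qed (rule B(1))
qed

section \<open>Lengths of paths in the Bergman metric\<close>

text \<open>The slab of Bergman size \<open>\<epsilon>\<close> around \<open>w\<close>. It stands in for Bergman balls because its volume and
measurability are explicit. The relation is not symmetric: the defect is taken at the first point.\<close>

definition near :: "real \<Rightarrow> ('n::finite) cvec \<Rightarrow> 'n cvec \<Rightarrow> bool"
  where "near \<epsilon> w u \<longleftrightarrow> norm (u - w) < \<epsilon> * sqrt (defect w) \<and> cmod (herm (u - w) w) < \<epsilon> * defect w"

text \<open>The lengths over which the Bergman distance takes the infimum, so that paths can be estimated and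
composed before passing to the infimum.\<close>

definition bergman_arc :: "('n::finite) cvec \<Rightarrow> 'n cvec \<Rightarrow> real \<Rightarrow> bool"
  where "bergman_arc z w L \<longleftrightarrow>
    (\<exists>\<gamma>. valid_path \<gamma> \<and> path_image \<gamma> \<subseteq> unit_ball \<and> pathstart \<gamma> = z \<and> pathfinish \<gamma> = w \<and>
           ((\<lambda>t. sqrt (bergman_form (\<gamma> t) (vector_derivative \<gamma> (at t)))) has_integral L) {0..1})"

lemma bergman_dist_eq_Inf_arc: "bergman_dist z w = Inf {L. bergman_arc z w L}"
  by (simp add: bergman_dist_def bergman_arc_def)

lemma bergman_form_eq_defect:
  "z \<in> unit_ball \<Longrightarrow> bergman_form z \<xi> = (norm \<xi>)\<^sup>2 / defect z + (cmod (herm \<xi> z))\<^sup>2 / (defect z)\<^sup>2"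
proof -
  assume z: "z \<in> unit_ball"
  have d: "defect z > 0" by (rule defect_pos[OF z])
  have "bergman_form z \<xi> = (defect z * (norm \<xi>)\<^sup>2 + (cmod (herm \<xi> z))\<^sup>2) / (defect z)\<^sup>2"
    unfolding defect_def using z by (intro bergman_form_eq) simp
  thus ?thesis using d by (simp add: add_divide_distrib power2_eq_square)
qed

lemma bergman_form_nonneg: "z \<in> unit_ball \<Longrightarrow> 0 \<le> bergman_form z \<xi>"
  using defect_pos[of z] by (simp add: bergman_form_eq_defect)

lemma norm_le_sqrt_bergman_form:
  assumes "z \<in> unit_ball"
  shows "norm \<xi> \<le> sqrt (bergman_form z \<xi>) * sqrt (defect z)"
    and "cmod (herm \<xi> z) \<le> sqrt (bergman_form z \<xi>) * defect z"
proof -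
  have d: "defect z > 0" by (rule defect_pos[OF assms])
  have "(norm \<xi>)\<^sup>2 / defect z \<le> bergman_form z \<xi>" "(cmod (herm \<xi> z))\<^sup>2 / (defect z)\<^sup>2
    \<le> bergman_form z \<xi>"
    using d by (simp_all add: bergman_form_eq_defect[OF assms])
  hence a: "(norm \<xi>)\<^sup>2 \<le> bergman_form z \<xi> * defect z" "(cmod (herm \<xi> z))\<^sup>2
    \<le> bergman_form z \<xi> * (defect z)\<^sup>2"
    using d by (simp_all add: pos_divide_le_eq)
  show "norm \<xi> \<le> sqrt (bergman_form z \<xi>) * sqrt (defect z)"
    using real_le_rsqrt[OF a(1)] by (simp add: real_sqrt_mult)
  show "cmod (herm \<xi> z) \<le> sqrt (bergman_form z \<xi>) * defect z"
    using real_le_rsqrt[OF a(2)] d by (simp add: real_sqrt_mult)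
qed

text \<open>A point \<open>z\<close> moving with unit Bergman speed changes \<open>ln |1 - \<langle>z,\<zeta>\<rangle>|\<close> at rate at most \<open>4\<close>. Writing
\<open>\<langle>\<xi>,\<zeta>\<rangle> = \<langle>\<xi>,z\<rangle> + \<langle>\<xi>,\<zeta> - z\<rangle>\<close>, the first term is controlled by the complex-radial part of the metric and
the second by its tangential part, as \<open>|\<zeta> - z|\<^sup>2\<close> and \<open>\<delta>(z)\<close> are both at most \<open>2|1 - \<langle>z,\<zeta>\<rangle>|\<close>.\<close>

lemma cmod_herm_le_bergman_form:
  assumes z: "z \<in> unit_ball" and \<zeta>: "norm \<zeta> \<le> 1"
  shows "cmod (herm \<xi> \<zeta>) \<le> 4 * sqrt (bergman_form z \<xi>) * cmod (1 - herm z \<zeta>)"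
proof -
  define g where "g = cmod (1 - herm z \<zeta>)"
  define F where "F = sqrt (bergman_form z \<xi>)"
  have F: "F \<ge> 0" using bergman_form_nonneg[OF z] by (simp add: F_def)
  have d: "0 < defect z" "defect z \<le> 2 * g"
    using defect_pos[OF z] defect_bounds[OF z] one_minus_norm_le_cmod_one_minus_herm[OF \<zeta>, of z]
      by (auto simp: g_def)
  have n: "norm (\<zeta> - z) \<le> sqrt (2 * g)"
    using norm_diff_squared_le[of z \<zeta>] z \<zeta> by (intro real_le_rsqrt) (auto simp: g_def)
  have "cmod (herm \<xi> \<zeta>) = cmod (herm \<xi> z + herm \<xi> (\<zeta> - z))" by (simp add: herm_diff_right)
  also have "\<dots> \<le> cmod (herm \<xi> z) + norm \<xi> * norm (\<zeta> - z)"
    using norm_triangle_ineq cmod_herm_le by (metis add_left_mono order_trans)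
  also have "\<dots> \<le> F * (2 * g) + (F * sqrt (2 * g)) * sqrt (2 * g)"
  proof (intro add_mono mult_mono)
    show "cmod (herm \<xi> z) \<le> F * (2 * g)"
      using norm_le_sqrt_bergman_form(2)[OF z, of \<xi>] mult_left_mono[OF d(2) F] by (simp add: F_def)
    have "sqrt (defect z) \<le> sqrt (2 * g)" using d by simp
    thus "norm \<xi> \<le> F * sqrt (2 * g)"
      using norm_le_sqrt_bergman_form(1)[OF z, of \<xi>] mult_left_mono[OF _ F] unfolding F_def
        by (meson order_trans)
  qed (use n F in \<open>auto simp: g_def\<close>)
  also have "\<dots> = 4 * F * g" using d by (simp add: mult.assoc)
  finally show ?thesis by (simp add: F_def g_def)
qed

text \<open>Integrate the rate of change of \<open>ln |1 - \<langle>\<gamma>(t),\<zeta>\<rangle>|\<close> along the path.\<close>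

lemma bergman_arc_distortion:
  assumes arc: "bergman_arc z a L" and \<zeta>: "norm \<zeta> \<le> 1"
  shows "cmod (1 - herm z \<zeta>) \<le> exp (4 * L) * cmod (1 - herm a \<zeta>)"
proof -
  obtain \<gamma> where g: "valid_path \<gamma>" "path_image \<gamma> \<subseteq> unit_ball" "\<gamma> 0 = z" "\<gamma> 1 = a"
    and int: "((\<lambda>t. sqrt (bergman_form (\<gamma> t) (vector_derivative \<gamma> (at t)))) has_integral L) {0..1}"
    using arc unfolding bergman_arc_def pathstart_def pathfinish_def by blast
  obtain S where S: "finite S" "\<And>x. x \<in> {0..1} - S \<Longrightarrow>
    \<gamma> differentiable (at x)" and cont: "continuous_on {0..1} \<gamma>"
    using g(1) by (auto simp: valid_path_def piecewise_C1_differentiable_on_def C1_differentiable_on_eq)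
  have ball: "\<gamma> t \<in> unit_ball" if "t \<in> {0..1}" for t
    using g(2) that unfolding path_image_def by blast
  define G where "G = (\<lambda>t. 1 - herm (\<gamma> t) \<zeta>)"
  define V where "V = (\<lambda>t. vector_derivative \<gamma> (at t))"
  define D where "D = (\<lambda>t. - (Re (G t) * Re (herm (V t) \<zeta>) + Im (G t) * Im (herm (V t) \<zeta>))
    / (cmod (G t))\<^sup>2)"
  have Gpos: "cmod (G t) > 0" if "t \<in> {0..1}" for t
    using one_minus_norm_le_cmod_one_minus_herm[OF \<zeta>, of "\<gamma> t"] ball[OF that]
      unfolding G_def mem_ball dist_0_norm by linarith
  have "(D has_integral ln (cmod (G 1)) - ln (cmod (G 0))) {0..1}"
  proof (rule fundamental_theorem_of_calculus_interior_strong[OF S(1)])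
    show "continuous_on {0..1} (\<lambda>t. ln (cmod (G t)))"
      unfolding G_def using Gpos by (intro continuous_intros cont) (auto simp: G_def)
    fix t :: real assume t: "t \<in> {0<..<1} - S"
    have "(\<gamma> has_vector_derivative V t) (at t)"
      using S(2)[of t] t unfolding V_def by (intro vector_derivative_works[THEN iffD1]) auto
    hence "((\<lambda>t. herm (\<gamma> t) \<zeta>) has_vector_derivative herm (V t) \<zeta>) (at t)"
      by (rule bounded_linear.has_vector_derivative[OF bounded_linear_herm_left])
    hence "((\<lambda>t. 1 - herm (\<gamma> t) \<zeta>) has_vector_derivative 0 - herm (V t) \<zeta>) (at t)"
      by (intro has_vector_derivative_diff has_vector_derivative_const)
    hence dG: "(G has_vector_derivative - herm (V t) \<zeta>) (at t)" by (simp add: G_def)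
    have r: "((\<lambda>t. Re (G t)) has_real_derivative Re (- herm (V t) \<zeta>)) (at t)"
      using bounded_linear.has_vector_derivative[OF bounded_linear_Re dG]
      by (simp add: has_real_derivative_iff_has_vector_derivative)
    have i: "((\<lambda>t. Im (G t)) has_real_derivative Im (- herm (V t) \<zeta>)) (at t)"
      using bounded_linear.has_vector_derivative[OF bounded_linear_Im dG]
      by (simp add: has_real_derivative_iff_has_vector_derivative)
    have p: "(Re (G t))\<^sup>2 + (Im (G t))\<^sup>2 > 0"
      using Gpos[of t] t by (simp add: cmod_def)
    have dln: "((\<lambda>t. ln ((Re (G t))\<^sup>2 + (Im (G t))\<^sup>2) / 2) has_real_derivative D t) (at t)"
    proof -
      have gen: "((\<lambda>t. ln ((x t)\<^sup>2 + (y t)\<^sup>2) / 2) has_real_derivative (x t * x' + y t * y')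
        / ((x t)\<^sup>2 + (y t)\<^sup>2)) (at t)"
        if "(x has_real_derivative x') (at t)" "(y has_real_derivative y') (at t)" "(x t)\<^sup>2
          + (y t)\<^sup>2 > 0"
        for x y :: "real \<Rightarrow> real" and x' y'
      proof -
        have half_ln: "((\<lambda>t. ln (h t) / 2) has_real_derivative h' / 2 / h t) (at t)"
          if "(h has_real_derivative h') (at t)" "h t > 0" for h :: "real \<Rightarrow> real" and h'
          using that by (auto intro!: derivative_eq_intros)
        have d: "((\<lambda>t. (x t)\<^sup>2 + (y t)\<^sup>2) has_real_derivative 2 * (x t * x' + y t * y')) (at t)"
          using that(1,2) by (auto intro!: derivative_eq_intros)
        have e: "2 * (x t * x' + y t * y') / 2 = x t * x' + y t * y'" by simp
        show ?thesis using half_ln[where h = "\<lambda>t. (x t)\<^sup>2 + (y t)\<^sup>2", OF d that(3)] unfolding e .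
      qed
      have "D t = (Re (G t) * Re (- herm (V t) \<zeta>) + Im (G t) * Im (- herm (V t) \<zeta>))
        / ((Re (G t))\<^sup>2 + (Im (G t))\<^sup>2)"
        unfolding D_def cmod_power2 by simp
      thus ?thesis using gen[OF r i p] by simp
    qed
    have eq: "(\<lambda>t. ln (cmod (G t))) = (\<lambda>t. ln ((Re (G t))\<^sup>2 + (Im (G t))\<^sup>2) / 2)"
      by (simp add: fun_eq_iff cmod_def ln_sqrt)
    show "((\<lambda>t. ln (cmod (G t))) has_vector_derivative D t) (at t)"
      unfolding eq has_real_derivative_iff_has_vector_derivative[symmetric] by (rule dln)
  qed auto
  from has_integral_neg[OF this]
  have "((\<lambda>t. - D t) has_integral (ln (cmod (G 0)) - ln (cmod (G 1)))) {0..1}" by simp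
  moreover have "((\<lambda>t. 4 * sqrt (bergman_form (\<gamma> t) (V t))) has_integral 4 * L) {0..1}"
    unfolding V_def by (intro has_integral_mult_right int)
  moreover have "- D t \<le> 4 * sqrt (bergman_form (\<gamma> t) (V t))" if t: "t \<in> {0..1}" for t
  proof -
    have "- D t = Re (cnj (G t) * herm (V t) \<zeta>) / (cmod (G t))\<^sup>2" by (simp add: D_def minus_divide_left)
    also have "\<dots> \<le> cmod (cnj (G t) * herm (V t) \<zeta>) / (cmod (G t))\<^sup>2"
      by (intro divide_right_mono complex_Re_le_cmod) auto
    also have "\<dots> = cmod (herm (V t) \<zeta>) / cmod (G t)"
      using Gpos[OF t] by (simp add: norm_mult power2_eq_square)
    also have "\<dots> \<le> 4 * sqrt (bergman_form (\<gamma> t) (V t))"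
      using cmod_herm_le_bergman_form[OF ball[OF t] \<zeta>, of "V t"] Gpos[OF t]
      by (simp add: G_def divide_le_eq)
    finally show ?thesis .
  qed
  ultimately have "ln (cmod (G 0)) - ln (cmod (G 1)) \<le> 4 * L"
    by (rule has_integral_le) auto
  hence "ln (cmod (G 0)) \<le> 4 * L + ln (cmod (G 1))" by simp
  hence "exp (ln (cmod (G 0))) \<le> exp (4 * L + ln (cmod (G 1)))" by simp
  hence "cmod (G 0) \<le> exp (4 * L) * cmod (G 1)" using Gpos by (simp add: exp_add)
  thus ?thesis by (simp add: G_def g)
qed

lemma bergman_arc_nonneg: assumes "bergman_arc z w L" shows "0 \<le> L"
proof -
  obtain \<gamma> where g: "valid_path \<gamma>" "path_image \<gamma> \<subseteq> unit_ball" "pathstart \<gamma> = z" "pathfinish \<gamma> = w"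
    and int: "((\<lambda>t. sqrt (bergman_form (\<gamma> t) (vector_derivative \<gamma> (at t)))) has_integral L) {0..1}"
    using assms unfolding bergman_arc_def by blast
  show ?thesis
  proof (rule has_integral_nonneg[OF int])
    fix t :: real assume "t \<in> {0..1}"
    hence "\<gamma> t \<in> unit_ball" using g(2) unfolding path_image_def by blast
    thus "0 \<le> sqrt (bergman_form (\<gamma> t) (vector_derivative \<gamma> (at t)))"
      using bergman_form_nonneg by simp
  qed
qed

lemma bergman_arc_segment:
  assumes z: "z \<in> unit_ball" and w: "w \<in> unit_ball"
    and bound: "\<And>v. v \<in> closed_segment z w \<Longrightarrow> sqrt (bergman_form v (w - z)) \<le> B"
  shows "\<exists>L\<le>B. bergman_arc z w L"
proof -
  have sub: "closed_segment z w \<subseteq> unit_ball" using z w by (intro closed_segment_subset) auto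
  have l: "linepath z w t \<in> closed_segment z w" if "t \<in> {0..1}" for t
    using that by (auto simp: linepath_in_path)
  let ?f = "\<lambda>t. sqrt (bergman_form (linepath z w t) (w - z))"
  have "?f integrable_on {0..1}"
  proof (rule integrable_continuous_interval)
    have "continuous_on {0..1} (\<lambda>t. sqrt ((norm (w - z))\<^sup>2 / defect (linepath z w t)
      + (cmod (herm (w - z) (linepath z w t)))\<^sup>2 / (defect (linepath z w t))\<^sup>2))"
    proof (intro continuous_intros ballI continuous_on_linepath)
      fix t :: real assume "t \<in> {0..1}"
      hence "defect (linepath z w t) > 0" using l sub by (intro defect_pos) blast
      thus "defect (linepath z w t) \<noteq> 0" "(defect (linepath z w t))\<^sup>2 \<noteq> 0" by auto
    qed
    thus "continuous_on {0..1} ?f"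
    proof (rule continuous_on_eq)
      fix t :: real assume "t \<in> {0..1}"
      hence "linepath z w t \<in> unit_ball" using l sub by blast
      thus "sqrt ((norm (w - z))\<^sup>2 / defect (linepath z w t)
        + (cmod (herm (w - z) (linepath z w t)))\<^sup>2 / (defect (linepath z w t))\<^sup>2) = ?f t"
        by (simp only: bergman_form_eq_defect)
    qed
  qed
  then obtain L where L: "(?f has_integral L) {0..1}" by blast
  have "bergman_arc z w L"
    unfolding bergman_arc_def
    using L sub by (intro exI[of _ "linepath z w"]) (simp add: path_image_linepath)
  moreover have "L \<le> B"
    using has_integral_le[OF L has_integral_const_real[of B 0 1]] bound l by simp
  ultimately show ?thesis by blast
qed

lemma bergman_form_scaleR: "z \<in> unit_ball \<Longrightarrow> sqrt (bergman_form z (c *\<^sub>R \<xi>))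
  = \<bar>c\<bar> * sqrt (bergman_form z \<xi>)"
proof -
  assume z: "z \<in> unit_ball"
  have "bergman_form z (c *\<^sub>R \<xi>) = c\<^sup>2 * bergman_form z \<xi>"
    unfolding bergman_form_eq_defect[OF z]
    by (simp add: herm_scaleR_left norm_mult power_mult_distrib distrib_left)
  thus ?thesis by (simp add: real_sqrt_mult)
qed

text \<open>Concatenation adds lengths, by the substitution that computes contour integrals over joined
paths. It is what makes Bergman balls open.\<close>

lemma bergman_arc_trans:
  assumes "bergman_arc x y L1" "bergman_arc y z L2"
  shows "bergman_arc x z (L1 + L2)"
proof -
  obtain g1 where g1: "valid_path g1" "path_image g1 \<subseteq> unit_ball" "pathstart g1 = x" "pathfinish g1 = y"
    and int1: "((\<lambda>t. sqrt (bergman_form (g1 t) (vector_derivative g1 (at t)))) has_integral L1) {0..1}"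
    using assms(1) unfolding bergman_arc_def by blast
  obtain g2 where g2: "valid_path g2" "path_image g2 \<subseteq> unit_ball" "pathstart g2 = y" "pathfinish g2 = z"
    and int2: "((\<lambda>t. sqrt (bergman_form (g2 t) (vector_derivative g2 (at t)))) has_integral L2) {0..1}"
    using assms(2) unfolding bergman_arc_def by blast
  let ?g = "g1 +++ g2"
  obtain s1 s2
    where s1: "finite s1" "\<forall>x\<in>{0..1} - s1. g1 differentiable at x"
      and s2: "finite s2" "\<forall>x\<in>{0..1} - s2. g2 differentiable at x"
    using g1(1) g2(1)
    by (auto simp: valid_path_def piecewise_C1_differentiable_on_def C1_differentiable_on_eq)
  have b1: "g1 t \<in> unit_ball" if "0 \<le> t" "t \<le> 1" for t using g1(2) that unfolding path_image_def
    by (meson atLeastAtMost_iff image_subset_iff)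
  have b2: "g2 t \<in> unit_ball" if "0 \<le> t" "t \<le> 1" for t using g2(2) that unfolding path_image_def
    by (meson atLeastAtMost_iff image_subset_iff)
  have i1: "((\<lambda>t. 2 * sqrt (bergman_form (g1 (2*t)) (vector_derivative g1 (at (2*t))))) has_integral
    L1) {0..1/2}"
   and i2: "((\<lambda>t. 2 * sqrt (bergman_form (g2 (2*t - 1)) (vector_derivative g2 (at (2*t - 1)))))
     has_integral L2) {1/2..1}"
    using has_integral_affinity01 [OF int1, where m= 2 and c=0, THEN has_integral_cmul [where c=2]]
          has_integral_affinity01 [OF int2, where m= 2 and c="-1", THEN has_integral_cmul [where c=2]]
    by (simp_all only: image_affinity_atLeastAtMost_div_diff, simp_all)
  have v1: "vector_derivative ?g (at t) = 2 *\<^sub>R vector_derivative g1 (at (2*t))"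
    if "0 \<le> t" "2*t < 1" "2*t \<notin> s1" for t
  proof (rule vector_derivative_at [OF has_vector_derivative_transform_within])
    show "0 < \<bar>t - 1/2\<bar>" using that by auto
    have "((*) 2 has_vector_derivative 2) (at t)"
      by (simp add: has_vector_derivative_def has_derivative_def bounded_linear_mult_left)
    moreover have "(g1 has_vector_derivative vector_derivative g1 (at (2 * t))) (at (2 * t))"
      using s1 that by (auto simp: vector_derivative_works)
    ultimately show "((\<lambda>x. g1 (2 * x)) has_vector_derivative 2 *\<^sub>R vector_derivative g1
      (at (2 * t))) (at t)"
      by (intro vector_diff_chain_at [simplified o_def])
  qed (use that in \<open>simp_all add: joinpaths_def dist_real_def abs_if split: if_split_asm\<close>)
  have v2: "vector_derivative ?g (at t) = 2 *\<^sub>R vector_derivative g2 (at (2*t - 1))"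
    if "1 < 2*t" "t \<le> 1" "2*t - 1 \<notin> s2" for t
  proof (rule vector_derivative_at [OF has_vector_derivative_transform_within])
    show "0 < \<bar>t - 1/2\<bar>" using that by auto
    have "((\<lambda>x. 2 * x - 1) has_vector_derivative 2) (at t)"
      by (simp add: has_vector_derivative_def has_derivative_def bounded_linear_mult_left)
    moreover have "(g2 has_vector_derivative vector_derivative g2 (at (2 * t - 1))) (at (2 * t - 1))"
      using s2 that by (auto simp: vector_derivative_works)
    ultimately show "((\<lambda>x. g2 (2 * x - 1)) has_vector_derivative 2 *\<^sub>R vector_derivative g2
      (at (2 * t - 1))) (at t)"
      by (intro vector_diff_chain_at [simplified o_def])
  qed (use that in \<open>simp_all add: joinpaths_def dist_real_def abs_if split: if_split_asm\<close>)
  have "((\<lambda>t. sqrt (bergman_form (?g t) (vector_derivative ?g (at t)))) has_integral L1) {0..1/2}"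
  proof (rule has_integral_spike_finite [OF _ _ i1])
    show "finite (insert (1/2) ((*) 2 -` s1))"
      using s1 by (force intro: finite_vimageI [where h = "(*)2"] inj_onI)
    fix t assume "t \<in> {0..1/2} - insert (1/2) ((*) 2 -` s1)"
    hence t: "0 \<le> t" "2*t < 1" "2*t \<notin> s1" by auto
    have "?g t = g1 (2*t)" using t by (simp add: joinpaths_def)
    thus "sqrt (bergman_form (?g t) (vector_derivative ?g (at t))) =
        2 * sqrt (bergman_form (g1 (2*t)) (vector_derivative g1 (at (2*t))))"
      using bergman_form_scaleR[OF b1, of "2*t" 2] t by (simp add: v1[OF t])
  qed
  moreover have "((\<lambda>t. sqrt (bergman_form (?g t) (vector_derivative ?g (at t)))) has_integral L2)
    {1/2..1}"
  proof (rule has_integral_spike_finite [OF _ _ i2])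
    show "finite (insert (1/2) ((\<lambda>x. 2 * x - 1) -` s2))"
      using s2 by (force intro: finite_vimageI [where h = "\<lambda>x. 2*x-1"] inj_onI)
    fix t assume "t \<in> {1/2..1} - insert (1/2) ((\<lambda>x. 2 * x - 1) -` s2)"
    hence t: "1 < 2*t" "t \<le> 1" "2*t - 1 \<notin> s2" by auto
    have "?g t = g2 (2*t - 1)" using t by (simp add: joinpaths_def)
    thus "sqrt (bergman_form (?g t) (vector_derivative ?g (at t))) =
        2 * sqrt (bergman_form (g2 (2*t - 1)) (vector_derivative g2 (at (2*t - 1))))"
      using bergman_form_scaleR[OF b2, of "2*t - 1" 2] t by (simp add: v2[OF t])
  qed
  ultimately have "((\<lambda>t. sqrt (bergman_form (?g t) (vector_derivative ?g (at t)))) has_integral L1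
    + L2) {0..1}"
    by (simp add: has_integral_combine [where c = "1/2"])
  thus ?thesis unfolding bergman_arc_def
    using g1 g2 by (intro exI[of _ ?g]) (auto intro: valid_path_join simp: path_image_join)
qed

lemma bergman_dist_le: "bergman_arc z w L \<Longrightarrow> bergman_dist z w \<le> L"
  unfolding bergman_dist_eq_Inf_arc
  by (rule cInf_lower) (auto intro!: bdd_belowI[of _ 0] bergman_arc_nonneg)

lemma bergman_arc_exists:
  assumes z: "z \<in> unit_ball" and w: "w \<in> unit_ball"
  shows "\<exists>L. bergman_arc z w L"
proof -
  have sub: "closed_segment z w \<subseteq> unit_ball" using z w by (intro closed_segment_subset) auto
  have "continuous_on (closed_segment z w) (\<lambda>v. sqrt ((norm (w - z))\<^sup>2 / defect v
    + (cmod (herm (w - z) v))\<^sup>2 / (defect v)\<^sup>2))"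
  proof (intro continuous_intros ballI)
    fix v assume "v \<in> closed_segment z w"
    hence "defect v > 0" using sub by (intro defect_pos) blast
    thus "defect v \<noteq> 0" "(defect v)\<^sup>2 \<noteq> 0" by auto
  qed
  hence "continuous_on (closed_segment z w) (\<lambda>v. sqrt (bergman_form v (w - z)))"
    by (rule continuous_on_eq) (use sub in \<open>auto simp: bergman_form_eq_defect subset_iff\<close>)
  then obtain x where "\<And>v. v \<in> closed_segment z w \<Longrightarrow> sqrt (bergman_form v (w - z))
    \<le> sqrt (bergman_form x (w - z))"
    using continuous_attains_sup[of "closed_segment z w" "\<lambda>v. sqrt (bergman_form v (w - z))"] by auto
  from bergman_arc_segment[OF z w this] show ?thesis by blast
qed

lemma bergman_dist_less_imp_arc:
  assumes "z \<in> unit_ball" "w \<in> unit_ball" "bergman_dist z w < R"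
  shows "\<exists>L<R. bergman_arc z w L"
proof -
  have "{L. bergman_arc z w L} \<noteq> {}" using bergman_arc_exists[OF assms(1,2)] by blast
  from cInf_lessD[OF this assms(3)[unfolded bergman_dist_eq_Inf_arc]] show ?thesis by auto
qed

text \<open>With \<open>\<zeta> = a/|a|\<close> the distorted quantity starts at \<open>|1 - \<langle>a,\<zeta>\<rangle>| = 1 - |a|\<close>.\<close>

lemma bergman_ball_subset_carleson_tube:
  assumes a: "a \<in> unit_ball" 
  shows "\<exists>\<zeta>\<in>sphere 0 1. bergman_ball a R \<subseteq> carleson_tube \<zeta> (exp (4 * R) * defect a)"
proof -
  obtain \<zeta> where \<zeta>: "\<zeta> \<in> sphere 0 1" "a = norm a *\<^sub>R \<zeta>"
    using unit_direction_exists[of a] by blast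
  have "1 - herm a \<zeta> = of_real (1 - norm a)"
    using \<zeta>(1) by (subst \<zeta>(2)) (simp add: herm_scaleR_left herm_self)
  hence ha: "cmod (1 - herm a \<zeta>) = 1 - norm a" using a by (simp only: norm_of_real) simp
  have "z \<in> carleson_tube \<zeta> (exp (4 * R) * defect a)" if z: "z \<in> bergman_ball a R" for z
  proof -
    have zb: "z \<in> unit_ball" "bergman_dist z a < R" using z by (auto simp: bergman_ball_def)
    obtain L where L: "L < R" "bergman_arc z a L" using bergman_dist_less_imp_arc[OF zb(1) a zb(2)]
      by blast
    have "cmod (1 - herm z \<zeta>) \<le> exp (4 * L) * (1 - norm a)"
      using bergman_arc_distortion[OF L(2), of \<zeta>] \<zeta> ha by simp
    also have "\<dots> < exp (4 * R) * (1 - norm a)" using L a by (intro mult_strict_right_mono) auto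
    also have "\<dots> \<le> exp (4 * R) * defect a" using defect_bounds[OF a] by simp
    finally show ?thesis using zb by (simp add: carleson_tube_def)
  qed
  thus ?thesis using \<zeta>(1) by blast
qed

section \<open>Explicit neighbourhoods of Bergman size\<close>

text \<open>The defect changes by \<open>-2 Re \<langle>\<xi>,w\<rangle> - |\<xi>|\<^sup>2\<close>, and both terms are small multiples of \<open>\<delta>(w)\<close>: it
is for the first one that the slab must be thin in the direction of \<open>w\<close>.\<close>

lemma near_perturb:
  assumes w: "w \<in> unit_ball" and e: "0 < \<epsilon>" "\<epsilon> \<le> 1/8"
    and n: "norm \<xi> \<le> \<epsilon> * sqrt (defect w)" "cmod (herm \<xi> w) \<le> \<epsilon> * defect w"
  shows "\<bar>defect (w + \<xi>) - defect w\<bar> \<le> 3 * \<epsilon> * defect w" and "w + \<xi> \<in> unit_ball"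
    and "cmod (herm \<xi> (w + \<xi>)) \<le> 2 * \<epsilon> * defect w"
proof -
  have d: "defect w > 0" by (rule defect_pos[OF w])
  have n2: "(norm \<xi>)\<^sup>2 \<le> \<epsilon>\<^sup>2 * defect w"
    using power_mono[OF n(1), of 2] d by (simp add: power_mult_distrib)
  also have "\<dots> \<le> \<epsilon> * defect w"
    using e d by (intro mult_right_mono) (auto simp: power2_eq_square mult_le_cancel_left1)
  finally have n3: "(norm \<xi>)\<^sup>2 \<le> \<epsilon> * defect w" .
  have "defect (w + \<xi>) - defect w = - 2 * Re (herm \<xi> w) - (norm \<xi>)\<^sup>2"
    unfolding defect_def Re_herm by (simp add: power2_norm_eq_inner algebra_simps inner_commute)
  moreover have "\<bar>Re (herm \<xi> w)\<bar> \<le> \<epsilon> * defect w" using abs_Re_le_cmod[of "herm \<xi> w"] n(2) by linarith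
  moreover have "0 \<le> (norm \<xi>)\<^sup>2" by simp
  ultimately show A: "\<bar>defect (w + \<xi>) - defect w\<bar> \<le> 3 * \<epsilon> * defect w" using n3 by linarith
  have "3 * \<epsilon> * defect w \<le> (3/8) * defect w" using e d by (intro mult_right_mono) auto
  hence "defect (w + \<xi>) > 0" using A d by linarith
  thus "w + \<xi> \<in> unit_ball" by (simp add: defect_def abs_square_less_1)
  have "cmod (herm \<xi> (w + \<xi>)) \<le> cmod (herm \<xi> w) + cmod (herm \<xi> \<xi>)"
    unfolding herm_add_right by (rule norm_triangle_ineq)
  also have "cmod (herm \<xi> \<xi>) = (norm \<xi>)\<^sup>2" by (simp add: herm_self norm_power)
  finally show "cmod (herm \<xi> (w + \<xi>)) \<le> 2 * \<epsilon> * defect w" using n(2) n3 by simp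
qed

lemma near_props:
  assumes w: "w \<in> unit_ball" and e: "0 < \<epsilon>" "\<epsilon> \<le> 1/8" and n: "near \<epsilon> w u"
  shows "u \<in> unit_ball" "defect u \<le> 2 * defect w" "defect w \<le> 2 * defect u"
    "cmod (herm (u - w) u) \<le> 2 * \<epsilon> * defect w"
proof -
  have n': "norm (u - w) \<le> \<epsilon> * sqrt (defect w)" "cmod (herm (u - w) w) \<le> \<epsilon> * defect w"
    using n by (auto simp: near_def)
  note p = near_perturb[OF w e n']
  have d: "defect w > 0" by (rule defect_pos[OF w])
  have "3 * \<epsilon> * defect w \<le> (3/8) * defect w" using e d by (intro mult_right_mono) auto
  thus "u \<in> unit_ball" "defect u \<le> 2 * defect w" "defect w \<le> 2 * defect u"
    "cmod (herm (u - w) u) \<le> 2 * \<epsilon> * defect w"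
    using p d by (simp_all, linarith+)
qed

text \<open>On the straight segment the Bergman form is at most \<open>18\<epsilon>\<^sup>2
  \<le> (5\<epsilon>)\<^sup>2\<close>, because the defect is at least
half of its initial value.\<close>

lemma near_imp_bergman_arc:
  assumes w: "w \<in> unit_ball" and e: "0 < \<epsilon>" "\<epsilon> \<le> 1/8" and n: "near \<epsilon> w u"
  shows "\<exists>L\<le>5 * \<epsilon>. bergman_arc w u L"
proof (rule bergman_arc_segment[OF w near_props(1)[OF assms]])
  fix v assume "v \<in> closed_segment w u"
  then obtain t where t: "0 \<le> t" "t \<le> 1" "v = w + t *\<^sub>R (u - w)"
    by (auto simp: in_segment algebra_simps)
  have d: "defect w > 0" by (rule defect_pos[OF w])
  define \<xi> where "\<xi> = u - w"
  have n': "norm \<xi> \<le> \<epsilon> * sqrt (defect w)" "cmod (herm \<xi> w) \<le> \<epsilon> * defect w"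
    using n by (auto simp: near_def \<xi>_def)
  have "norm (t *\<^sub>R \<xi>) \<le> norm \<xi>" "cmod (herm (t *\<^sub>R \<xi>) w) \<le> cmod (herm \<xi> w)"
    using t by (auto simp: herm_scaleR_left norm_mult mult_left_le_one_le)
  with n' have n'': "norm (t *\<^sub>R \<xi>) \<le> \<epsilon> * sqrt (defect w)" "cmod (herm (t *\<^sub>R \<xi>) w) \<le> \<epsilon> * defect w"
    by linarith+
  note p = near_perturb[OF w e n'', folded t(3)[folded \<xi>_def]]
  have "3 * \<epsilon> * defect w \<le> (3/8) * defect w" using e d by (intro mult_right_mono) auto
  hence dv: "defect w / 2 \<le> defect v" using p(1) d by linarith
  have nx: "(norm \<xi>)\<^sup>2 \<le> \<epsilon>\<^sup>2 * defect w"
    using power_mono[OF n'(1), of 2] d by (simp add: power_mult_distrib)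
  have "\<epsilon>\<^sup>2 * defect w \<le> \<epsilon> * defect w"
    using e d by (intro mult_right_mono) (auto simp: power2_eq_square mult_le_cancel_left1)
  have "cmod (herm \<xi> v) \<le> cmod (herm \<xi> w) + t * (norm \<xi>)\<^sup>2"
    unfolding t(3) \<xi>_def[symmetric] herm_add_right herm_scaleR_right herm_self
    using norm_triangle_ineq[of "herm \<xi> w" "of_real t * of_real ((norm \<xi>)\<^sup>2)"] t
      by (simp add: norm_mult norm_power)
  also have "t * (norm \<xi>)\<^sup>2 \<le> (norm \<xi>)\<^sup>2" using t by (simp add: mult_left_le_one_le)
  also have "cmod (herm \<xi> w) + (norm \<xi>)\<^sup>2 \<le> 2 * \<epsilon> * defect w"
    using n'(2) nx \<open>\<epsilon>\<^sup>2 * defect w \<le> \<epsilon> * defect w\<close> by simp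
  finally have hv: "cmod (herm \<xi> v) \<le> 2 * \<epsilon> * defect w" by simp
  have "bergman_form v \<xi> \<le> (\<epsilon>\<^sup>2 * defect w) / (defect w / 2) + (2 * \<epsilon> * defect w)\<^sup>2 / (defect w / 2)\<^sup>2"
    unfolding bergman_form_eq_defect[OF p(2)]
    using dv d nx hv by (intro add_mono frac_le power_mono) auto
  also have "\<dots> = 18 * \<epsilon>\<^sup>2" using d by (simp add: power2_eq_square)
  also have "\<dots> \<le> (5 * \<epsilon>)\<^sup>2" by (simp add: power_mult_distrib)
  finally show "sqrt (bergman_form v (u - w)) \<le> 5 * \<epsilon>"
    using e by (simp add: real_le_lsqrt \<xi>_def)
qed

lemma near_imp_bergman_ball:
  assumes "w \<in> unit_ball" "0 < \<epsilon>" "\<epsilon> \<le> 1/8" "near \<epsilon> w u" "5 * \<epsilon> < R"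
  shows "w \<in> bergman_ball u R"
  using near_imp_bergman_arc[OF assms(1-4)] bergman_dist_le[of w u] assms(1,5)
  by (fastforce simp: bergman_ball_def)

lemma open_near_source: "open {w \<in> unit_ball. near \<epsilon> w u}"
proof -
  have "{w \<in> unit_ball. near \<epsilon> w u} = unit_ball \<inter> {w. norm (u - w)
    < \<epsilon> * sqrt (defect w)} \<inter> {w. cmod (herm (u - w) w) < \<epsilon> * defect w}"
    by (auto simp: near_def)
  also have "open \<dots>" by (intro open_Int open_ball open_Collect_less continuous_intros)
  finally show ?thesis .
qed

lemma near_refl: "w \<in> unit_ball \<Longrightarrow> 0 < \<epsilon> \<Longrightarrow> near \<epsilon> w w"
  using defect_pos[of w] by (simp add: near_def)

text \<open>A point near \<open>z\<close> reaches \<open>a\<close> by a short segment to \<open>z\<close> followed by a path that realises the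
distance up to the available slack. Openness provides the measurability of Bergman balls.\<close>

lemma open_bergman_ball:
  assumes a: "a \<in> unit_ball" shows "open (bergman_ball a R)"
proof (rule openI)
  fix z assume "z \<in> bergman_ball a R"
  hence z: "z \<in> unit_ball" "bergman_dist z a < R" by (auto simp: bergman_ball_def)
  obtain L where L: "L < R" "bergman_arc z a L" using bergman_dist_less_imp_arc[OF z(1) a z(2)] by blast
  define \<epsilon> where "\<epsilon> = min (1/8) ((R - L) / 6)"
  have e: "0 < \<epsilon>" "\<epsilon> \<le> 1/8" "5 * \<epsilon> < R - L" using L by (auto simp: \<epsilon>_def min_def)
  have "z \<in> {w \<in> unit_ball. near \<epsilon> w z}" using z near_refl e by simp
  then obtain r where r: "r > 0" "ball z r \<subseteq> {w \<in> unit_ball. near \<epsilon> w z}"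
    using open_contains_ball[of "{w \<in> unit_ball. near \<epsilon> w z}"] open_near_source by blast
  have "ball z r \<subseteq> bergman_ball a R"
  proof
    fix w assume "w \<in> ball z r"
    hence w: "w \<in> unit_ball" "near \<epsilon> w z" using r by auto
    obtain L1 where "L1 \<le> 5 * \<epsilon>" "bergman_arc w z L1"
      using near_imp_bergman_arc[OF w(1) e(1,2) w(2)] by blast
    with bergman_arc_trans[OF this(2) L(2)] e(3) have "bergman_dist w a < R"
      using bergman_dist_le[of w a "L1 + L"] by simp
    thus "w \<in> bergman_ball a R" using w by (simp add: bergman_ball_def)
  qed
  thus "\<exists>e>0. ball z e \<subseteq> bergman_ball a R" using r by blast
qed

section \<open>Holomorphic functions of several variables\<close>

lemma bounded_linear_smult_left: "bounded_linear (\<lambda>c::complex. c *s (v::('n::finite) cvec))"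
  by (rule bounded_linear_intro[where K = "norm v"])
     (auto simp: vec_eq_iff algebra_simps norm_smult_vec)

lemma holomorphic_vecD:
  assumes "f holomorphic_vec_on S" "z \<in> S"
  shows "(f has_derivative frechet_derivative f (at z)) (at z)"
    and "frechet_derivative f (at z) (c *s x) = c * frechet_derivative f (at z) x"
proof -
  obtain D where D: "(f has_derivative D) (at z)" "\<And>c x. D (c *s x) = c * D x"
    using assms by (auto simp: holomorphic_vec_on_def)
  moreover have "D = frechet_derivative f (at z)" by (rule frechet_derivative_at[OF D(1)])
  ultimately show "(f has_derivative frechet_derivative f (at z)) (at z)"
    and "frechet_derivative f (at z) (c *s x) = c * frechet_derivative f (at z) x" by auto
qed

lemma holomorphic_vec_continuous_on:
  assumes "f holomorphic_vec_on S" shows "continuous_on S f"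
  using holomorphic_vecD(1)[OF assms] by (meson continuous_at_imp_continuous_on
    has_derivative_continuous)

lemma holomorphic_vec_DERIV_line:
  fixes z v :: "('n::finite) cvec"
  assumes f: "f holomorphic_vec_on S" and c: "z + c *s v \<in> S"
  shows "((\<lambda>c. f (z + c *s v)) has_field_derivative frechet_derivative f (at (z + c *s v)) v) (at c)"
proof -
  have l: "((\<lambda>c. z + c *s v) has_derivative (\<lambda>h. h *s v)) (at c)"
    using has_derivative_add[OF has_derivative_const bounded_linear_imp_has_derivative[OF
      bounded_linear_smult_left]]
    by simp
  have "((\<lambda>c. f (z + c *s v)) has_derivative (\<lambda>h. frechet_derivative f (at (z + c *s v)) (h *s v)))
    (at c)"
    using has_derivative_compose[OF l holomorphic_vecD(1)[OF f c]] .
  moreover have "(\<lambda>h. frechet_derivative f (at (z + c *s v)) (h *s v))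
    = (*) (frechet_derivative f (at (z + c *s v)) v)"
    by (simp add: fun_eq_iff holomorphic_vecD(2)[OF f c] mult.commute)
  ultimately show ?thesis unfolding has_field_derivative_def by simp
qed

lemma holomorphic_vec_line:
  fixes z v :: "('n::finite) cvec"
  assumes f: "f holomorphic_vec_on S" and A: "\<And>c. c \<in> A \<Longrightarrow> z + c *s v \<in> S"
  shows "(\<lambda>c. f (z + c *s v)) holomorphic_on A"
  unfolding holomorphic_on_def field_differentiable_def
  using holomorphic_vec_DERIV_line[OF f A] by (meson has_field_derivative_at_within)

lemma cpartial_eq:
  assumes f: "f holomorphic_vec_on S" and z: "z \<in> S"
  shows "cpartial j f z = frechet_derivative f (at z) (axis j 1)"
proof -
  have "axis j c = c *s axis j (1::complex)" for c by (simp add: vec_eq_iff axis_def)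
  hence "cpartial j f z = deriv (\<lambda>c. f (z + c *s axis j 1)) 0" unfolding cpartial_def by metis
  thus ?thesis using holomorphic_vec_DERIV_line[OF f, of z 0 "axis j 1"] z
    by (simp add: DERIV_imp_deriv)
qed

lemma radial_deriv_eq:
  assumes f: "f holomorphic_vec_on S" and z: "z \<in> S"
  shows "radial_deriv f z = frechet_derivative f (at z) z"
proof -
  interpret linear "frechet_derivative f (at z)"
    using holomorphic_vecD(1)[OF f z] by (simp add: has_derivative_linear)
  have "frechet_derivative f (at z) z = frechet_derivative f (at z) (\<Sum>j\<in>UNIV. z $ j *s axis j 1)"
    by (simp add: basis_expansion)
  also have "\<dots> = radial_deriv f z"
    unfolding radial_deriv_def sum by (simp add: holomorphic_vecD(2)[OF f z] cpartial_eq[OF f z])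
  finally show ?thesis ..
qed

text \<open>Cauchy's formulas for the value and the derivative at the centre, written as real integrals over
the parameter of the circle.\<close>

lemma circle_mean_value:
  assumes g: "g holomorphic_on A" and A: "open A" "cball 0 \<rho> \<subseteq> A" and \<rho>: "\<rho> > 0"
  shows "((\<lambda>t. g (of_real \<rho> * exp (2 * of_real pi * \<i> * of_real t))) has_integral g 0) {0..1}"
    and "((\<lambda>t. inverse (of_real \<rho> * exp (2 * of_real pi * \<i> * of_real t)) *
            g (of_real \<rho> * exp (2 * of_real pi * \<i> * of_real t))) has_integral deriv g 0) {0..1}"
proof -
  have c: "continuous_on (cball 0 \<rho>) g" "g holomorphic_on ball 0 \<rho>"
    using A holomorphic_on_imp_continuous_on[OF g] holomorphic_on_subset[OF g order_trans[OF
      ball_subset_cball A(2)]]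
    by (auto intro: continuous_on_subset)
  let ?e = "\<lambda>t::real. of_real \<rho> * exp (2 * of_real pi * \<i> * of_real t) :: complex"
  have cp: "circlepath 0 \<rho> t = ?e t" for t by (simp add: circlepath mult_ac)
  have vd: "vector_derivative (circlepath 0 \<rho>) (at t) = 2 * of_real pi * \<i> * ?e t" for t
    by (simp add: vector_derivative_circlepath mult_ac)
  have nz: "?e t \<noteq> 0" for t using \<rho> by simp
  have "((\<lambda>u. g u / (u - 0)) has_contour_integral 2 * of_real pi * \<i> * g 0) (circlepath 0 \<rho>)"
    by (rule Cauchy_integral_circlepath) (use c \<rho> in auto)
  hence "((\<lambda>t. g (?e t) / ?e t * (2 * of_real pi * \<i> * ?e t)) has_integral 2 * of_real pi * \<i>
    * g 0) {0..1}"
    unfolding has_contour_integral cp vd by simp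
  hence "((\<lambda>t. (1 / (2 * of_real pi * \<i>)) * (g (?e t) / ?e t * (2 * of_real pi * \<i> * ?e t)))
    has_integral (1 / (2 * of_real pi * \<i>)) * (2 * of_real pi * \<i> * g 0)) {0..1}"
    by (rule has_integral_mult_right)
  moreover have "(1 / (2 * of_real pi * \<i>)) * (g (?e t) / ?e t * (2 * of_real pi * \<i> * ?e t))
    = g (?e t)" for t
  proof -
    have "(1 / a) * (x / e * (a * e)) = x" if "a \<noteq> 0" "e \<noteq> 0" for a e x :: complex
      using that by (simp add: field_simps)
    from this[OF _ nz[of t], of "2 * of_real pi * \<i>" "g (?e t)"] show ?thesis by simp
  qed
  ultimately show "((\<lambda>t. g (?e t)) has_integral g 0) {0..1}" by simp
  have "((\<lambda>u. g u / (u - 0)\<^sup>2) has_contour_integral 2 * of_real pi * \<i> * deriv g 0) (circlepath 0 \<rho>)"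
  proof -
    have h: "((\<lambda>u. g u / (u - 0)^(Suc 1)) has_contour_integral ((2 * pi * \<i>) / (fact 1)
      * (deriv ^^ 1) g 0)) (circlepath 0 \<rho>)"
      by (rule Cauchy_has_contour_integral_higher_derivative_circlepath) (use c \<rho> in auto)
    thus ?thesis by (simp add: numeral_2_eq_2)
  qed
  hence "((\<lambda>t. g (?e t) / (?e t)\<^sup>2 * (2 * of_real pi * \<i> * ?e t)) has_integral 2 * of_real pi * \<i>
    * deriv g 0) {0..1}"
    unfolding has_contour_integral cp vd by simp
  hence "((\<lambda>t. (1 / (2 * of_real pi * \<i>)) * (g (?e t) / (?e t)\<^sup>2 * (2 * of_real pi * \<i> * ?e t)))
    has_integral (1 / (2 * of_real pi * \<i>)) * (2 * of_real pi * \<i> * deriv g 0)) {0..1}"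
    by (rule has_integral_mult_right)
  moreover have "(1 / (2 * of_real pi * \<i>)) * (g (?e t) / (?e t)\<^sup>2 * (2 * of_real pi * \<i> * ?e t))
    = inverse (?e t) * g (?e t)" for t
  proof -
    have "(1 / a) * (x / e\<^sup>2 * (a * e)) = inverse e * x" if "a \<noteq> 0" "e \<noteq> 0" for a e x :: complex
      using that by (simp add: field_simps power2_eq_square)
    from this[OF _ nz[of t], of "2 * of_real pi * \<i>" "g (?e t)"] show ?thesis by simp
  qed
  ultimately show "((\<lambda>t. inverse (?e t) * g (?e t)) has_integral deriv g 0) {0..1}" by simp
qed

definition circle_point :: "real \<Rightarrow> real \<Rightarrow> complex"
  where "circle_point \<rho> t = of_real \<rho> * exp (2 * of_real pi * \<i> * of_real t)"

lemma cmod_circle_point: "\<rho> \<ge> 0 \<Longrightarrow> cmod (circle_point \<rho> t) = \<rho>"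
  by (simp add: circle_point_def norm_mult)

lemma continuous_on_circle_point [continuous_intros]:
  "continuous_on S f \<Longrightarrow> continuous_on S (\<lambda>x. circle_point \<rho> (f x))"
  unfolding circle_point_def by (intro continuous_intros)

lemma holomorphic_vec_mean_value:
  fixes z v :: "('n::finite) cvec"
  assumes f: "f holomorphic_vec_on S" and S: "open S" and \<rho>: "\<rho> > 0"
    and disc: "\<And>c. cmod c \<le> \<rho> \<Longrightarrow> z + c *s v \<in> S"
  shows "((\<lambda>t. f (z + circle_point \<rho> t *s v)) has_integral f z) {0..1}"
    and "((\<lambda>t. inverse (circle_point \<rho> t) * f (z + circle_point \<rho> t *s v)) has_integral
            frechet_derivative f (at z) v) {0..1}"
proof -
  define A where "A = (\<lambda>c. z + c *s v) -` S"
  have A: "open A" unfolding A_def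
    by (intro open_vimage S continuous_intros)
  have sub: "cball 0 \<rho> \<subseteq> A" using disc by (auto simp: A_def)
  have g: "(\<lambda>c. f (z + c *s v)) holomorphic_on A"
    by (rule holomorphic_vec_line[OF f]) (simp add: A_def)
  have z: "z \<in> S" using disc[of 0] \<rho> by simp
  have d: "deriv (\<lambda>c. f (z + c *s v)) 0 = frechet_derivative f (at z) v"
    using holomorphic_vec_DERIV_line[OF f, of z 0 v] z by (simp add: DERIV_imp_deriv)
  show "((\<lambda>t. f (z + circle_point \<rho> t *s v)) has_integral f z) {0..1}"
    and "((\<lambda>t. inverse (circle_point \<rho> t) * f (z + circle_point \<rho> t *s v)) has_integral
            frechet_derivative f (at z) v) {0..1}"
    using circle_mean_value[OF g A sub \<rho>] unfolding circle_point_def d by simp_all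
qed

lemma small_disc_exists:
  fixes v :: "('n::finite) cvec"
  assumes "open S" "z0 \<in> S"
  shows "\<exists>r>0. \<exists>\<rho>>0. ball z0 r \<subseteq> S \<and> (\<forall>z\<in>ball z0 r. \<forall>c. cmod c \<le> \<rho> \<longrightarrow> z + c *s v \<in> S)"
proof -
  obtain e where e: "e > 0" "ball z0 e \<subseteq> S" using assms open_contains_ball by blast
  define \<rho> where "\<rho> = e / (2 * (norm v + 1))"
  have r: "\<rho> > 0" using e by (simp add: \<rho>_def add_nonneg_pos)
  have "\<rho> * norm v \<le> \<rho> * (norm v + 1)" using r by simp
  also have "\<dots> = e / 2"
    using add_nonneg_pos[OF norm_ge_zero[of v] zero_less_one] by (simp add: \<rho>_def field_simps)
  finally have v: "\<rho> * norm v \<le> e / 2" .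
  show ?thesis
  proof (rule exI[of _ "e/2"], rule conjI, simp add: e, rule exI[of _ \<rho>], intro conjI ballI allI impI)
    fix z c assume z: "z \<in> ball z0 (e/2)" and c: "cmod c \<le> \<rho>"
    have "norm (c *s v) \<le> e / 2"
      unfolding norm_smult_vec using mult_right_mono[OF c, of "norm v"] v by simp
    moreover have "dist z0 (z + c *s v) \<le> dist z0 z + norm (c *s v)"
      by (simp add: dist_norm) (metis diff_diff_eq norm_triangle_ineq4)
    ultimately have "z + c *s v \<in> ball z0 e" using z by simp
    thus "z + c *s v \<in> S" using e by blast
  qed (use e r in auto)
qed

text \<open>Complex differentiability at each point does not include continuity of the derivative; it comes
from Cauchy's formula, in which only the continuous function \<open>f\<close> itself occurs.\<close>

lemma continuous_on_directional_deriv: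
  fixes v :: "('n::finite) cvec"
  assumes f: "f holomorphic_vec_on S" and S: "open S"
  shows "continuous_on S (\<lambda>z. frechet_derivative f (at z) v)"
proof (rule continuous_at_imp_continuous_on, intro ballI)
  fix z0 assume z0: "z0 \<in> S"
  obtain r \<rho> where r: "r > 0" "\<rho> > 0" "ball z0 r \<subseteq> S" "\<And>z c. z \<in> ball z0 r \<Longrightarrow> cmod c \<le> \<rho> \<Longrightarrow>
    z + c *s v \<in> S"
    using small_disc_exists[OF S z0, of v] by blast
  have "continuous_on (ball z0 r) (\<lambda>z. integral (cbox 0 1) (\<lambda>t. inverse (circle_point \<rho> t)
    * f (z + circle_point \<rho> t *s v)))"
  proof (rule integral_continuous_on_param)
    show "continuous_on (ball z0 r \<times> cbox 0 1) (\<lambda>(z, t). inverse (circle_point \<rho> t)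
      * f (z + circle_point \<rho> t *s v))"
      unfolding case_prod_unfold
    proof (intro continuous_intros ballI)
      show "continuous_on (ball z0 r \<times> cbox 0 1) (\<lambda>x. f (fst x + circle_point \<rho> (snd x) *s v))"
        by (rule continuous_on_compose2[OF holomorphic_vec_continuous_on[OF f]])
           (use r in \<open>auto intro!: continuous_intros simp: cmod_circle_point\<close>)
      fix x :: "'n cvec \<times> real"
      show "circle_point \<rho> (snd x) \<noteq> 0" using r by (simp add: circle_point_def)
    qed
  qed
  moreover have "integral (cbox 0 1) (\<lambda>t. inverse (circle_point \<rho> t)
    * f (z + circle_point \<rho> t *s v)) = frechet_derivative f (at z) v"
    if "z \<in> ball z0 r" for z
    using holomorphic_vec_mean_value(2)[OF f S r(2), of z v] r(4)[OF that]
      by (simp add: integral_unique)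
  ultimately have "continuous_on (ball z0 r) (\<lambda>z. frechet_derivative f (at z) v)"
    by (rule continuous_on_eq) 
  thus "continuous (at z0) (\<lambda>z. frechet_derivative f (at z) v)"
    using r(1) by (simp add: continuous_on_eq_continuous_at)
qed

text \<open>Cauchy's formula expresses the directional derivative as a circle integral of \<open>f\<close>, which may be
differentiated under the integral sign since the derivative of \<open>f\<close> is continuous. Complex linearity is
inherited from the integrand.\<close>

lemma holomorphic_vec_directional_deriv:
  fixes v :: "('n::finite) cvec"
  assumes f: "f holomorphic_vec_on S" and S: "open S"
  shows "(\<lambda>z. frechet_derivative f (at z) v) holomorphic_vec_on S"
  unfolding holomorphic_vec_on_def
proof (intro ballI)
  fix z0 assume z0: "z0 \<in> S"
  obtain r \<rho> where r: "r > 0" "\<rho> > 0" "ball z0 r \<subseteq> S" "\<And>z c. z \<in> ball z0 r \<Longrightarrow> cmod c \<le> \<rho> \<Longrightarrow>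
    z + c *s v \<in> S"
    using small_disc_exists[OF S z0, of v] by blast
  define Df where "Df = (\<lambda>z. Blinfun (frechet_derivative f (at z)))"
  have Df: "blinfun_apply (Df z) = frechet_derivative f (at z)" if "z \<in> S" for z
    unfolding Df_def using holomorphic_vecD(1)[OF f that]
    by (intro bounded_linear_Blinfun_apply has_derivative_bounded_linear)
  have contD: "continuous_on S Df"
  proof (rule continuous_on_blinfun_componentwise)
    fix i :: "'n cvec"
    show "continuous_on S (\<lambda>x. blinfun_apply (Df x) i)"
      using continuous_on_directional_deriv[OF f S, of i] by (rule continuous_on_eq) (simp add: Df)
  qed
  let ?c = "circle_point \<rho>"
  have cnz: "?c t \<noteq> 0" for t using r by (simp add: circle_point_def)
  define fx where "fx = (\<lambda>z t. blinfun_mult_right (inverse (?c t)) o\<^sub>L Df (z + ?c t *s v))"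
  have inS: "z + ?c t *s v \<in> S" if "z \<in> ball z0 r" for z t
    using r(4)[OF that, of "?c t"] r(2) by (simp add: cmod_circle_point)
  have fx: "blinfun_apply (fx z t) = (\<lambda>\<xi>. inverse (?c t) * frechet_derivative f (at (z + ?c t *s v)) \<xi>)"
    if "z \<in> ball z0 r" for z t
    using Df[OF inS[OF that]] by (simp add: fx_def fun_eq_iff)
  have cfx: "continuous_on (ball z0 r \<times> cbox 0 1) (\<lambda>(z, t). fx z t)"
    unfolding fx_def case_prod_unfold
  proof (intro continuous_intros ballI bounded_linear.continuous_on[OF
    bounded_linear_blinfun_mult_right])
    show "continuous_on (ball z0 r \<times> cbox 0 1) (\<lambda>x. Df (fst x + ?c (snd x) *s v))"
      by (rule continuous_on_compose2[OF contD])
         (use inS in \<open>auto intro!: continuous_intros\<close>)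
  qed (rule cnz)
  have "((\<lambda>z. integral (cbox 0 1) (\<lambda>t. inverse (?c t) * f (z + ?c t *s v))) has_derivative
     blinfun_apply (integral (cbox 0 1) (fx z0))) (at z0 within ball z0 r)"
  proof (rule leibniz_rule)
    fix z t assume z: "z \<in> ball z0 r" and "t \<in> cbox (0::real) 1"
    have "((\<lambda>z. z + ?c t *s v) has_derivative (\<lambda>h. h)) (at z)"
      by (auto intro!: derivative_eq_intros)
    from has_derivative_compose[OF this holomorphic_vecD(1)[OF f inS[OF z]]]
    have "((\<lambda>z. inverse (?c t) * f (z + ?c t *s v)) has_derivative (\<lambda>\<xi>. inverse (?c t)
      * frechet_derivative f (at (z + ?c t *s v)) \<xi>)) (at z)"
      by (rule has_derivative_mult_right)
    thus "((\<lambda>z. inverse (?c t) * f (z + ?c t *s v)) has_derivative blinfun_apply (fx z t))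
      (at z within ball z0 r)"
      unfolding fx[OF z] by (rule has_derivative_at_withinI)
  next
    fix z assume z: "z \<in> ball z0 r"
    show "(\<lambda>t. inverse (?c t) * f (z + ?c t *s v)) integrable_on cbox 0 1"
      using holomorphic_vec_mean_value(2)[OF f S r(2), of z v] r(4)[OF z] by auto
  qed (use cfx r in auto)
  hence "((\<lambda>z. integral (cbox 0 1) (\<lambda>t. inverse (?c t) * f (z + ?c t *s v))) has_derivative
     blinfun_apply (integral (cbox 0 1) (fx z0))) (at z0)"
    using r(1) by (simp add: at_within_open[of z0 "ball z0 r"])
  hence "((\<lambda>z. frechet_derivative f (at z) v) has_derivative blinfun_apply
    (integral (cbox 0 1) (fx z0))) (at z0)"
  proof (rule has_derivative_transform_within_open)
    fix z assume z: "z \<in> ball z0 r"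
    show "integral (cbox 0 1) (\<lambda>t. inverse (?c t) * f (z + ?c t *s v)) = frechet_derivative f (at z) v"
      using holomorphic_vec_mean_value(2)[OF f S r(2), of z v] r(4)[OF z] by (simp add: integral_unique)
  qed (use r in auto)
  moreover have "blinfun_apply (integral (cbox 0 1) (fx z0)) (c *s x)
    = c * blinfun_apply (integral (cbox 0 1) (fx z0)) x" for c x
  proof -
    have int: "fx z0 integrable_on cbox 0 1"
      by (rule integrable_continuous, rule continuous_on_compose2[OF cfx, of _ "\<lambda>t. (z0, t)",
        unfolded case_prod_conv])
         (use r in \<open>auto intro!: continuous_intros\<close>)
    have z0b: "z0 \<in> ball z0 r" using r by simp
    show ?thesis
      unfolding blinfun_apply_integral[OF int] fx[OF z0b] holomorphic_vecD(2)[OF f inS[OF z0b]]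
      by (simp add: mult.left_commute)
  qed
  ultimately show "\<exists>D. ((\<lambda>z. frechet_derivative f (at z) v) has_derivative D) (at z0) \<and>
    (\<forall>c x. D (c *s x) = c * D x)"
    by blast
qed

lemma holomorphic_vec_cong:
  assumes "open S" "f holomorphic_vec_on S" "\<And>z. z \<in> S \<Longrightarrow> f z = g z"
  shows "g holomorphic_vec_on S"
  unfolding holomorphic_vec_on_def
proof
  fix z assume z: "z \<in> S"
  then obtain D where D: "(f has_derivative D) (at z)" "\<forall>c x. D (c *s x) = c * D x"
    using assms(2) by (auto simp: holomorphic_vec_on_def)
  have "(g has_derivative D) (at z)"
    by (rule has_derivative_transform_within_open[OF D(1) assms(1) z assms(3)])
  thus "\<exists>D. (g has_derivative D) (at z) \<and> (\<forall>c x. D (c *s x) = c * D x)" using D by blast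
qed

lemma holomorphic_vec_mult:
  assumes "f holomorphic_vec_on S" "g holomorphic_vec_on S"
  shows "(\<lambda>z. f z * g z) holomorphic_vec_on S"
  unfolding holomorphic_vec_on_def
proof
  fix z assume z: "z \<in> S"
  note F = holomorphic_vecD[OF assms(1) z] and G = holomorphic_vecD[OF assms(2) z]
  show "\<exists>D. ((\<lambda>z. f z * g z) has_derivative D) (at z) \<and> (\<forall>c x. D (c *s x) = c * D x)"
    by (rule exI, rule conjI, rule has_derivative_mult[OF F(1) G(1)])
      (simp add: F(2) G(2) algebra_simps)
qed

lemma holomorphic_vec_const: "(\<lambda>z. c) holomorphic_vec_on S"
  unfolding holomorphic_vec_on_def by (auto intro!: exI[of _ "\<lambda>_. 0"])

lemma holomorphic_vec_sum:
  assumes "finite I" "\<And>i. i \<in> I \<Longrightarrow> f i holomorphic_vec_on S"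
  shows "(\<lambda>z. \<Sum>i\<in>I. f i z) holomorphic_vec_on S"
  unfolding holomorphic_vec_on_def
proof
  fix z assume z: "z \<in> S"
  show "\<exists>D. ((\<lambda>z. \<Sum>i\<in>I. f i z) has_derivative D) (at z) \<and> (\<forall>c x. D (c *s x) = c * D x)"
    by (rule exI, rule conjI, rule has_derivative_sum, rule holomorphic_vecD(1)[OF assms(2) z])
       (auto simp: holomorphic_vecD(2)[OF assms(2) z] sum_distrib_left)
qed

lemma holomorphic_vec_component: "(\<lambda>z. z $ j) holomorphic_vec_on S"
  unfolding holomorphic_vec_on_def
  by (auto intro!: exI[of _ "\<lambda>z. z $ j"] bounded_linear_imp_has_derivative bounded_linear_vec_nth)

lemma holomorphic_vec_power:
  assumes "f holomorphic_vec_on S" shows "(\<lambda>z. f z ^ m) holomorphic_vec_on S"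
  by (induction m) (auto intro: holomorphic_vec_const holomorphic_vec_mult[OF assms])

text \<open>Along functions of \<open>\<langle>w,z\<rangle>\<close> alone the radial derivative is the operator \<open>x d/dx\<close>.\<close>

lemma holomorphic_vec_compose_herm:
  assumes \<phi>: "\<And>w. w \<in> S \<Longrightarrow> (\<phi> has_field_derivative \<phi>' (herm w z)) (at (herm w z))"
  shows "(\<lambda>w. \<phi> (herm w z)) holomorphic_vec_on S"
    and "w \<in> S \<Longrightarrow> radial_deriv (\<lambda>w. \<phi> (herm w z)) w = herm w z * \<phi>' (herm w z)"
proof -
  have D: "((\<lambda>w. \<phi> (herm w z)) has_derivative (\<lambda>x. \<phi>' (herm w z) * herm x z)) (at w)" if "w \<in> S" for w
    using has_derivative_compose[OF bounded_linear_imp_has_derivative[OF bounded_linear_herm_left]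
      \<phi>[OF that, unfolded has_field_derivative_def]]
    by simp
  show h: "(\<lambda>w. \<phi> (herm w z)) holomorphic_vec_on S"
    unfolding holomorphic_vec_on_def
  proof
    fix w assume w: "w \<in> S"
    show "\<exists>D. ((\<lambda>w. \<phi> (herm w z)) has_derivative D) (at w) \<and> (\<forall>c x. D (c *s x) = c * D x)"
      by (rule exI, rule conjI, rule D[OF w]) (simp add: herm_smult_left)
  qed
  show "radial_deriv (\<lambda>w. \<phi> (herm w z)) w = herm w z * \<phi>' (herm w z)" if w: "w \<in> S"
    using radial_deriv_eq[OF h w] frechet_derivative_at[OF D[OF w]] by (metis mult.commute)
qed

text \<open>The radial derivative is a combination of directional derivatives with coordinate functions as
coefficients.\<close>

lemma holomorphic_vec_radial_deriv:
  assumes "f holomorphic_vec_on S" "open S"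
  shows "radial_deriv f holomorphic_vec_on S"
proof (rule holomorphic_vec_cong[OF assms(2)])
  show "(\<lambda>z. \<Sum>j\<in>UNIV. z $ j * frechet_derivative f (at z) (axis j 1)) holomorphic_vec_on S"
    by (intro holomorphic_vec_sum holomorphic_vec_mult holomorphic_vec_component
      holomorphic_vec_directional_deriv assms) auto
  show "(\<Sum>j\<in>UNIV. z $ j * frechet_derivative f (at z) (axis j 1)) = radial_deriv f z" if "z \<in> S" for z
    using cpartial_eq[OF assms(1) that] by (simp add: radial_deriv_def)
qed

lemma holomorphic_vec_iterated_radial_deriv:
  assumes "f holomorphic_vec_on S" "open S"
  shows "(radial_deriv ^^ k) f holomorphic_vec_on S"
  by (induction k) (auto intro: assms holomorphic_vec_radial_deriv)

section \<open>Mean values over circular sets\<close>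

lemma nn_integral_lborel_uminus:
  fixes f :: "'a::euclidean_space \<Rightarrow> ennreal"
  assumes [measurable]: "f \<in> borel_measurable borel"
  shows "(\<integral>\<^sup>+x. f (- x) \<partial>lborel) = (\<integral>\<^sup>+x. f x \<partial>lborel)"
proof -
  have "(\<integral>\<^sup>+x. f x \<partial>lborel) = (\<integral>\<^sup>+x. f x \<partial>density (distr lborel borel (\<lambda>x. 0 + (-1) *\<^sub>R x))
    (\<lambda>_. ennreal (\<bar>-1\<bar> ^ DIM('a))))"
    using lborel_affine[of "-1" "0::'a"] by simp
  also have "\<dots> = (\<integral>\<^sup>+x. f (- x) \<partial>lborel)"
    by (simp add: nn_integral_density nn_integral_distr)
  finally show ?thesis ..
qed

lemma nn_integral_lborel_reflect:
  fixes f :: "'a::euclidean_space \<Rightarrow> ennreal"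
  assumes f [measurable]: "f \<in> borel_measurable borel"
  shows "(\<integral>\<^sup>+x. f (a - x) \<partial>lborel) = (\<integral>\<^sup>+x. f x \<partial>lborel)"
proof -
  have "(\<integral>\<^sup>+x. f (a - x) \<partial>lborel) = (\<integral>\<^sup>+x. f (- (x - a)) \<partial>lborel)" by simp
  also have "\<dots> = (\<integral>\<^sup>+x. f (- x) \<partial>lborel)" by (rule nn_integral_lborel_diff) measurable
  finally show ?thesis using nn_integral_lborel_uminus[OF f] by simp
qed

text \<open>The uniqueness proof for Haar measure in a special case. Integrating \<open>f(cx) \<phi>(y - cx)\<close>, with \<open>\<phi>\<close>
the indicator function of the unit ball, in both orders and substituting \<open>x \<mapsto> c\<^sup>-\<^sup>1y - x\<close> gives the
claim multiplied by the volume of the ball, since \<open>\<phi>\<close> is itself invariant.\<close>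

lemma nn_integral_lborel_unit_scalar:
  fixes f :: "('n::finite) cvec \<Rightarrow> ennreal"
  assumes f [measurable]: "f \<in> borel_measurable borel" and c: "cmod c = 1"
  shows "(\<integral>\<^sup>+x. f (c *s x) \<partial>lborel) = (\<integral>\<^sup>+x. f x \<partial>lborel)"
proof -
  define \<phi> :: "'n cvec \<Rightarrow> ennreal" where "\<phi> = indicator (ball 0 1)"
  have \<phi> [measurable]: "\<phi> \<in> borel_measurable borel" unfolding \<phi>_def
    by (intro borel_measurable_indicator) auto
  define v where "v = (\<integral>\<^sup>+y. \<phi> y \<partial>lborel)"
  have v: "v = emeasure lborel (ball (0::'n cvec) 1)" unfolding v_def \<phi>_def
    by (subst nn_integral_indicator) auto
  have pos: "unit_ball_vol (2 * real CARD('n)) > 0" by simp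
  have vv: "v = ennreal (unit_ball_vol (2 * CARD('n)))" unfolding v by (subst emeasure_ball_cvec) auto
  have "v \<noteq> 0" using pos unfolding vv ennreal_eq_0_iff by (simp only: not_le of_nat_mult of_nat_numeral)
  moreover have "v \<noteq> \<infinity>" unfolding vv by simp
  ultimately have v0: "v \<noteq> 0" "v \<noteq> \<infinity>" by blast+
  have c0: "c \<noteq> 0" using c by auto
  have cinv: "c *s (inverse c *s y - x) = y - c *s x" for x y :: "'n cvec"
    using c0 by (simp add: vec_eq_iff algebra_simps)
  have "(\<integral>\<^sup>+x. f (c *s x) \<partial>lborel) * v = (\<integral>\<^sup>+x. f (c *s x) * (\<integral>\<^sup>+y. \<phi> (y - c *s x) \<partial>lborel) \<partial>lborel)"
    unfolding v_def by (subst nn_integral_lborel_diff[OF \<phi>]) (simp add: nn_integral_multc)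
  also have "\<dots> = (\<integral>\<^sup>+x. \<integral>\<^sup>+y. f (c *s x) * \<phi> (y - c *s x) \<partial>lborel \<partial>lborel)"
    by (subst nn_integral_cmult) auto
  also have "\<dots> = (\<integral>\<^sup>+y. \<integral>\<^sup>+x. f (c *s x) * \<phi> (y - c *s x) \<partial>lborel \<partial>lborel)"
    by (rule lborel_pair.Fubini') measurable
  also have "\<dots> = (\<integral>\<^sup>+y. \<integral>\<^sup>+x. f (y - c *s x) * \<phi> (c *s x) \<partial>lborel \<partial>lborel)"
  proof (rule nn_integral_cong)
    fix y :: "'n cvec"
    have "(\<integral>\<^sup>+x. f (c *s x) * \<phi> (y - c *s x) \<partial>lborel) = 
       (\<integral>\<^sup>+x. f (c *s (inverse c *s y - x)) * \<phi> (y - c *s (inverse c *s y - x)) \<partial>lborel)"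
      by (rule nn_integral_lborel_reflect[symmetric]) measurable
    thus "(\<integral>\<^sup>+x. f (c *s x) * \<phi> (y - c *s x) \<partial>lborel) = (\<integral>\<^sup>+x. f (y - c *s x) * \<phi> (c *s x) \<partial>lborel)"
      unfolding cinv by simp
  qed
  also have "\<dots> = (\<integral>\<^sup>+x. \<integral>\<^sup>+y. f (y - c *s x) * \<phi> (c *s x) \<partial>lborel \<partial>lborel)"
    by (rule lborel_pair.Fubini') measurable
  also have "\<dots> = (\<integral>\<^sup>+x. (\<integral>\<^sup>+y. f y \<partial>lborel) * \<phi> x \<partial>lborel)"
  proof (rule nn_integral_cong)
    fix x :: "'n cvec"
    have "\<phi> (c *s x) = \<phi> x" using c by (simp add: \<phi>_def indicator_def norm_smult_vec)
    thus "(\<integral>\<^sup>+y. f (y - c *s x) * \<phi> (c *s x) \<partial>lborel) = (\<integral>\<^sup>+y. f y \<partial>lborel) * \<phi> x"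
      by (subst nn_integral_multc) (auto simp: nn_integral_lborel_diff[OF f])
  qed
  also have "\<dots> = (\<integral>\<^sup>+y. f y \<partial>lborel) * v" unfolding v_def by (subst nn_integral_cmult) auto
  finally have "v * (\<integral>\<^sup>+x. f (c *s x) \<partial>lborel) = v * (\<integral>\<^sup>+x. f x \<partial>lborel)" by (simp only: mult.commute)
  thus ?thesis using v0 by (subst (asm) ennreal_mult_cancel_left) auto
qed

lemma borel_measurable_times_indicator_open:
  fixes f :: "('n::finite) cvec \<Rightarrow> real"
  assumes "open S" "continuous_on S f"
  shows "(\<lambda>z. ennreal (f z) * indicator S z) \<in> borel_measurable borel"
proof -
  have "(\<lambda>z. indicator S z *\<^sub>R f z) \<in> borel_measurable borel"
    using assms by (intro borel_measurable_continuous_on_indicator) auto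
  hence "(\<lambda>z. ennreal (indicator S z *\<^sub>R f z)) \<in> borel_measurable borel" by measurable
  also have "(\<lambda>z. ennreal (indicator S z *\<^sub>R f z)) = (\<lambda>z. ennreal (f z) * indicator S z)"
    by (auto simp: indicator_def)
  finally show ?thesis .
qed

text \<open>The one-variable mean value property on each circle \<open>w + e\<^bsup>i\<theta>\<^esup>\<xi>\<close> is integrated over \<open>\<xi> \<in> P\<close>; for
fixed \<open>\<theta>\<close> the rotation preserves both \<open>P\<close> and Lebesgue measure.\<close>

lemma circular_mean_value_le:
  fixes f :: "('n::finite) cvec \<Rightarrow> complex"
  assumes f: "f holomorphic_vec_on S" and S: "open S"
    and P [measurable]: "P \<in> sets borel" and circ: "\<And>c \<xi>. cmod c = 1 \<Longrightarrow> \<xi> \<in> P \<Longrightarrow> c *s \<xi> \<in> P"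
    and disc: "\<And>c \<xi>. cmod c \<le> 1 \<Longrightarrow> \<xi> \<in> P \<Longrightarrow> w + c *s \<xi> \<in> S"
  shows "ennreal (cmod (f w)) * emeasure lborel P
    \<le> (\<integral>\<^sup>+\<xi>. ennreal (cmod (f (w + \<xi>))) * indicator P \<xi> \<partial>lborel)"
proof -
  let ?e = "circle_point 1"
  define F where "F = (\<lambda>z. ennreal (cmod (f z)) * indicator S z)"
  have F [measurable]: "F \<in> borel_measurable borel" unfolding F_def
    by (intro borel_measurable_times_indicator_open S continuous_intros
      holomorphic_vec_continuous_on[OF f])
  have e [measurable]: "?e \<in> borel_measurable borel"
    by (intro borel_measurable_continuous_onI continuous_intros)
  have ce: "cmod (?e t) = 1" for t by (simp add: cmod_circle_point)
  have circ': "?e t *s \<xi> \<in> P \<longleftrightarrow> \<xi> \<in> P" for t \<xi>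
  proof
    assume "?e t *s \<xi> \<in> P"
    from circ[OF _ this, of "inverse (?e t)"] ce[of t] show "\<xi> \<in> P"
      by (simp add: norm_inverse vector_smult_assoc)
        (metis ce left_inverse norm_eq_zero scaleR_one vector_smult_lid zero_neq_one)
  qed (rule circ[OF ce])
  have "ennreal (cmod (f w)) * emeasure lborel P = (\<integral>\<^sup>+\<xi>. ennreal (cmod (f w)) * indicator P \<xi> \<partial>lborel)"
    by (subst nn_integral_cmult) auto
  also have "\<dots> \<le> (\<integral>\<^sup>+\<xi>. \<integral>\<^sup>+t. F (w + ?e t *s \<xi>) * indicator P \<xi> * indicator {0..1} t \<partial>lborel \<partial>lborel)"
  proof (rule nn_integral_mono)
    fix \<xi> :: "'n cvec"
    show "ennreal (cmod (f w)) * indicator P \<xi>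
      \<le> (\<integral>\<^sup>+t. F (w + ?e t *s \<xi>) * indicator P \<xi> * indicator {0..1} t \<partial>lborel)"
    proof (cases "\<xi> \<in> P")
      case True
      have inS: "w + ?e t *s \<xi> \<in> S" for t using disc[OF _ True] ce by simp
      have int: "((\<lambda>t. f (w + ?e t *s \<xi>)) has_integral f w) {0..1}"
        by (rule holomorphic_vec_mean_value(1)[OF f S]) (use disc[OF _ True] in auto)
      have cont: "continuous_on UNIV (\<lambda>t. cmod (f (w + ?e t *s \<xi>)))"
        by (intro continuous_intros continuous_on_compose2[OF holomorphic_vec_continuous_on[OF f]])
           (use inS in auto)
      hence int2: "(\<lambda>t. cmod (f (w + ?e t *s \<xi>))) integrable_on {0..1}"
        by (intro integrable_continuous_interval) (auto intro: continuous_on_subset)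
      have "cmod (f w) \<le> integral {0..1} (\<lambda>t. cmod (f (w + ?e t *s \<xi>)))"
        using integral_norm_bound_integral[OF has_integral_integrable[OF int] int2] int
          by (simp add: integral_unique)
      hence "ennreal (cmod (f w)) \<le> ennreal (integral {0..1} (\<lambda>t. cmod (f (w + ?e t *s \<xi>))))"
        by (rule ennreal_leI)
      also have "\<dots> = (\<integral>\<^sup>+t. ennreal (cmod (f (w + ?e t *s \<xi>))) * indicator {0..1} t \<partial>lborel)"
        using nn_integral_has_integral_lebesgue[OF _ integrable_integral[OF int2]]
        by (simp add: ennreal_mult ennreal_indicator mult.commute)
      finally show ?thesis using True inS by (simp add: F_def)
    qed simp
  qed
  also have "\<dots> = (\<integral>\<^sup>+t. \<integral>\<^sup>+\<xi>. F (w + ?e t *s \<xi>) * indicator P \<xi> * indicator {0..1} t \<partial>lborel \<partial>lborel)"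
    by (rule lborel_pair.Fubini') measurable
  also have "\<dots> = (\<integral>\<^sup>+t. (\<integral>\<^sup>+\<xi>. F (w + \<xi>) * indicator P \<xi> \<partial>lborel) * indicator {0..1::real} t \<partial>lborel)"
  proof (rule nn_integral_cong)
    fix t :: real
    have "(\<integral>\<^sup>+\<xi>. F (w + ?e t *s \<xi>) * indicator P (?e t *s \<xi>) \<partial>lborel)
      = (\<integral>\<^sup>+\<xi>. F (w + \<xi>) * indicator P \<xi> \<partial>lborel)"
      by (rule nn_integral_lborel_unit_scalar[OF _ ce]) measurable
    moreover have "indicator P (?e t *s \<xi>) = (indicator P \<xi> :: ennreal)" for \<xi> using circ'[of t \<xi>]
      by (simp add: indicator_def)
    ultimately show "(\<integral>\<^sup>+\<xi>. F (w + ?e t *s \<xi>) * indicator P \<xi> * indicator {0..1} t \<partial>lborel)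
      = (\<integral>\<^sup>+\<xi>. F (w + \<xi>) * indicator P \<xi> \<partial>lborel) * indicator {0..1} t"
      by (subst nn_integral_multc) auto
  qed
  also have "\<dots> = (\<integral>\<^sup>+\<xi>. F (w + \<xi>) * indicator P \<xi> \<partial>lborel)"
    by (subst nn_integral_cmult) auto
  also have "\<dots> = (\<integral>\<^sup>+\<xi>. ennreal (cmod (f (w + \<xi>))) * indicator P \<xi> \<partial>lborel)"
    using disc[of 1] by (intro nn_integral_cong) (auto simp: F_def indicator_def)
  finally show ?thesis .
qed

section \<open>Mean value inequalities for \<open>p\<close>-th powers\<close>

text \<open>A mean value inequality for the first power implies one for the power \<open>p \<le> 1\<close>. Let \<open>M\<close> be the
supremum of \<open>F(u) (1 - N(u))\<^bsup>m/p\<^esup>\<close>. In the mean value inequality at \<open>u\<close> with radius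
\<open>s = (1 - N(u))/2\<close> write \<open>F = F\<^sup>p F\<^bsup>1-p\<^esup>\<close> and bound the second factor by means of \<open>M\<close>. Taking the
supremum over \<open>u\<close> gives \<open>M \<le> const M\<^bsup>1-p\<^esup> \<integral>F\<^sup>p\<close>, and \<open>M\<^bsup>1-p\<^esup>\<close> can be cancelled because
boundedness of \<open>F\<close> makes \<open>M\<close> finite.\<close>

lemma submean_absorption:
  fixes F N :: "('n::finite) cvec \<Rightarrow> real" and p m \<kappa> K :: real
  assumes N [measurable]: "N \<in> borel_measurable borel" and F [measurable]: "F \<in> borel_measurable borel"
    and N0: "N 0 = 0" and tri: "\<And>x y. N (x + y) \<le> N x + N y"
    and F0: "\<And>x. 0 \<le> F x" and bdd: "\<And>x. N x < 1 \<Longrightarrow> F x \<le> K"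
    and p: "0 < p" "p \<le> 1" and m: "0 \<le> m" and \<kappa>: "0 < \<kappa>" and Npos: "\<And>x. 0 \<le> N x"
    and sub: "\<And>u s. N u < 1 \<Longrightarrow> 0 < s \<Longrightarrow> N u + s \<le> 1 \<Longrightarrow>
       ennreal (\<kappa> * s powr m * F u) \<le> (\<integral>\<^sup>+\<xi>. ennreal (F (u + \<xi>)) * indicator {\<xi>. N \<xi> < s} \<xi> \<partial>lborel)"
  shows "ennreal (\<kappa> * F 0 powr p) \<le> ennreal (2 powr (m / p))
    * (\<integral>\<^sup>+\<xi>. ennreal (F \<xi> powr p) * indicator {\<xi>. N \<xi> < 1} \<xi> \<partial>lborel)"
    (is "_ \<le> _ * ?I")
proof (cases "?I = \<infinity> \<or> F 0 = 0")
  case True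
  thus ?thesis using p by (auto simp: ennreal_mult_top)
next
  case False
  then obtain i where i: "?I = ennreal i" "0 \<le> i" by (cases ?I) auto
  have F0p: "F 0 > 0" using False F0[of 0] by simp
  \<comment> \<open>The weight vanishes at the boundary of the gauge ball, which leaves room for the radius \<open>s\<close> below.\<close>
  define X where "X = (\<lambda>u. F u * (1 - N u) powr (m / p)) ` {u. N u < 1}"
  define M where "M = Sup X"
  have Xne: "X \<noteq> {}" using N0 zero_less_one by
    (metis (mono_tags) X_def empty_iff image_is_empty mem_Collect_eq)
  have Xb: "bdd_above X"
  proof (rule bdd_aboveI[of _ "max K 0"])
    fix x assume "x \<in> X"
    then obtain u where u: "N u < 1" "x = F u * (1 - N u) powr (m / p)" by (auto simp: X_def)
    have "(1 - N u) powr (m / p) \<le> 1" using u Npos[of u] p m by (intro powr_le1) auto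
    hence "x \<le> F u * 1" unfolding u(2) using F0 by (intro mult_left_mono)
    thus "x \<le> max K 0" using bdd[OF u(1)] by simp
  qed
  have le_M: "F u * (1 - N u) powr (m / p) \<le> M" if "N u < 1" for u
    unfolding M_def using that by (intro cSup_upper Xb) (auto simp: X_def)
  have "F 0 \<le> M" using le_M[of 0] N0 by simp
  hence M: "M > 0" using F0p by simp
  have key: "F u * (1 - N u) powr (m / p) \<le> 2 powr (m / p) * M powr (1 - p) * i / \<kappa>" if u: "N u
    < 1" for u
  proof -
    define s where "s = (1 - N u) / 2"
    have s: "s > 0" "N u + s \<le> 1" using u by (auto simp: s_def field_simps)
    define B where "B = (M * s powr (- (m / p))) powr (1 - p)"
    have "ennreal (\<kappa> * s powr m * F u) \<le> (\<integral>\<^sup>+\<xi>. ennreal (F (u + \<xi>)) * indicator {\<xi>. N \<xi> < s} \<xi> \<partial>lborel)"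
      by (rule sub[OF u s])
    also have "\<dots> \<le> (\<integral>\<^sup>+\<xi>. ennreal B * (ennreal (F (\<xi> + u) powr p) * indicator {\<xi>. N \<xi>
      < 1} (\<xi> + u)) \<partial>lborel)"
    proof (rule nn_integral_mono)
      fix \<xi> :: "'n cvec"
      show "ennreal (F (u + \<xi>)) * indicator {\<xi>. N \<xi> < s} \<xi>
        \<le> ennreal B * (ennreal (F (\<xi> + u) powr p) * indicator {\<xi>. N \<xi> < 1} (\<xi> + u))"
      proof (cases "N \<xi> < s \<and> F (u + \<xi>) > 0")
        case True
        have n: "N (u + \<xi>) < 1" "s \<le> 1 - N (u + \<xi>)" using tri[of u \<xi>] True s by (auto simp: s_def)
        have "F (u + \<xi>) * s powr (m / p) \<le> F (u + \<xi>) * (1 - N (u + \<xi>)) powr (m / p)"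
          using n s p m F0 by (intro mult_left_mono powr_mono2) auto
        also have "\<dots> \<le> M" by (rule le_M[OF n(1)])
        finally have "F (u + \<xi>) \<le> M * s powr (- (m / p))"
          using s by (simp add: powr_minus field_simps)
        hence "F (u + \<xi>) powr (1 - p) \<le> B" unfolding B_def using F0 p by (intro powr_mono2) auto
        hence "F (u + \<xi>) powr (1 - p) * F (u + \<xi>) powr p \<le> B * F (u + \<xi>) powr p"
          by (intro mult_right_mono) auto
        hence "F (u + \<xi>) \<le> B * F (u + \<xi>) powr p" using True by (simp add: powr_add[symmetric])
        hence "ennreal (F (u + \<xi>)) \<le> ennreal B * ennreal (F (u + \<xi>) powr p)"
          by (simp add: ennreal_mult[symmetric] ennreal_leI B_def)
        thus ?thesis using True n by (simp add: add.commute)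
      next
        case False
        thus ?thesis using F0[of "u + \<xi>"] by (auto simp: indicator_def)
      qed
    qed
    also have "\<dots> = ennreal B * (\<integral>\<^sup>+\<xi>. ennreal (F (\<xi> + u) powr p) * indicator {\<xi>. N \<xi>
      < 1} (\<xi> + u) \<partial>lborel)"
      by (rule nn_integral_cmult) measurable
    also have "(\<integral>\<^sup>+\<xi>. ennreal (F (\<xi> + u) powr p) * indicator {\<xi>. N \<xi> < 1} (\<xi> + u) \<partial>lborel) = ?I"
      by (rule nn_integral_lborel_shift) measurable
    finally have "ennreal (\<kappa> * s powr m * F u) \<le> ennreal (B * i)"
      using i by (simp add: ennreal_mult B_def)
    hence "\<kappa> * s powr m * F u \<le> B * i" using i by (subst (asm) ennreal_le_iff) (auto simp: B_def)
    also have "B = M powr (1 - p) * s powr (m - m / p)"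
    proof -
      have "B = M powr (1 - p) * s powr (- (m / p) * (1 - p))"
        unfolding B_def using M s by (simp add: powr_mult powr_powr)
      also have "- (m / p) * (1 - p) = m - m / p" using p by (simp add: field_simps)
      finally show ?thesis .
    qed
    also have "M powr (1 - p) * s powr (m - m / p) * i
      = s powr m * (M powr (1 - p) * i * s powr (- (m / p)))"
      by (simp add: powr_diff powr_minus field_simps)
    finally have "s powr m * (\<kappa> * F u) \<le> s powr m * (M powr (1 - p) * i * s powr (- (m / p)))"
      by (simp add: mult_ac)
    hence "\<kappa> * F u \<le> M powr (1 - p) * i * s powr (- (m / p))" using s
      by (subst (asm) mult_le_cancel_left_pos) auto
    hence "F u * s powr (m / p) \<le> M powr (1 - p) * i / \<kappa>" using s \<kappa>
      by (simp add: powr_minus field_simps)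
    moreover have "(1 - N u) powr (m / p) = 2 powr (m / p) * s powr (m / p)"
    proof -
      have "1 - N u = 2 * s" by (simp add: s_def)
      thus ?thesis using s by (simp add: powr_mult)
    qed
    ultimately show ?thesis using mult_left_mono[of "F u * s powr (m / p)" "M powr (1 - p) * i
      / \<kappa>" "2 powr (m / p)"]
      by (simp add: mult_ac)
  qed
  have "M \<le> 2 powr (m / p) * M powr (1 - p) * i / \<kappa>"
    unfolding M_def using key Xne by (intro cSup_least) (auto simp: X_def M_def)
  hence "\<kappa> * M \<le> 2 powr (m / p) * M powr (1 - p) * i" using \<kappa> by (simp add: field_simps)
  moreover have "M = M powr (1 - p) * M powr p" using M by (simp add: powr_add[symmetric])
  ultimately have "M powr (1 - p) * (\<kappa> * M powr p) \<le> M powr (1 - p) * (2 powr (m / p) * i)"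
    by (metis mult.left_commute mult.commute)
  hence "\<kappa> * M powr p \<le> 2 powr (m / p) * i" using M by (subst (asm) mult_le_cancel_left_pos) auto
  moreover have "F 0 powr p \<le> M powr p" using \<open>F 0 \<le> M\<close> F0 p by (intro powr_mono2) auto
  ultimately have "\<kappa> * F 0 powr p \<le> 2 powr (m / p) * i"
    using mult_left_mono[of "F 0 powr p" "M powr p" \<kappa>] \<kappa> by linarith
  thus ?thesis unfolding i(1) using i(2) by (simp add: ennreal_mult[symmetric] ennreal_leI)
qed

lemma near_measurable: "{u. near \<epsilon> w u} \<in> sets borel"
  unfolding near_def by measurable

lemma near_iff_slab: "near \<epsilon> w (w + \<xi>) \<longleftrightarrow> \<xi> \<in> slab w (\<epsilon> * sqrt (defect w)) (\<epsilon> * defect w)"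
  by (simp add: near_def slab_def)

lemma bounded_on_defect_ge:
  assumes f: "continuous_on unit_ball (f :: ('n::finite) cvec \<Rightarrow> real)" and d: "d > 0"
  shows "\<exists>K. \<forall>z. d \<le> defect z \<longrightarrow> f z \<le> K"
proof -
  have sub: "{z::'n cvec. d \<le> defect z} \<subseteq> unit_ball"
  proof
    fix z :: "'n cvec" assume "z \<in> {z. d \<le> defect z}"
    hence "(norm z)\<^sup>2 < 1" using d by (simp add: defect_def)
    thus "z \<in> unit_ball" by (simp add: abs_square_less_1)
  qed
  have "closed {z::'n cvec. d \<le> defect z}" by (intro closed_Collect_le continuous_intros)
  moreover have "bounded {z::'n cvec. d \<le> defect z}" using sub bounded_ball bounded_subset by blast
  ultimately have "compact {z::'n cvec. d \<le> defect z}" by (simp add: compact_eq_bounded_closed)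
  hence "compact (f ` {z. d \<le> defect z})" using f sub
    by (intro compact_continuous_image) (auto intro: continuous_on_subset)
  hence "bdd_above (f ` {z. d \<le> defect z})" by (intro bounded_imp_bdd_above compact_imp_bounded)
  thus ?thesis unfolding bdd_above_def by auto
qed

text \<open>The slab around \<open>w\<close> is the unit ball of the gauge \<open>N(\<xi>) = max (|\<xi>|/A) (|\<langle>\<xi>,w\<rangle>|/B)\<close>, whose balls
are invariant under unit scalars. The mean value inequality holds on all gauge balls inside the
  slab, \<open>m = 2n\<close>. An integer power \<open>j\<close> of \<open>g\<close> reduces the exponent to
\<open>p/j \<le> 1\<close>.\<close>

lemma pointwise_estimate:
  fixes p \<epsilon> :: real
  assumes p: "p > 0" and e: "0 < \<epsilon>" "\<epsilon> \<le> 1/8"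
  shows "\<exists>C>0. \<forall>g w. g holomorphic_vec_on (unit_ball :: ('n::finite) cvec set) \<longrightarrow> w \<in> unit_ball \<longrightarrow>
    ennreal (cmod (g w) powr p) \<le> ennreal (C * defect w powr (- (real CARD('n) + 1))) *
      (\<integral>\<^sup>+u. ennreal (cmod (g u) powr p) * indicator {u. near \<epsilon> w u} u \<partial>lborel)"
proof -
  obtain j :: nat where j: "p < j" using reals_Archimedean2 by blast
  hence j0: "j > 0" using p by (cases j) auto
  define p' where "p' = p / j"
  have p': "0 < p'" "p' \<le> 1" using p j j0 by (auto simp: p'_def)
  define m where "m = 2 * real CARD('n)"
  define c0 :: real where "c0 = unit_ball_vol (2 * CARD('n)) / (36 * 3 ^ (2 * CARD('n)))"
  have c0: "c0 > 0" by (simp add: c0_def)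
  define c1 where "c1 = c0 * \<epsilon> ^ (2 * CARD('n))"
  have c1: "c1 > 0" using c0 e by (simp add: c1_def)
  show ?thesis
  proof (intro exI[of _ "2 powr (m / p') / c1"] conjI allI impI)
    show "0 < 2 powr (m / p') / c1" using c1 by simp
    fix g :: "'n cvec \<Rightarrow> complex" and w :: "'n cvec"
    assume g: "g holomorphic_vec_on unit_ball" and w: "w \<in> unit_ball"
    define A B where "A = \<epsilon> * sqrt (defect w)" and "B = \<epsilon> * defect w"
    have dw: "0 < defect w" "defect w \<le> 1" using defect_pos[OF w] defect_le_1[of w] by auto
    have AB: "0 < A" "0 < B" "B \<le> A" using dw e
      by (auto simp: A_def B_def intro!: real_le_rsqrt simp: power2_eq_square mult_le_cancel_left1)
    define N where "N = (\<lambda>\<xi>. max (norm \<xi> / A) (cmod (herm \<xi> w) / B))"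
    have Nslab: "{\<xi>. N \<xi> < s} = slab w (s * A) (s * B)" for s
      using AB by (auto simp: N_def slab_def pos_divide_less_eq)
    define F where "F = (\<lambda>\<xi>. cmod (g (w + \<xi>)) ^ j * indicator (slab w A B) \<xi>)"
    have inball: "w + \<xi> \<in> unit_ball" "defect w / 2 \<le> defect (w + \<xi>)" if "\<xi> \<in> slab w A B" for \<xi>
      using near_props[OF w e, of "w + \<xi>"] that by (auto simp: near_iff_slab A_def B_def)
    have contg: "continuous_on unit_ball (\<lambda>z. cmod (g z) ^ j)"
      by (intro continuous_intros holomorphic_vec_continuous_on[OF g])
    have slab_open: "open (slab w A B)"
    proof -
      have "slab w A B = {\<xi>. norm \<xi> < A} \<inter> {\<xi>. cmod (herm \<xi> w) < B}" by (auto simp: slab_def)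
      thus ?thesis by (auto intro!: open_Int open_Collect_less continuous_intros)
    qed
    have Fm: "F \<in> borel_measurable borel"
    proof -
      have "(\<lambda>\<xi>. indicator (slab w A B) \<xi> *\<^sub>R cmod (g (w + \<xi>)) ^ j) \<in> borel_measurable borel"
        by (intro borel_measurable_continuous_on_indicator continuous_on_compose2[OF contg])
           (use inball in \<open>auto intro!: continuous_intros slab_open\<close>)
      thus ?thesis by (simp add: F_def mult.commute)
    qed
    obtain K where K: "\<And>z. defect w / 2 \<le> defect z \<Longrightarrow> cmod (g z) ^ j \<le> K"
      using bounded_on_defect_ge[OF contg, of "defect w / 2"] dw by auto
    define \<kappa> where "\<kappa> = c0 * A ^ (2 * CARD('n) - 2) * B\<^sup>2"
    have \<kappa>: "\<kappa> = c1 * defect w ^ (CARD('n) + 1)"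
    proof -
      obtain k where k: "CARD('n) = Suc k" using zero_less_card_finite[where 'a='n]
        by (cases "CARD('n)") auto
      have "sqrt (defect w) ^ (2 * k) = defect w ^ k" using dw by (simp add: power_mult)
      thus ?thesis unfolding \<kappa>_def c1_def A_def B_def power_mult_distrib k
        by (simp add: power2_eq_square mult_ac)
    qed
    have \<kappa>0: "\<kappa> > 0" using c1 dw by (simp add: \<kappa>)
    have "ennreal (\<kappa> * F 0 powr p') \<le> ennreal (2 powr (m / p'))
      * (\<integral>\<^sup>+\<xi>. ennreal (F \<xi> powr p') * indicator {\<xi>. N \<xi> < 1} \<xi> \<partial>lborel)"
    proof (rule submean_absorption[where K = "max K 0"])
      show "N \<in> borel_measurable borel" unfolding N_def by measurable
      show "N (x + y) \<le> N x + N y" for x y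
      proof -
        have "norm (x + y) / A \<le> norm x / A + norm y / A"
          using AB norm_triangle_ineq[of x y]
            by (simp add: add_divide_distrib[symmetric] divide_right_mono)
        moreover have "cmod (herm (x + y) w) / B \<le> cmod (herm x w) / B + cmod (herm y w) / B"
          using AB norm_triangle_ineq[of "herm x w" "herm y w"]
          by (simp add: herm_add_left add_divide_distrib[symmetric] divide_right_mono)
        ultimately show ?thesis unfolding N_def by linarith
      qed
      show "F x \<le> max K 0" for x
        using K[OF inball(2), of x] by (auto simp: F_def indicator_def)
      fix u s assume u: "N u < 1" and s: "0 < s" "N u + s \<le> 1"
      have us: "u \<in> slab w A B" using u Nslab[of 1] by auto
      have add_slab: "u + c *s \<xi> \<in> slab w A B" if "\<xi> \<in> slab w (s * A) (s * B)" "cmod c \<le> 1" for c \<xi>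
      proof -
        have le: "cmod c * x \<le> x" if "0 \<le> x" for x using that \<open>cmod c \<le> 1\<close>
          by (rule mult_left_le_one_le[OF _ norm_ge_zero])
        have x: "norm \<xi> < s * A" "cmod (herm \<xi> w) < s * B" using that by (auto simp: slab_def)
        have "norm u / A \<le> N u" "cmod (herm u w) / B \<le> N u" by (auto simp: N_def)
        hence nu: "norm u \<le> N u * A" "cmod (herm u w) \<le> N u * B" using AB
          by (auto simp: pos_divide_le_eq)
        have "norm (u + c *s \<xi>) \<le> norm u + norm \<xi>"
          using norm_triangle_ineq[of u "c *s \<xi>"] le[of "norm \<xi>"] by (simp add: norm_smult_vec)
        also have "\<dots> < (N u + s) * A" using nu x by (simp add: distrib_right)
        also have "\<dots> \<le> 1 * A" using s AB by (intro mult_right_mono) auto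
        finally have 1: "norm (u + c *s \<xi>) < A" by simp
        have "cmod (herm (u + c *s \<xi>) w) \<le> cmod (herm u w) + cmod (herm \<xi> w)"
          using norm_triangle_ineq[of "herm u w" "c * herm \<xi> w"] le[of "cmod (herm \<xi> w)"]
          by (simp add: herm_add_left herm_smult_left norm_mult)
        also have "\<dots> < (N u + s) * B" using nu x by (simp add: distrib_right)
        also have "\<dots> \<le> 1 * B" using s AB by (intro mult_right_mono) auto
        finally show ?thesis using 1 by (simp add: slab_def)
      qed
      have G: "(\<lambda>z. g z ^ j) holomorphic_vec_on unit_ball" by (rule holomorphic_vec_power[OF g])
      have "ennreal (cmod (g (w + u) ^ j)) * emeasure lborel (slab w (s * A) (s * B))
        \<le> (\<integral>\<^sup>+\<xi>. ennreal (cmod (g (w + u + \<xi>) ^ j)) * indicator (slab w (s * A) (s * B)) \<xi> \<partial>lborel)"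
      proof (rule circular_mean_value_le[OF G])
        show "c *s \<xi> \<in> slab w (s * A) (s * B)" if "cmod c = 1" "\<xi> \<in> slab w (s * A) (s * B)" for c \<xi>
          using that by (simp add: slab_def norm_smult_vec herm_smult_left norm_mult)
        show "w + u + c *s \<xi> \<in> unit_ball" if "cmod c \<le> 1" "\<xi> \<in> slab w (s * A) (s * B)" for c \<xi>
          using inball(1)[OF add_slab[OF that(2,1)]] by (simp add: add.assoc)
      qed auto
      also have "\<dots> = (\<integral>\<^sup>+\<xi>. ennreal (F (u + \<xi>)) * indicator {\<xi>. N \<xi> < s} \<xi> \<partial>lborel)"
        unfolding Nslab
      proof (rule nn_integral_cong)
        fix \<xi> :: "'n cvec"
        show "ennreal (cmod (g (w + u + \<xi>) ^ j)) * indicator (slab w (s * A) (s * B)) \<xi>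
           = ennreal (F (u + \<xi>)) * indicator (slab w (s * A) (s * B)) \<xi>"
          using add_slab[of \<xi> 1] by (auto simp: F_def indicator_def norm_power add.assoc)
      qed
      finally have main: "ennreal (F u) * emeasure lborel (slab w (s * A) (s * B))
        \<le> (\<integral>\<^sup>+\<xi>. ennreal (F (u + \<xi>)) * indicator {\<xi>. N \<xi> < s} \<xi> \<partial>lborel)"
        using us by (simp add: F_def norm_power)
      have "ennreal (c0 * (s * A) ^ (2 * CARD('n) - 2) * (s * B)\<^sup>2)
        \<le> emeasure lborel (slab w (s * A) (s * B))"
        unfolding c0_def by (rule emeasure_slab_lower) (use w AB s in auto)
      also have "c0 * (s * A) ^ (2 * CARD('n) - 2) * (s * B)\<^sup>2 = \<kappa> * s powr m"
      proof -
        have "s powr m = s ^ (2 * CARD('n))" using s powr_realpow[of s "2 * CARD('n)"]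
          by (simp add: m_def)
        also have "\<dots> = s ^ (2 * CARD('n) - 2) * s\<^sup>2" by (rule power_twice_card)
        finally show ?thesis by (simp add: \<kappa>_def power_mult_distrib mult_ac)
      qed
      finally have "ennreal (F u) * ennreal (\<kappa> * s powr m)
        \<le> ennreal (F u) * emeasure lborel (slab w (s * A) (s * B))"
        by (rule mult_left_mono) auto
      from order_trans[OF this main]
      show "ennreal (\<kappa> * s powr m * F u) \<le> (\<integral>\<^sup>+\<xi>. ennreal (F (u + \<xi>)) * indicator {\<xi>. N \<xi>
        < s} \<xi> \<partial>lborel)"
        using \<kappa>0 by (simp add: ennreal_mult[symmetric] F_def mult_ac)
    qed (use Fm p' \<kappa>0 AB in \<open>auto simp: F_def N_def m_def le_max_iff_disj\<close>)
    also have "(\<integral>\<^sup>+\<xi>. ennreal (F \<xi> powr p') * indicator {\<xi>. N \<xi> < 1} \<xi> \<partial>lborel)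
       = (\<integral>\<^sup>+u. ennreal (cmod (g u) powr p) * indicator {u. near \<epsilon> w u} u \<partial>lborel)"
    proof -
      have pw: "(x ^ j) powr p' = x powr p" if "x \<ge> 0" for x :: real
      proof (cases "x = 0")
        case False
        thus ?thesis using that j0 by (simp add: powr_realpow[symmetric] powr_powr p'_def)
      qed (use j0 p p' in simp)
      have Sm: "(\<lambda>u. ennreal (F (u - w) powr p')) \<in> borel_measurable borel" using Fm by measurable
      have "(\<integral>\<^sup>+\<xi>. ennreal (F \<xi> powr p') * indicator {\<xi>. N \<xi> < 1} \<xi> \<partial>lborel)
        = (\<integral>\<^sup>+\<xi>. ennreal (F \<xi> powr p') \<partial>lborel)"
        using Nslab[of 1] p' by (intro nn_integral_cong) (auto simp: F_def indicator_def)
      also have "\<dots> = (\<integral>\<^sup>+u. ennreal (F (u - w) powr p') \<partial>lborel)"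
        by (rule nn_integral_lborel_diff[symmetric]) (use Fm in measurable)
      also have "\<dots> = (\<integral>\<^sup>+u. ennreal (cmod (g u) powr p) * indicator {u. near \<epsilon> w u} u \<partial>lborel)"
      proof (rule nn_integral_cong)
        fix u :: "'n cvec"
        have "u - w \<in> slab w A B \<longleftrightarrow> near \<epsilon> w u" by (simp add: near_def slab_def A_def B_def)
        thus "ennreal (F (u - w) powr p') = ennreal (cmod (g u) powr p) * indicator {u. near \<epsilon> w u} u"
          using pw[of "cmod (g u)"] p' by (auto simp: F_def indicator_def)
      qed
      finally show ?thesis .
    qed
    also have "F 0 powr p' = cmod (g w) powr p"
    proof -
      have "0 \<in> slab w A B" using AB by (simp add: slab_def)
      thus ?thesis using j0 p by (cases "g w = 0")
        (simp_all add: F_def powr_realpow[symmetric] powr_powr p'_def)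
    qed
    finally have "ennreal (1 / \<kappa>) * ennreal (\<kappa> * cmod (g w) powr p) \<le> ennreal (1 / \<kappa>) *
       (ennreal (2 powr (m / p')) * (\<integral>\<^sup>+u. ennreal (cmod (g u) powr p)
         * indicator {u. near \<epsilon> w u} u \<partial>lborel))"
      by (rule mult_left_mono) auto
    moreover have "ennreal (1 / \<kappa>) * ennreal (\<kappa> * cmod (g w) powr p) = ennreal (cmod (g w) powr p)"
      using \<kappa>0 by (simp add: ennreal_mult[symmetric])
    moreover have "ennreal (1 / \<kappa>) * ennreal (2 powr (m / p'))
      = ennreal (2 powr (m / p') / c1 * defect w powr (- (real CARD('n) + 1)))"
    proof -
      have "real CARD('n) + 1 = real (CARD('n) + 1)" by simp
      hence "defect w powr (- (real CARD('n) + 1)) = 1 / defect w ^ (CARD('n) + 1)"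
        by (simp only: powr_minus_divide powr_realpow[OF dw(1)])
      hence "1 / \<kappa> * 2 powr (m / p') = 2 powr (m / p') / c1 * defect w powr (- (real CARD('n) + 1))"
        by (simp only: \<kappa>) simp
      thus ?thesis using \<kappa>0 by (simp only: ennreal_mult'[symmetric] zero_le_divide_1_iff less_imp_le)
    qed
    ultimately show "ennreal (cmod (g w) powr p)
      \<le> ennreal (2 powr (m / p') / c1 * defect w powr (- (real CARD('n) + 1))) *
      (\<integral>\<^sup>+u. ennreal (cmod (g u) powr p) * indicator {u. near \<epsilon> w u} u \<partial>lborel)"
      by (simp only: mult.assoc[symmetric])
  qed
qed

text \<open>\<open>R g(w)\<close> is the derivative at \<open>0\<close> of \<open>c \<mapsto> g(w + cw)\<close>, so Cauchy's estimate on a circle of radius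
proportional to \<open>\<delta>(w)\<close> bounds \<open>\<delta>(w) |R g(w)|\<close> by the value of \<open>|g|\<close> at some point of the circle; the
estimate of \<open>|g|\<^sup>p\<close> applies there, with a smaller slab.\<close>

lemma radial_deriv_estimate:
  fixes p \<epsilon> :: real
  assumes p: "p > 0" and e: "0 < \<epsilon>" "\<epsilon> \<le> 1/8"
  shows "\<exists>C>0. \<forall>g w. g holomorphic_vec_on (unit_ball :: ('n::finite) cvec set) \<longrightarrow> w \<in> unit_ball \<longrightarrow>
    ennreal ((defect w * cmod (radial_deriv g w)) powr p)
      \<le> ennreal (C * defect w powr (- (real CARD('n) + 1))) *
      (\<integral>\<^sup>+u. ennreal (cmod (g u) powr p) * indicator {u. near \<epsilon> w u} u \<partial>lborel)"
proof -
  \<comment> \<open>Slabs of parameter \<open>\<delta>\<close> around the points of the circle stay in that of parameter \<open>5\<delta>\<close> at \<open>w\<close>.\<close>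
  define \<delta> where "\<delta> = \<epsilon> / 16"
  have \<delta>: "0 < \<delta>" "\<delta> \<le> 1/8" "\<delta> \<le> 1/128" using e by (auto simp: \<delta>_def)
  obtain C where C: "C > 0" "\<And>g w. g holomorphic_vec_on (unit_ball :: 'n cvec set) \<Longrightarrow> w \<in> unit_ball \<Longrightarrow>
    ennreal (cmod (g w) powr p) \<le> ennreal (C * defect w powr (- (real CARD('n) + 1))) *
      (\<integral>\<^sup>+u. ennreal (cmod (g u) powr p) * indicator {u. near \<delta> w u} u \<partial>lborel)"
    using pointwise_estimate[OF p \<delta>(1,2), where 'n='n] by blast
  define n1 where "n1 = real CARD('n) + 1"
  have n1: "n1 > 0" by (simp add: n1_def add_nonneg_pos)
  show ?thesis
  proof (intro exI[of _ "\<delta> powr (-p) * (C * 2 powr n1)"] conjI allI impI)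
    show "0 < \<delta> powr (-p) * (C * 2 powr n1)" using C(1) \<delta> by simp
    fix g :: "'n cvec \<Rightarrow> complex" and w :: "'n cvec"
    assume g: "g holomorphic_vec_on unit_ball" and w: "w \<in> unit_ball"
    have dw: "0 < defect w" "defect w \<le> 1" using defect_pos[OF w] defect_le_1[of w] by auto
    define \<rho> where "\<rho> = \<delta> * defect w"
    have \<rho>: "\<rho> > 0" "\<rho> \<le> 1/2" using \<delta> dw mult_mono[of \<delta> "1/2" "defect w" 1] by (auto simp: \<rho>_def)
    have pert: "norm (c *s w) \<le> \<delta> * sqrt (defect w)" "cmod (herm (c *s w) w)
      \<le> \<delta> * defect w" if "cmod c \<le> \<rho>" for c
    proof -
      have nw: "norm w \<le> 1" using w by simp
      have "defect w \<le> sqrt (defect w)" using dw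
        by (intro real_le_rsqrt) (simp add: power2_eq_square mult_le_cancel_left1)
      hence r: "\<rho> \<le> \<delta> * sqrt (defect w)" unfolding \<rho>_def using \<delta> by simp
      have "norm (c *s w) \<le> \<rho> * 1" unfolding norm_smult_vec using that nw \<rho> by (intro mult_mono) auto
      thus "norm (c *s w) \<le> \<delta> * sqrt (defect w)" using r by simp
      have "cmod (herm w w) \<le> 1" using cmod_herm_le[of w w] mult_mono[OF nw nw] by simp
      hence "cmod (herm (c *s w) w) \<le> \<rho> * 1" unfolding herm_smult_left norm_mult using that \<rho>
        by (intro mult_mono) auto
      thus "cmod (herm (c *s w) w) \<le> \<delta> * defect w" by (simp add: \<rho>_def)
    qed
    have inb: "w + c *s w \<in> unit_ball" if "cmod c \<le> \<rho>" for c
      by (rule near_perturb(2)[OF w \<delta>(1,2) pert[OF that]])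
    let ?c = "circle_point \<rho>"
    have cc: "cmod (?c t) = \<rho>" for t using \<rho> by (simp add: cmod_circle_point)
    have cont: "continuous_on UNIV (\<lambda>t. g (w + ?c t *s w))"
      by (intro continuous_on_compose2[OF holomorphic_vec_continuous_on[OF g]])
         (use inb cc in \<open>auto intro!: continuous_intros\<close>)
    obtain t0 where t0: "t0 \<in> {0..1}" "\<And>t. t \<in> {0..1} \<Longrightarrow> cmod (g (w + ?c t *s w))
      \<le> cmod (g (w + ?c t0 *s w))"
    proof -
      have "continuous_on {0..1} (\<lambda>t. cmod (g (w + ?c t *s w)))"
        by (intro continuous_intros continuous_on_subset[OF cont]) auto
      thus ?thesis using continuous_attains_sup[of "{0..1::real}" "\<lambda>t. cmod (g (w + ?c t *s w))"]
        that by auto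
    qed
    define c where "c = ?c t0"
    define u0 where "u0 = w + c *s w"
    have cr: "cmod c = \<rho>" by (simp add: c_def cc)
    have u0: "u0 \<in> unit_ball" unfolding u0_def by (rule inb) (simp add: cr)
    have "((\<lambda>t. inverse (?c t) * g (w + ?c t *s w)) has_integral radial_deriv g w) {0..1}"
      using holomorphic_vec_mean_value(2)[OF g open_ball \<rho>(1), of w w] inb radial_deriv_eq[OF g w]
        by simp
    moreover have "((\<lambda>t::real. cmod (g u0) / \<rho>) has_integral cmod (g u0) / \<rho>) {0..1}"
      using has_integral_const_real[of "cmod (g u0) / \<rho>" 0 1] by simp
    moreover have "cmod (inverse (?c t) * g (w + ?c t *s w)) \<le> cmod (g u0) / \<rho>" if "t \<in> {0..1}" for t
    proof -
      have "cmod (inverse (?c t) * g (w + ?c t *s w)) = cmod (g (w + ?c t *s w)) / \<rho>"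
        by (simp only: norm_mult norm_inverse cc divide_inverse mult.commute)
      also have "\<dots> \<le> cmod (g u0) / \<rho>"
        using t0(2)[OF that] \<rho> unfolding u0_def c_def by (intro divide_right_mono) auto
      finally show ?thesis .
    qed
    ultimately have "cmod (radial_deriv g w) \<le> cmod (g u0) / \<rho>"
      using integral_norm_bound_integral[of "\<lambda>t. inverse (?c t)
        * g (w + ?c t *s w)" "{0..1}" "\<lambda>t. cmod (g u0) / \<rho>"]
      by (simp add: has_integral_integrable integral_unique)
    hence Rg: "defect w * cmod (radial_deriv g w) \<le> cmod (g u0) / \<delta>"
      using \<rho> \<delta> dw by (simp add: \<rho>_def field_simps)
    have "\<bar>defect u0 - defect w\<bar> \<le> 3 * \<delta> * defect w"
      unfolding u0_def by (rule near_perturb(1)[OF w \<delta>(1,2) pert]) (simp_all add: cr)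
    moreover have "3 * \<delta> * defect w \<le> (1/2) * defect w" using \<delta> dw by (intro mult_right_mono) auto
    ultimately have du: "defect w \<le> 2 * defect u0" "defect u0 \<le> 2 * defect w" using dw by linarith+
    have sub: "near \<epsilon> w u" if "near \<delta> u0 u" for u
    proof -
      have h: "norm (u - u0) < \<delta> * sqrt (defect u0)" "cmod (herm (u - u0) u0) < \<delta> * defect u0"
        using that by (auto simp: near_def)
      have "sqrt (defect u0) \<le> 2 * sqrt (defect w)"
        using du dw by (intro real_le_lsqrt) (auto simp: power_mult_distrib)
      hence "norm (u - u0) < \<delta> * (2 * sqrt (defect w))"
        using h(1) \<delta> mult_left_mono[of "sqrt (defect u0)" "2 * sqrt (defect w)" \<delta>] by linarith
      moreover have "norm (u - w) \<le> norm (u - u0) + norm (c *s w)"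
        using norm_triangle_ineq[of "u - u0" "c *s w"] by (simp add: u0_def)
      ultimately have "norm (u - w) < 3 * \<delta> * sqrt (defect w)" using pert(1)[of c] cr by simp
      also have "\<dots> \<le> \<epsilon> * sqrt (defect w)" using e dw by (intro mult_right_mono) (auto simp: \<delta>_def)
      finally have 1: "norm (u - w) < \<epsilon> * sqrt (defect w)" .
      have "herm (u - u0) u0 = cnj (1 + c) * herm (u - u0) w"
        unfolding u0_def by (simp add: herm_def sum_distrib_left distrib_left distrib_right
          sum.distrib mult_ac)
      moreover have "1/2 \<le> cmod (1 + c)"
        using norm_triangle_ineq2[of 1 "- c"] \<rho> cr by simp
      ultimately have "1/2 * cmod (herm (u - u0) w) \<le> cmod (herm (u - u0) u0)"
        by (simp only: norm_mult complex_mod_cnj mult_right_mono norm_ge_zero)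
      hence "cmod (herm (u - u0) w) \<le> 4 * \<delta> * defect w"
        using h(2) mult_left_mono[OF du(2), of \<delta>] \<delta> by linarith
      moreover have "cmod (herm (u - w) w) \<le> cmod (herm (u - u0) w) + cmod (herm (c *s w) w)"
        using norm_triangle_ineq[of "herm (u - u0) w" "herm (c *s w) w"]
        by (simp add: herm_add_left[symmetric] u0_def)
      ultimately have "cmod (herm (u - w) w) \<le> 5 * \<delta> * defect w" using pert(2)[of c] cr by simp
      also have "\<dots> < \<epsilon> * defect w" using e dw by (intro mult_strict_right_mono) (auto simp: \<delta>_def)
      finally show ?thesis using 1 by (simp add: near_def)
    qed
    let ?J = "\<integral>\<^sup>+u. ennreal (cmod (g u) powr p) * indicator {u. near \<epsilon> w u} u \<partial>lborel"
    have "(defect w * cmod (radial_deriv g w)) powr p \<le> (cmod (g u0) / \<delta>) powr p"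
      using Rg p dw by (intro powr_mono2) auto
    also have "\<dots> = \<delta> powr (-p) * cmod (g u0) powr p" using \<delta>
      by (simp add: powr_divide powr_minus field_simps)
    finally have "ennreal ((defect w * cmod (radial_deriv g w)) powr p)
      \<le> ennreal (\<delta> powr (-p)) * ennreal (cmod (g u0) powr p)"
      by (simp add: ennreal_mult[symmetric] ennreal_leI)
    also have "\<dots> \<le> ennreal (\<delta> powr (-p)) * (ennreal (C * 2 powr n1 * defect w powr (- n1)) * ?J)"
    proof (rule mult_left_mono)
      have "ennreal (cmod (g u0) powr p) \<le> ennreal (C * defect u0 powr (- n1)) *
          (\<integral>\<^sup>+u. ennreal (cmod (g u) powr p) * indicator {u. near \<delta> u0 u} u \<partial>lborel)"
        unfolding n1_def by (rule C(2)[OF g u0])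
      also have "\<dots> \<le> ennreal (C * (2 powr n1 * defect w powr (- n1))) * ?J"
      proof (intro mult_mono ennreal_leI mult_left_mono nn_integral_mono)
        have "defect u0 powr (-n1) \<le> 2 powr \<bar>- n1\<bar> * defect w powr (-n1)"
          by (rule powr_ratio_bound) (use du dw in auto)
        thus "defect u0 powr (-n1) \<le> 2 powr n1 * defect w powr (-n1)" using n1 by simp
        show "indicator {u. near \<delta> u0 u} u \<le> (indicator {u. near \<epsilon> w u} u :: ennreal)" for u
          using sub[of u] by (auto simp: indicator_def)
      qed (use C in auto)
      finally show "ennreal (cmod (g u0) powr p) \<le> ennreal (C * 2 powr n1 * defect w powr (- n1)) * ?J"
        by (simp add: mult_ac)
    qed auto
    also have "\<dots> = ennreal (\<delta> powr (-p) * (C * 2 powr n1) * defect w powr (- n1)) * ?J"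
      unfolding mult.assoc[symmetric] by (subst ennreal_mult'[symmetric]) (auto simp: mult.assoc)
    finally show "ennreal ((defect w * cmod (radial_deriv g w)) powr p)
      \<le> ennreal (\<delta> powr (-p) * (C * 2 powr n1) * defect w powr (- (real CARD('n) + 1))) * ?J"
      by (simp add: n1_def)
  qed
qed

section \<open>Integrating pointwise estimates\<close>

lemma near_pair_measurable [measurable]:
  "{x::('n::finite) cvec \<times> 'n cvec. near \<epsilon> (fst x) (snd x)} \<in> sets (borel \<Otimes>\<^sub>M borel)"
proof -
  have "Measurable.pred (borel \<Otimes>\<^sub>M borel) (\<lambda>x::'n cvec \<times> 'n cvec. near \<epsilon> (fst x) (snd x))"
    unfolding near_def by measurable
  thus ?thesis by (simp add: pred_def space_pair_measure)
qed

lemma nn_integral_near_measurable: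
  fixes G :: "('n::finite) cvec \<Rightarrow> ennreal"
  assumes [measurable]: "G \<in> borel_measurable borel"
  shows "(\<lambda>w. \<integral>\<^sup>+u. G u * indicator {u. near \<epsilon> w u} u \<partial>lborel) \<in> borel_measurable borel"
proof -
  have "(\<lambda>x. G (snd x) * indicator {x. near \<epsilon> (fst x) (snd x)} x) \<in> borel_measurable (borel \<Otimes>\<^sub>M borel)"
    by measurable
  moreover have "sets (borel \<Otimes>\<^sub>M lborel :: ('n cvec \<times> 'n cvec) measure) = sets (borel \<Otimes>\<^sub>M borel)"
    by (intro sets_pair_measure_cong) auto
  ultimately have "(\<lambda>x. G (snd x) * indicator {x. near \<epsilon> (fst x) (snd x)} x) \<in> borel_measurable
    (borel \<Otimes>\<^sub>M lborel)"
    using measurable_cong_sets by blast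
  from lborel.borel_measurable_nn_integral_fst[OF this] show ?thesis
    by (simp add: indicator_def)
qed

lemma near_source_borel: "{w \<in> (unit_ball :: ('n::finite) cvec set). near \<epsilon> w u} \<in> sets borel"
  by (rule borel_open[OF open_near_source])

text \<open>Tonelli's theorem, together with the fact that the defects of neighbouring points are comparable.
It is used twice: with \<open>\<nu>\<close> the volume it bounds radial derivatives, and with \<open>\<nu>\<close> a Carleson
measure it gives the embedding.\<close>

lemma near_swap:
  fixes \<nu> :: "('n::finite) cvec measure" and G :: "'n cvec \<Rightarrow> ennreal" and \<epsilon> \<sigma> \<tau> C0 :: real
  assumes sets [measurable_cong]: "sets \<nu> = sets borel" and sf: "sigma_finite_measure \<nu>"
    and e: "0 < \<epsilon>" "\<epsilon> \<le> 1/8" and C0: "C0 \<ge> 0"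
    and bound: "\<And>u. u \<in> unit_ball \<Longrightarrow> emeasure \<nu> {w \<in> unit_ball. near \<epsilon> w u}
      \<le> ennreal (C0 * defect u powr \<tau>)"
    and G [measurable]: "G \<in> borel_measurable borel"
  shows "(\<integral>\<^sup>+w. ennreal (defect w powr \<sigma>) * (\<integral>\<^sup>+u. G u * indicator {u. near \<epsilon> w u} u \<partial>lborel)
    * indicator unit_ball w \<partial>\<nu>)
    \<le> ennreal (2 powr \<bar>\<sigma>\<bar> * C0) * (\<integral>\<^sup>+u. ennreal (defect u powr (\<sigma> + \<tau>)) * G u
      * indicator unit_ball u \<partial>lborel)"
proof -
  interpret \<nu>: sigma_finite_measure \<nu> by (rule sf)
  interpret P: pair_sigma_finite \<nu> "lborel :: 'n cvec measure" ..
  have ub [measurable]: "(unit_ball :: 'n cvec set) \<in> sets borel" by simp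
  define H where "H = (\<lambda>(w::'n cvec, u::'n cvec). ennreal (defect w powr \<sigma>)
    * (G u * indicator {x. near \<epsilon> (fst x) (snd x)} (w, u)) * indicator unit_ball w)"
  have Hm: "H \<in> borel_measurable (\<nu> \<Otimes>\<^sub>M lborel)"
  proof -
    have "sets (\<nu> \<Otimes>\<^sub>M (lborel :: 'n cvec measure)) = sets (borel \<Otimes>\<^sub>M borel)"
      by (intro sets_pair_measure_cong sets) auto
    moreover have "H \<in> borel_measurable (borel \<Otimes>\<^sub>M borel)"
      unfolding H_def case_prod_unfold by measurable
    ultimately show ?thesis by (simp cong: measurable_cong_sets)
  qed
  have Gm: "(\<lambda>u. G u * indicator {u. near \<epsilon> w u} u) \<in> borel_measurable lborel" for w
    using near_measurable[of \<epsilon> w] by measurable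
  have "(\<integral>\<^sup>+w. ennreal (defect w powr \<sigma>) * (\<integral>\<^sup>+u. G u * indicator {u. near \<epsilon> w u} u \<partial>lborel)
    * indicator unit_ball w \<partial>\<nu>)
     = (\<integral>\<^sup>+w. \<integral>\<^sup>+u. H (w, u) \<partial>lborel \<partial>\<nu>)"
  proof (rule nn_integral_cong)
    fix w :: "'n cvec"
    have "(\<integral>\<^sup>+u. H (w, u) \<partial>lborel) = (\<integral>\<^sup>+u. ennreal (defect w powr \<sigma>) * indicator unit_ball w
      * (G u * indicator {u. near \<epsilon> w u} u) \<partial>lborel)"
      unfolding H_def by (intro nn_integral_cong) (auto simp: indicator_def)
    also have "\<dots> = ennreal (defect w powr \<sigma>) * indicator unit_ball w
      * (\<integral>\<^sup>+u. (G u * indicator {u. near \<epsilon> w u} u) \<partial>lborel)"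
      by (rule nn_integral_cmult[OF Gm])
    finally show "ennreal (defect w powr \<sigma>) * (\<integral>\<^sup>+u. G u * indicator {u. near \<epsilon> w u} u \<partial>lborel)
      * indicator unit_ball w = (\<integral>\<^sup>+u. H (w, u) \<partial>lborel)"
      by (simp add: mult_ac)
  qed
  also have "\<dots> = (\<integral>\<^sup>+u. \<integral>\<^sup>+w. H (w, u) \<partial>\<nu> \<partial>lborel)" by (rule P.Fubini'[symmetric]) (use Hm in simp)
  also have "\<dots> \<le> (\<integral>\<^sup>+u. ennreal (2 powr \<bar>\<sigma>\<bar> * C0)
    * (ennreal (defect u powr (\<sigma> + \<tau>)) * G u * indicator unit_ball u) \<partial>lborel)"
  proof (rule nn_integral_mono)
    fix u :: "'n cvec"
    have "(\<integral>\<^sup>+w. H (w, u) \<partial>\<nu>) \<le> (\<integral>\<^sup>+w. ennreal (2 powr \<bar>\<sigma>\<bar> * defect u powr \<sigma>) * G u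
      * indicator unit_ball u * indicator {w \<in> unit_ball. near \<epsilon> w u} w \<partial>\<nu>)"
    proof (rule nn_integral_mono)
      fix w :: "'n cvec"
      show "H (w, u) \<le> ennreal (2 powr \<bar>\<sigma>\<bar> * defect u powr \<sigma>) * G u * indicator unit_ball u
        * indicator {w \<in> unit_ball. near \<epsilon> w u} w"
      proof (cases "w \<in> unit_ball \<and> near \<epsilon> w u")
        case True
        hence w: "w \<in> unit_ball" "near \<epsilon> w u" by auto
        note np = near_props[OF w(1) e w(2)]
        have "defect w powr \<sigma> \<le> 2 powr \<bar>\<sigma>\<bar> * defect u powr \<sigma>"
          by (rule powr_ratio_bound) (use np w defect_pos[of w] defect_pos[of u] in auto)
        hence "ennreal (defect w powr \<sigma>) * G u \<le> ennreal (2 powr \<bar>\<sigma>\<bar> * defect u powr \<sigma>) * G u"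
          by (intro mult_right_mono ennreal_leI) auto
        thus ?thesis using w np by (simp add: H_def)
      qed (auto simp: H_def indicator_def)
    qed
    also have "\<dots> = ennreal (2 powr \<bar>\<sigma>\<bar> * defect u powr \<sigma>) * G u * indicator unit_ball u
      * emeasure \<nu> {w \<in> unit_ball. near \<epsilon> w u}"
      by (rule nn_integral_cmult_indicator) (use near_source_borel sets in auto)
    also have "\<dots> \<le> ennreal (2 powr \<bar>\<sigma>\<bar> * defect u powr \<sigma>) * G u * indicator unit_ball u
      * ennreal (C0 * defect u powr \<tau>)"
      using bound[of u] by (cases "u \<in> unit_ball") (auto intro!: mult_left_mono)
    also have "\<dots> = (ennreal (2 powr \<bar>\<sigma>\<bar> * defect u powr \<sigma>) * ennreal (C0 * defect u powr \<tau>))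
      * (G u * indicator unit_ball u)"
      by (simp only: mult_ac)
    also have "ennreal (2 powr \<bar>\<sigma>\<bar> * defect u powr \<sigma>) * ennreal (C0 * defect u powr \<tau>)
      = ennreal (2 powr \<bar>\<sigma>\<bar> * C0) * ennreal (defect u powr (\<sigma> + \<tau>))"
      using C0 by (simp add: ennreal_mult[symmetric] powr_add mult_ac)
    finally show "(\<integral>\<^sup>+w. H (w, u) \<partial>\<nu>) \<le> ennreal (2 powr \<bar>\<sigma>\<bar> * C0)
      * (ennreal (defect u powr (\<sigma> + \<tau>)) * G u * indicator unit_ball u)"
      by (simp only: mult.assoc)
  qed
  also have "\<dots> = ennreal (2 powr \<bar>\<sigma>\<bar> * C0) * (\<integral>\<^sup>+u. ennreal (defect u powr (\<sigma> + \<tau>)) * G u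
    * indicator unit_ball u \<partial>lborel)"
    by (rule nn_integral_cmult) measurable
  finally show ?thesis .
qed

text \<open>The points \<open>w\<close> having \<open>u\<close> as a neighbour satisfy \<open>|1 - \<langle>w,u\<rangle>|
  \<le> (3/2) \<delta>(u)\<close>, hence lie in a tube of
size comparable to \<open>\<delta>(u)\<close>.\<close>

lemma emeasure_near_source_le:
  "\<exists>C>0. \<forall>\<epsilon> u. 0 < \<epsilon> \<longrightarrow> \<epsilon> \<le> 1/8 \<longrightarrow> u \<in> (unit_ball :: ('n::finite) cvec set) \<longrightarrow>
    emeasure lborel {w \<in> unit_ball. near \<epsilon> w u} \<le> ennreal (C * defect u powr (real CARD('n) + 1))"
proof -
  obtain C where C: "C > 0" "\<And>r \<zeta>. r > 0 \<Longrightarrow> \<zeta> \<in> sphere (0::'n cvec) 1 \<Longrightarrow>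
     emeasure lborel (carleson_tube \<zeta> r) \<le> ennreal (C * r ^ (CARD('n) + 1))"
    using emeasure_carleson_tube_le by blast
  show ?thesis
  proof (intro exI[of _ "C * 4 ^ (CARD('n) + 1)"] conjI allI impI)
    show "0 < C * 4 ^ (CARD('n) + 1)" using C by simp
    fix \<epsilon> :: real and u :: "'n cvec"
    assume e: "0 < \<epsilon>" "\<epsilon> \<le> 1/8" and u: "u \<in> unit_ball"
    have du: "defect u > 0" by (rule defect_pos[OF u])
    obtain \<zeta> where \<zeta>: "\<zeta> \<in> sphere 0 1" "u = norm u *\<^sub>R \<zeta>" using unit_direction_exists[of u] by blast
    have "{w \<in> unit_ball. near \<epsilon> w u} \<subseteq> carleson_tube \<zeta> (4 * defect u)"
    proof
      fix w assume "w \<in> {w \<in> unit_ball. near \<epsilon> w u}"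
      hence w: "w \<in> unit_ball" "near \<epsilon> w u" by auto
      note np = near_props[OF w(1) e w(2)]
      have "2 * \<epsilon> * defect w \<le> (1/4) * (2 * defect u)"
        using e np defect_pos[OF w(1)] by (intro mult_mono) auto
      hence h: "cmod (herm (u - w) u) \<le> defect u / 2" using np by simp
      have "1 - herm w u = of_real (defect u) + herm (u - w) u"
        by (simp add: herm_diff_left herm_self defect_def)
      hence "cmod (1 - herm w u) \<le> defect u + cmod (herm (u - w) u)"
        using norm_triangle_ineq[of "of_real (defect u)" "herm (u - w) u"] du by simp
      hence a: "cmod (1 - herm w u) \<le> (3/2) * defect u" using h by simp
      have "cmod (1 - herm w \<zeta>) \<le> 2 * cmod (1 - herm w (norm u *\<^sub>R \<zeta>))"
        by (rule cmod_one_minus_herm_radial_le) (use \<zeta> w u in auto)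
      hence "cmod (1 - herm w \<zeta>) < 4 * defect u" using a du unfolding \<zeta>(2)[symmetric] by simp
      thus "w \<in> carleson_tube \<zeta> (4 * defect u)" using w by (simp add: carleson_tube_def)
    qed
    hence "emeasure lborel {w \<in> unit_ball. near \<epsilon> w u}
      \<le> emeasure lborel (carleson_tube \<zeta> (4 * defect u))"
      by (rule emeasure_mono) simp
    also have "\<dots> \<le> ennreal (C * (4 * defect u) ^ (CARD('n) + 1))"
      using C(2)[of "4 * defect u" \<zeta>] du \<zeta> by simp
    also have "C * (4 * defect u) ^ (CARD('n) + 1)
      = C * 4 ^ (CARD('n) + 1) * defect u powr (real CARD('n) + 1)"
    proof -
      have "defect u powr (real CARD('n) + 1) = defect u ^ (CARD('n) + 1)"
        using powr_realpow[OF du, of "CARD('n) + 1"] by (simp only: of_nat_add of_nat_1)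
      thus ?thesis by (simp only: power_mult_distrib mult.assoc)
    qed
    finally show "emeasure lborel {w \<in> unit_ball. near \<epsilon> w u}
      \<le> ennreal (C * 4 ^ (CARD('n) + 1) * defect u powr (real CARD('n) + 1))" .
  qed
qed

lemma borel_measurable_cmod_powr_indicator:
  assumes g: "g holomorphic_vec_on (unit_ball :: ('n::finite) cvec set)" and p: "p > 0"
  shows "(\<lambda>u. ennreal (cmod (g u) powr p) * indicator unit_ball u) \<in> borel_measurable borel"
proof (rule borel_measurable_times_indicator_open)
  show "continuous_on unit_ball (\<lambda>u. cmod (g u) powr p)"
    by (rule continuous_on_powr') (use p in \<open>auto intro!: continuous_intros
      holomorphic_vec_continuous_on[OF g]\<close>)
qed simp

text \<open>Each application of \<open>R\<close> costs one power of the defect.\<close>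

lemma radial_deriv_weighted_Lp:
  fixes p \<beta> :: real
  assumes p: "p > 0"
  shows "\<exists>C>0. \<forall>g. g holomorphic_vec_on (unit_ball :: ('n::finite) cvec set) \<longrightarrow>
    ball_integral lborel (\<lambda>w. defect w powr (\<beta> + p) * cmod (radial_deriv g w) powr p)
    \<le> ennreal C * ball_integral lborel (\<lambda>w. defect w powr \<beta> * cmod (g w) powr p)"
proof -
  define n1 where "n1 = real CARD('n) + 1"
  obtain C1 where C1: "C1 > 0" "\<And>g w. g holomorphic_vec_on (unit_ball :: 'n cvec set) \<Longrightarrow> w \<in> unit_ball \<Longrightarrow>
    ennreal ((defect w * cmod (radial_deriv g w)) powr p) \<le> ennreal (C1 * defect w powr (- n1)) *
      (\<integral>\<^sup>+u. ennreal (cmod (g u) powr p) * indicator {u. near (1/8) w u} u \<partial>lborel)"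
    using radial_deriv_estimate[OF p, of "1/8", where 'n='n] by (auto simp: n1_def)
  obtain C2 where C2: "C2 > 0" "\<And>\<epsilon> u. 0 < \<epsilon> \<Longrightarrow> \<epsilon> \<le> 1/8 \<Longrightarrow> u \<in> (unit_ball :: 'n cvec set) \<Longrightarrow>
    emeasure lborel {w \<in> unit_ball. near \<epsilon> w u} \<le> ennreal (C2 * defect u powr n1)"
    using emeasure_near_source_le[where 'n='n] unfolding n1_def by blast
  define D where "D = 2 powr \<bar>\<beta> - n1\<bar> * C2"
  show ?thesis
  proof (intro exI[of _ "C1 * D"] conjI allI impI)
    show "0 < C1 * D" using C1 C2 by (simp add: D_def)
    fix g :: "'n cvec \<Rightarrow> complex" assume g: "g holomorphic_vec_on unit_ball"
    define G where "G = (\<lambda>u. ennreal (cmod (g u) powr p) * indicator unit_ball u)"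
    have G: "G \<in> borel_measurable borel" unfolding G_def
      by (rule borel_measurable_cmod_powr_indicator[OF g p])
    have GN: "(\<integral>\<^sup>+u. ennreal (cmod (g u) powr p) * indicator {u. near (1/8) w u} u \<partial>lborel) =
        (\<integral>\<^sup>+u. G u * indicator {u. near (1/8) w u} u \<partial>lborel)" if "w \<in> unit_ball" for w
      using near_props(1)[OF that, of "1/8"] by (intro nn_integral_cong)
        (auto simp: G_def indicator_def)
    have pt: "ennreal (defect w powr (\<beta> + p) * cmod (radial_deriv g w) powr p) * indicator unit_ball w
       \<le> ennreal C1 * (ennreal (defect w powr (\<beta> - n1))
         * (\<integral>\<^sup>+u. G u * indicator {u. near (1/8) w u} u \<partial>lborel) * indicator unit_ball w)" for w
    proof (cases "w \<in> unit_ball")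
      case True
      have dw: "defect w > 0" by (rule defect_pos[OF True])
      have "defect w powr (\<beta> + p) * cmod (radial_deriv g w) powr p
        = defect w powr \<beta> * (defect w * cmod (radial_deriv g w)) powr p"
        using dw by (simp add: powr_add powr_mult)
      hence "ennreal (defect w powr (\<beta> + p) * cmod (radial_deriv g w) powr p)
        = ennreal (defect w powr \<beta>) * ennreal ((defect w * cmod (radial_deriv g w)) powr p)"
        by (simp only: ennreal_mult' powr_ge_zero)
      also have "\<dots> \<le> ennreal (defect w powr \<beta>)
        * (ennreal (C1 * defect w powr (- n1)) * (\<integral>\<^sup>+u. G u * indicator {u. near (1/8) w u} u \<partial>lborel))"
        using C1(2)[OF g True] unfolding GN[OF True] by (rule mult_left_mono) auto
      also have "\<dots> = ennreal (C1 * defect w powr (\<beta> - n1))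
        * (\<integral>\<^sup>+u. G u * indicator {u. near (1/8) w u} u \<partial>lborel)"
      proof -
        have "defect w powr \<beta> * (C1 * defect w powr (- n1)) = C1 * defect w powr (\<beta> - n1)"
          by (simp add: powr_add[symmetric])
        hence "ennreal (defect w powr \<beta>) * ennreal (C1 * defect w powr (- n1))
          = ennreal (C1 * defect w powr (\<beta> - n1))"
          by (simp only: ennreal_mult'[symmetric] powr_ge_zero)
        thus ?thesis by (simp only: mult.assoc[symmetric])
      qed
      finally show ?thesis using True C1(1) by (simp add: ennreal_mult mult_ac)
    qed simp
    let ?J = "\<lambda>w. ennreal (defect w powr (\<beta> - n1))
      * (\<integral>\<^sup>+u. G u * indicator {u. near (1/8) w u} u \<partial>lborel) * indicator unit_ball w"
    have "ball_integral lborel (\<lambda>w. defect w powr (\<beta> + p) * cmod (radial_deriv g w) powr p)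
      \<le> (\<integral>\<^sup>+w. ennreal C1 * ?J w \<partial>lborel)"
      by (rule nn_integral_mono) (rule pt)
    also have "\<dots> = ennreal C1 * (\<integral>\<^sup>+w. ?J w \<partial>lborel)"
    proof (rule nn_integral_cmult)
      have [measurable]: "(unit_ball :: 'n cvec set) \<in> sets borel" by simp
      have "(\<lambda>w. \<integral>\<^sup>+u. G u * indicator {u. near (1/8) w u} u \<partial>lborel) \<in> borel_measurable borel"
        by (rule nn_integral_near_measurable[OF G])
      thus "?J \<in> borel_measurable lborel" by measurable
    qed
    also have "\<dots> \<le> ennreal C1 * (ennreal D * (\<integral>\<^sup>+u. ennreal (defect u powr (\<beta> - n1 + n1)) * G u
      * indicator unit_ball u \<partial>lborel))"
      unfolding D_def
      by (intro mult_left_mono near_swap C2(2) G) (use C2(1) sigma_finite_lborel in auto)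
    also have "\<dots> = ennreal (C1 * D) * ball_integral lborel (\<lambda>u. defect u powr \<beta> * cmod (g u) powr p)"
    proof -
      have "(\<integral>\<^sup>+u. ennreal (defect u powr (\<beta> - n1 + n1)) * G u * indicator unit_ball u \<partial>lborel)
        = ball_integral lborel (\<lambda>u. defect u powr \<beta> * cmod (g u) powr p)"
        by (intro nn_integral_cong) (simp add: G_def indicator_def ennreal_mult)
      thus ?thesis using C1(1) by (simp add: ennreal_mult' mult.assoc)
    qed
    finally show "ball_integral lborel (\<lambda>w. defect w powr (\<beta> + p) * cmod (radial_deriv g w) powr p)
      \<le> ennreal (C1 * D) * ball_integral lborel (\<lambda>w. defect w powr \<beta> * cmod (g w) powr p)" .
  qed
qed

lemma iterated_radial_deriv_weighted_Lp:
  fixes p \<beta> :: real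
  assumes p: "p > 0"
  shows "\<exists>C>0. \<forall>g. g holomorphic_vec_on (unit_ball :: ('n::finite) cvec set) \<longrightarrow>
    ball_integral lborel (\<lambda>w. defect w powr (\<beta> + p * real j) * cmod ((radial_deriv ^^ j) g w) powr p)
    \<le> ennreal C * ball_integral lborel (\<lambda>w. defect w powr \<beta> * cmod (g w) powr p)"
proof (induction j)
  case 0
  show ?case by (intro exI[of _ 1]) auto
next
  case (Suc j)
  obtain C where C: "C > 0" "\<And>g. g holomorphic_vec_on (unit_ball :: 'n cvec set) \<Longrightarrow>
    ball_integral lborel (\<lambda>w. defect w powr (\<beta> + p * real j) * cmod ((radial_deriv ^^ j) g w) powr p)
    \<le> ennreal C * ball_integral lborel (\<lambda>w. defect w powr \<beta> * cmod (g w) powr p)"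
    using Suc by blast
  obtain C' where C': "C' > 0" "\<And>g. g holomorphic_vec_on (unit_ball :: 'n cvec set) \<Longrightarrow>
    ball_integral lborel (\<lambda>w. defect w powr (\<beta> + p * real j + p) * cmod (radial_deriv g w) powr p)
    \<le> ennreal C' * ball_integral lborel (\<lambda>w. defect w powr (\<beta> + p * real j) * cmod (g w) powr p)"
    using radial_deriv_weighted_Lp[OF p, of "\<beta> + p * real j", where 'n='n] by blast
  show ?case
  proof (intro exI[of _ "C' * C"] conjI allI impI)
    show "C' * C > 0" using C C' by simp
    fix g :: "'n cvec \<Rightarrow> complex" assume g: "g holomorphic_vec_on unit_ball"
    have "\<beta> + p * real (Suc j) = \<beta> + p * real j + p" by (simp add: algebra_simps)
    hence "ball_integral lborel (\<lambda>w. defect w powr (\<beta> + p * real (Suc j))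
      * cmod ((radial_deriv ^^ Suc j) g w) powr p)
      = ball_integral lborel (\<lambda>w. defect w powr (\<beta> + p * real j + p)
        * cmod (radial_deriv ((radial_deriv ^^ j) g) w) powr p)"
      by (simp only: funpow.simps o_apply)
    also have "\<dots> \<le> ennreal C' * ball_integral lborel (\<lambda>w. defect w powr (\<beta> + p * real j)
      * cmod ((radial_deriv ^^ j) g w) powr p)"
      by (rule C'(2)) (rule holomorphic_vec_iterated_radial_deriv[OF g open_ball])
    also have "\<dots> \<le> ennreal C' * (ennreal C * ball_integral lborel (\<lambda>w. defect w powr \<beta>
      * cmod (g w) powr p))"
      by (intro mult_left_mono C(2)[OF g]) auto
    finally show "ball_integral lborel (\<lambda>w. defect w powr (\<beta> + p * real (Suc j))
      * cmod ((radial_deriv ^^ Suc j) g w) powr p)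
      \<le> ennreal (C' * C) * ball_integral lborel (\<lambda>w. defect w powr \<beta> * cmod (g w) powr p)"
      using C'(1) by (simp add: ennreal_mult' mult.assoc)
  qed
qed

section \<open>The embedding theorem\<close>

text \<open>Exchanging the order of integration requires \<open>\<sigma>\<close>-finiteness. The sets in the hypothesis are open
and cover the ball, so by Lindelof's theorem countably many of them do.\<close>

lemma sigma_finite_from_near:
  fixes \<nu> :: "('n::finite) cvec measure"
  assumes sets: "sets \<nu> = sets borel" and null: "emeasure \<nu> (- unit_ball) = 0" and e: "0 < \<epsilon>"
    and fin: "\<And>u. u \<in> unit_ball \<Longrightarrow> emeasure \<nu> {w \<in> unit_ball. near \<epsilon> w u} < \<infinity>"
  shows "sigma_finite_measure \<nu>"
proof
  define \<F> where "\<F> = (\<lambda>u. {w \<in> (unit_ball :: 'n cvec set). near \<epsilon> w u}) ` unit_ball"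
  obtain \<F>' where F': "\<F>' \<subseteq> \<F>" "countable \<F>'" "\<Union>\<F>' = \<Union>\<F>"
    using Lindelof[of \<F>] open_near_source by (auto simp: \<F>_def)
  have "\<Union>\<F> = unit_ball" using near_refl[OF _ e] unfolding \<F>_def by blast
  hence "\<Union>(insert (- unit_ball) \<F>') = space \<nu>"
    using F' sets_eq_imp_space_eq[OF sets] by auto
  moreover have "insert (- unit_ball) \<F>' \<subseteq> sets \<nu>"
    using F'(1) sets near_source_borel by (auto simp: \<F>_def)
  moreover have "\<forall>a\<in>insert (- unit_ball) \<F>'. emeasure \<nu> a \<noteq> \<infinity>"
    using F'(1) fin null by (auto simp: \<F>_def less_top[symmetric])
  ultimately show "\<exists>A. countable A \<and> A \<subseteq> sets \<nu> \<and> \<Union>A = space \<nu> \<and> (\<forall>a\<in>A. emeasure \<nu> a \<noteq> \<infinity>)"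
    using F'(2) by (intro exI[of _ "insert (- unit_ball) \<F>'"]) auto
qed

text \<open>Let \<open>J(w)\<close> be the integral of \<open>|F|\<^sup>p \<delta>\<^sup>\<gamma>\<close> over the slab around \<open>w\<close>. The pointwise estimate
raised to the power \<open>q/p\<close> gives \<open>|F|\<^sup>q \<le> const \<delta>\<^bsup>-\<tau>\<^esup> J\<^bsup>q/p\<^esup>\<close>. All but one power of \<open>J\<close> are bounded by
the full integral \<open>I\<close>, which is where \<open>q \<ge> p\<close> enters, and the remaining one is integrated by
\<open>near_swap\<close>.\<close>

lemma carleson_embedding:
  fixes \<nu> :: "('n::finite) cvec measure" and p q \<gamma> \<epsilon> \<tau> C0 :: real
  assumes sets [measurable_cong]: "sets \<nu> = sets borel" and sf: "sigma_finite_measure \<nu>"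
    and e: "0 < \<epsilon>" "\<epsilon> \<le> 1/8" and C0: "C0 > 0" and p: "0 < p" "p \<le> q"
    and \<tau>: "\<tau> = (real CARD('n) + 1 + \<gamma>) * q / p"
    and bound: "\<And>u. u \<in> unit_ball \<Longrightarrow> emeasure \<nu> {w \<in> unit_ball. near \<epsilon> w u}
      \<le> ennreal (C0 * defect u powr \<tau>)"
  shows "\<exists>C>0. \<forall>F I. F holomorphic_vec_on unit_ball \<longrightarrow> I \<ge> 0 \<longrightarrow>
    ball_integral lborel (\<lambda>w. defect w powr \<gamma> * cmod (F w) powr p) \<le> ennreal I \<longrightarrow>
    ball_integral \<nu> (\<lambda>w. cmod (F w) powr q) \<le> ennreal (C * I powr (q / p))"
proof -
  define n1 where "n1 = real CARD('n) + 1"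
  define r where "r = q / p"
  have r: "r \<ge> 1" "r > 0" using p by (auto simp: r_def)
  have \<tau>r: "\<tau> = (n1 + \<gamma>) * r" by (simp add: \<tau> n1_def r_def)
  obtain C1 where C1: "C1 > 0" "\<And>g w. g holomorphic_vec_on (unit_ball :: 'n cvec set) \<Longrightarrow> w \<in> unit_ball \<Longrightarrow>
    ennreal (cmod (g w) powr p) \<le> ennreal (C1 * defect w powr (- n1)) *
      (\<integral>\<^sup>+u. ennreal (cmod (g u) powr p) * indicator {u. near \<epsilon> w u} u \<partial>lborel)"
    using pointwise_estimate[OF p(1) e, where 'n='n] unfolding n1_def by blast
  define K where "K = C1 * 2 powr \<bar>\<gamma>\<bar>"
  have K: "K > 0" using C1 by (simp add: K_def)
  show ?thesis
  proof (intro exI[of _ "K powr r * (2 powr \<bar>\<tau>\<bar> * C0)"] conjI allI impI)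
    show "0 < K powr r * (2 powr \<bar>\<tau>\<bar> * C0)" using K C0 by simp
    fix F :: "'n cvec \<Rightarrow> complex" and I :: real
    assume F: "F holomorphic_vec_on unit_ball" and I: "I \<ge> 0"
      and le: "ball_integral lborel (\<lambda>w. defect w powr \<gamma> * cmod (F w) powr p) \<le> ennreal I"
    define G where "G = (\<lambda>u. ennreal (defect u powr \<gamma>)
      * (ennreal (cmod (F u) powr p) * indicator unit_ball u))"
    have G [measurable]: "G \<in> borel_measurable borel"
      using borel_measurable_cmod_powr_indicator[OF F p(1)] unfolding G_def by measurable
    have Gle: "(\<integral>\<^sup>+u. G u \<partial>lborel) \<le> ennreal I"
      using le by (simp add: G_def ennreal_mult' mult.assoc)
    define J where "J = (\<lambda>w. \<integral>\<^sup>+u. G u * indicator {u. near \<epsilon> w u} u \<partial>lborel)"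
    have JI: "J w \<le> ennreal I" for w
      unfolding J_def by (rule order_trans[OF nn_integral_mono Gle]) (auto simp: indicator_def)
    have pt: "ennreal (cmod (F w) powr q) * indicator unit_ball w \<le>
       ennreal (K powr r * I powr (r - 1)) * (ennreal (defect w powr (-\<tau>)) * J w
         * indicator unit_ball w)" for w
    proof (cases "w \<in> unit_ball")
      case True
      have dw: "defect w > 0" by (rule defect_pos[OF True])
      obtain j where j: "J w = ennreal j" "0 \<le> j" "j \<le> I"
        using JI[of w] I by (cases "J w") (auto simp: top_unique)
      have "ennreal (cmod (F w) powr p) \<le> ennreal (C1 * defect w powr (- n1)) *
          (\<integral>\<^sup>+u. ennreal (cmod (F u) powr p) * indicator {u. near \<epsilon> w u} u \<partial>lborel)"
        by (rule C1(2)[OF F True])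
      also have "\<dots> \<le> ennreal (C1 * defect w powr (- n1))
        * (\<integral>\<^sup>+u. ennreal (2 powr \<bar>\<gamma>\<bar> * defect w powr (-\<gamma>))
        * (G u * indicator {u. near \<epsilon> w u} u) \<partial>lborel)"
      proof (intro mult_left_mono nn_integral_mono)
        fix u :: "'n cvec"
        show "ennreal (cmod (F u) powr p) * indicator {u. near \<epsilon> w u} u \<le>
          ennreal (2 powr \<bar>\<gamma>\<bar> * defect w powr (-\<gamma>)) * (G u * indicator {u. near \<epsilon> w u} u)"
        proof (cases "near \<epsilon> w u")
          case nr: True
          note np = near_props[OF True e nr]
          have du: "defect u > 0" by (rule defect_pos[OF np(1)])
          have "defect w powr \<gamma> \<le> 2 powr \<bar>\<gamma>\<bar> * defect u powr \<gamma>"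
            by (rule powr_ratio_bound) (use np dw du in auto)
          hence "1 \<le> 2 powr \<bar>\<gamma>\<bar> * defect w powr (-\<gamma>) * defect u powr \<gamma>"
            using dw by (simp add: powr_minus field_simps)
          hence "1 * cmod (F u) powr p \<le> 2 powr \<bar>\<gamma>\<bar> * defect w powr (-\<gamma>) * defect u powr \<gamma>
            * cmod (F u) powr p"
            by (rule mult_right_mono) simp
          hence "ennreal (cmod (F u) powr p) \<le> ennreal (2 powr \<bar>\<gamma>\<bar> * defect w powr (-\<gamma>)
            * (defect u powr \<gamma> * cmod (F u) powr p))"
            by (intro ennreal_leI) (simp add: mult.assoc)
          also have "\<dots> = ennreal (2 powr \<bar>\<gamma>\<bar> * defect w powr (-\<gamma>))
            * (ennreal (defect u powr \<gamma>) * ennreal (cmod (F u) powr p))"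
            by (simp add: ennreal_mult)
          finally show ?thesis using nr np by (simp add: G_def)
        qed simp
      qed auto
      also have "(\<integral>\<^sup>+u. ennreal (2 powr \<bar>\<gamma>\<bar> * defect w powr (-\<gamma>))
        * (G u * indicator {u. near \<epsilon> w u} u) \<partial>lborel)
         = ennreal (2 powr \<bar>\<gamma>\<bar> * defect w powr (-\<gamma>)) * J w"
      proof -
        have "(\<lambda>u. G u * indicator {u. near \<epsilon> w u} u) \<in> borel_measurable lborel"
          using near_measurable[of \<epsilon> w] by measurable
        thus ?thesis unfolding J_def by (rule nn_integral_cmult)
      qed
      also have "ennreal (C1 * defect w powr (- n1))
        * (ennreal (2 powr \<bar>\<gamma>\<bar> * defect w powr (-\<gamma>)) * J w)
        = ennreal (K * defect w powr (- (n1 + \<gamma>)) * j)"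
      proof -
        have "defect w powr (- n1) * defect w powr (-\<gamma>) = defect w powr (- (n1 + \<gamma>))"
          by (simp add: powr_add[symmetric])
        hence eq: "(C1 * defect w powr (- n1)) * ((2 powr \<bar>\<gamma>\<bar> * defect w powr (-\<gamma>)) * j)
          = K * defect w powr (- (n1 + \<gamma>)) * j"
          by (simp add: K_def mult_ac)
        have "ennreal a * (ennreal b * ennreal j) = ennreal (a * (b * j))" if "0 \<le> a" "0 \<le> b" for a b
          using that j(2) by (simp add: ennreal_mult)
        thus ?thesis unfolding j(1) eq[symmetric] using C1(1) by simp
      qed
      finally have "cmod (F w) powr p \<le> K * defect w powr (- (n1 + \<gamma>)) * j"
        using K j(2) by (subst (asm) ennreal_le_iff) auto
      hence "(cmod (F w) powr p) powr r \<le> (K * defect w powr (- (n1 + \<gamma>)) * j) powr r"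
        using r by (intro powr_mono2) auto
      also have "(cmod (F w) powr p) powr r = cmod (F w) powr q" using p by (simp add: powr_powr r_def)
      also have "(K * defect w powr (- (n1 + \<gamma>)) * j) powr r = K powr r * defect w powr (-\<tau>) * j powr r"
      proof -
        have "(K * X * j) powr r = K powr r * X powr r * j powr r" if "0 \<le> X" for X
          using that K j(2) by (simp add: powr_mult)
        moreover have "(defect w powr (- (n1 + \<gamma>))) powr r = defect w powr (-\<tau>)"
          by (simp only: powr_powr \<tau>r minus_mult_left)
        ultimately show ?thesis by simp
      qed
      also have "\<dots> \<le> K powr r * defect w powr (-\<tau>) * (I powr (r - 1) * j)"
      proof (rule mult_left_mono)
        show "j powr r \<le> I powr (r - 1) * j"
        proof (cases "j = 0")
          case False
          hence "j powr r = j powr (r - 1) * j" using j(2) by (simp add: powr_diff)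
          also have "\<dots> \<le> I powr (r - 1) * j" using j r by (intro mult_right_mono powr_mono2) auto
          finally show ?thesis .
        qed simp
      qed simp
      finally have "ennreal (cmod (F w) powr q)
        \<le> ennreal (K powr r * I powr (r - 1) * (defect w powr (-\<tau>) * j))"
        by (intro ennreal_leI) (simp add: mult_ac)
      also have "\<dots> = ennreal (K powr r * I powr (r - 1)) * (ennreal (defect w powr (-\<tau>)) * J w)"
        unfolding j(1) using j(2) by (simp add: ennreal_mult)
      finally show ?thesis using True by simp
    qed simp
    have "ball_integral \<nu> (\<lambda>w. cmod (F w) powr q) \<le>
       (\<integral>\<^sup>+w. ennreal (K powr r * I powr (r - 1))
         * (ennreal (defect w powr (-\<tau>)) * J w * indicator unit_ball w) \<partial>\<nu>)"
      by (rule nn_integral_mono) (rule pt)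
    also have "\<dots> = ennreal (K powr r * I powr (r - 1))
      * (\<integral>\<^sup>+w. ennreal (defect w powr (-\<tau>)) * J w * indicator unit_ball w \<partial>\<nu>)"
    proof (rule nn_integral_cmult)
      have [measurable]: "(unit_ball :: 'n cvec set) \<in> sets borel" by simp
      have "J \<in> borel_measurable borel"
        unfolding J_def by (rule nn_integral_near_measurable[OF G])
      thus "(\<lambda>w. ennreal (defect w powr (-\<tau>)) * J w * indicator unit_ball w) \<in> borel_measurable \<nu>"
        by measurable
    qed
    also have "\<dots> \<le> ennreal (K powr r * I powr (r - 1))
      * (ennreal (2 powr \<bar>-\<tau>\<bar> * C0) * (\<integral>\<^sup>+u. ennreal (defect u powr (-\<tau> + \<tau>)) * G u
      * indicator unit_ball u \<partial>lborel))"
      unfolding J_def using C0 by (intro mult_left_mono near_swap[OF sets sf e] bound G) auto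
    also have "\<dots> \<le> ennreal (K powr r * I powr (r - 1)) * (ennreal (2 powr \<bar>-\<tau>\<bar> * C0) * ennreal I)"
    proof (intro mult_left_mono order_trans[OF nn_integral_mono Gle])
      fix u :: "'n cvec"
      show "ennreal (defect u powr (-\<tau> + \<tau>)) * G u * indicator unit_ball u \<le> G u"
        using defect_pos[of u] by (auto simp: indicator_def)
    qed auto
    also have "\<dots> = ennreal (K powr r * (2 powr \<bar>\<tau>\<bar> * C0) * (I powr (r - 1) * I))"
      using C0 I K by (simp add: ennreal_mult[symmetric] mult_ac)
    also have "I powr (r - 1) * I = I powr r" using I by (cases "I = 0") (auto simp: powr_diff)
    finally show "ball_integral \<nu> (\<lambda>w. cmod (F w) powr q)
      \<le> ennreal (K powr r * (2 powr \<bar>\<tau>\<bar> * C0) * I powr (q / p))"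
      by (simp add: r_def)
  qed
qed

section \<open>The weighted volume and the Bergman norm\<close>

lemma weighted_volume_unit_ball_finite:
  fixes t :: real
  assumes "t > -1"
  shows "ball_integral lborel (\<lambda>z::('n::finite) cvec. defect z powr t) < \<infinity>"
proof -
  obtain C where C: "\<And>r \<zeta>. r > 0 \<Longrightarrow> \<zeta> \<in> sphere (0::'n cvec) 1 \<Longrightarrow>
     (\<integral>\<^sup>+z. ennreal (defect z powr t) * indicator (carleson_tube \<zeta> r) z \<partial>lborel)
       \<le> ennreal (C * r powr (CARD('n) + 1 + t))"
    using weighted_volume_carleson_tube_le[OF assms, where 'n='n] by blast
  obtain \<zeta> :: "'n cvec" where \<zeta>: "norm \<zeta> = 1" using vector_choose_size[of 1] by auto
  have "z \<in> carleson_tube \<zeta> 3" if "z \<in> unit_ball" for z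
  proof -
    have "cmod (1 - herm z \<zeta>) \<le> 1 + norm z * norm \<zeta>"
      using norm_triangle_ineq4[of 1 "herm z \<zeta>"] cmod_herm_le[of z \<zeta>] by simp
    thus ?thesis using that \<zeta> by (simp add: carleson_tube_def)
  qed
  hence "ball_integral lborel (\<lambda>z::'n cvec. defect z powr t) \<le>
     (\<integral>\<^sup>+z. ennreal (defect z powr t) * indicator (carleson_tube \<zeta> 3) z \<partial>lborel)"
    by (intro nn_integral_mono mult_left_mono) (auto simp: indicator_def)
  also have "\<dots> \<le> ennreal (C * 3 powr (CARD('n) + 1 + t))" by (rule C) (use \<zeta> in auto)
  finally show ?thesis by (rule le_less_trans) simp
qed

lemma weighted_volume_raw_integral:
  fixes f :: "('n::finite) cvec \<Rightarrow> ennreal"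
  assumes f: "(\<lambda>z. f z * indicator unit_ball z) \<in> borel_measurable borel"
  shows "(\<integral>\<^sup>+z. f z \<partial>weighted_volume_raw \<alpha>) = (\<integral>\<^sup>+z. ennreal (defect z powr \<alpha>) * f z
    * indicator unit_ball z \<partial>lborel)"
    and "f \<in> borel_measurable (weighted_volume_raw \<alpha>)"
proof -
  have ub: "unit_ball \<inter> space (lborel :: 'n cvec measure) \<in> sets lborel" by simp
  have fm: "f \<in> borel_measurable (restrict_space lborel unit_ball)"
    using f by (subst borel_measurable_restrict_space_iff_ennreal[OF ub]) simp
  have gm: "(\<lambda>z::'n cvec. ennreal ((1 - (norm z)\<^sup>2) powr \<alpha>)) \<in> borel_measurable
    (restrict_space lborel unit_ball)"
    by (rule measurable_restrict_space1) measurable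
  show "f \<in> borel_measurable (weighted_volume_raw \<alpha>)"
    using fm by (simp add: weighted_volume_raw_def)
  show "(\<integral>\<^sup>+z. f z \<partial>weighted_volume_raw \<alpha>) = (\<integral>\<^sup>+z. ennreal (defect z powr \<alpha>) * f z
    * indicator unit_ball z \<partial>lborel)"
    unfolding weighted_volume_raw_def nn_integral_density[OF gm fm] nn_integral_restrict_space[OF
      ub] defect_def ..
qed

text \<open>The normalising constant is positive and finite, so it may be ignored up to a constant factor.\<close>

lemma weighted_volume_integral:
  "\<exists>c>0. \<forall>f. (\<lambda>z. f z * indicator (unit_ball :: ('n::finite) cvec set) z) \<in> borel_measurable borel \<longrightarrow>
    (\<integral>\<^sup>+z. f z \<partial>weighted_volume \<alpha>) = ennreal c
      * (\<integral>\<^sup>+z. ennreal (defect z powr \<alpha>) * f z * indicator unit_ball z \<partial>lborel)"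
proof (cases "\<alpha> > -1")
  case False
  thus ?thesis by (intro exI[of _ 1]) (auto simp: weighted_volume_def weighted_volume_raw_integral)
next
  case True
  define V where "V = emeasure (weighted_volume_raw \<alpha> :: 'n cvec measure) unit_ball"
  have im: "(\<lambda>z::'n cvec. indicator unit_ball z * indicator unit_ball z :: ennreal) \<in>
    borel_measurable borel"
    by (intro borel_measurable_times_ennreal borel_measurable_indicator) auto
  have ub: "unit_ball \<in> sets (weighted_volume_raw \<alpha> :: 'n cvec measure)"
    by (simp add: weighted_volume_raw_def sets_restrict_space image_iff)
      (use UNIV_I sets.top in \<open>force intro!: bexI[of _ unit_ball]\<close>)
  have "V = (\<integral>\<^sup>+z. indicator unit_ball z \<partial>(weighted_volume_raw \<alpha> :: 'n cvec measure))"
    using ub by (simp add: V_def)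
  also have "\<dots> = (\<integral>\<^sup>+z. ennreal (defect z powr \<alpha>) * indicator (unit_ball :: 'n cvec set) z
    * indicator unit_ball z \<partial>lborel)"
    by (rule weighted_volume_raw_integral(1)[OF im])
  also have "\<dots> = ball_integral lborel (\<lambda>z::'n cvec. defect z powr \<alpha>)"
    by (intro nn_integral_cong) (auto simp: indicator_def)
  finally have V: "V = ball_integral lborel (\<lambda>z::'n cvec. defect z powr \<alpha>)" .
  have Vfin: "V < \<infinity>" unfolding V by (rule weighted_volume_unit_ball_finite[OF True])
  have "ennreal (2 powr - \<bar>\<alpha>\<bar>) * emeasure lborel (ball (0::'n cvec) (1/2))
    = (\<integral>\<^sup>+z. ennreal (2 powr - \<bar>\<alpha>\<bar>) * indicator (ball (0::'n cvec) (1/2)) z \<partial>lborel)"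
    by (rule nn_integral_cmult_indicator[symmetric]) simp
  also have "\<dots> \<le> V" unfolding V
  proof (rule nn_integral_mono)
    fix z :: "'n cvec"
    show "ennreal (2 powr - \<bar>\<alpha>\<bar>) * indicator (ball 0 (1/2)) z
      \<le> ennreal (defect z powr \<alpha>) * indicator unit_ball z"
    proof (cases "norm z < 1/2")
      case n: True
      hence z: "z \<in> unit_ball" by simp
      have "1 powr \<alpha> \<le> 2 powr \<bar>\<alpha>\<bar> * defect z powr \<alpha>"
        by (rule powr_ratio_bound) (use n defect_pos[OF z] defect_bounds(1)[OF z] defect_le_1[of z]
          in auto)
      hence "2 powr - \<bar>\<alpha>\<bar> \<le> defect z powr \<alpha>" by (simp add: powr_minus field_simps)
      thus ?thesis using n z by (simp add: ennreal_leI)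
    qed simp
  qed
  finally have "ennreal (2 powr - \<bar>\<alpha>\<bar>) * emeasure lborel (ball (0::'n cvec) (1/2)) \<le> V" .
  moreover have "emeasure lborel (ball (0::'n cvec) (1/2)) > 0"
    by (subst emeasure_ball_cvec) (auto simp: ennreal_zero_less_mult_iff)
  ultimately have "V > 0" by (auto simp: ennreal_zero_less_mult_iff elim!: order.strict_trans2[rotated])
  then obtain v where v: "V = ennreal v" "v > 0" using Vfin by (cases V) auto
  show ?thesis
  proof (intro exI[of _ "1 / v"] conjI allI impI)
    show "1 / v > 0" using v by simp
    fix f :: "'n cvec \<Rightarrow> ennreal" assume f: "(\<lambda>z. f z * indicator unit_ball z) \<in> borel_measurable borel"
    have "1 / V = ennreal (1 / v)" unfolding v(1) using v(2)
      by (subst ennreal_1[symmetric], subst divide_ennreal) auto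
    moreover have "weighted_volume \<alpha> = scale_measure (1 / V) (weighted_volume_raw \<alpha> :: 'n cvec measure)"
      using True by (simp add: weighted_volume_def V_def)
    ultimately show "(\<integral>\<^sup>+z. f z \<partial>weighted_volume \<alpha>)
      = ennreal (1 / v) * (\<integral>\<^sup>+z. ennreal (defect z powr \<alpha>) * f z * indicator unit_ball z \<partial>lborel)"
      by (simp add: nn_integral_scale_measure weighted_volume_raw_integral[OF f])
  qed
qed

lemma bergman_index_props:
  assumes "p > 0"
  shows "p * real (bergman_index p \<alpha>) + \<alpha> > -1"
    and "p * real k + \<alpha> > -1 \<Longrightarrow> bergman_index p \<alpha> \<le> k"
proof -
  obtain n :: nat where "(- 1 - \<alpha>) / p < n" using reals_Archimedean2 by blast
  hence "p * real n + \<alpha> > -1" using assms by (simp add: field_simps)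
  thus "p * real (bergman_index p \<alpha>) + \<alpha> > -1" unfolding bergman_index_def by (rule LeastI)
  show "bergman_index p \<alpha> \<le> k" if "p * real k + \<alpha> > -1"
    unfolding bergman_index_def using that by (rule Least_le)
qed

text \<open>The \<open>p\<close>-th power of the seminorm in the Bergman norm, without the normalisation of the volume.\<close>

definition bergman_energy :: "real \<Rightarrow> real \<Rightarrow> (('n::finite) cvec \<Rightarrow> complex) \<Rightarrow> ennreal"
  where "bergman_energy p \<alpha> f =
    ball_integral lborel (\<lambda>w. defect w powr (\<alpha> + p * real (bergman_index p \<alpha>))
      * cmod ((radial_deriv ^^ bergman_index p \<alpha>) f w) powr p)"

lemma bergman_norm_eq_energy:
  assumes p: "p > 0"
  shows "\<exists>c>0. \<forall>f. f holomorphic_vec_on (unit_ball :: ('n::finite) cvec set) \<longrightarrow>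
    bergman_norm p \<alpha> f = ennreal (cmod (f 0))
      + ennreal_powr (ennreal c * bergman_energy p \<alpha> f) (1 / p) \<and>
    (bergman_energy p \<alpha> f < \<infinity> \<longrightarrow> f \<in> bergman_space p \<alpha>)"
proof -
  define N where "N = bergman_index p \<alpha>"
  have N: "p * real N + \<alpha> > -1" unfolding N_def by (rule bergman_index_props(1)[OF p])
  obtain c where c: "c > 0" "\<And>f. (\<lambda>z. f z * indicator (unit_ball :: 'n cvec set) z) \<in>
    borel_measurable borel \<Longrightarrow>
    (\<integral>\<^sup>+z. f z \<partial>weighted_volume \<alpha>) = ennreal c
      * (\<integral>\<^sup>+z. ennreal (defect z powr \<alpha>) * f z * indicator unit_ball z \<partial>lborel)"
    using weighted_volume_integral[where 'n='n, of \<alpha>] by blast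
  show ?thesis
  proof (intro exI[of _ c] conjI allI impI)
    show "c > 0" by (rule c(1))
    fix f :: "'n cvec \<Rightarrow> complex" assume f: "f holomorphic_vec_on unit_ball"
    let ?g = "(radial_deriv ^^ N) f"
    have g: "?g holomorphic_vec_on unit_ball"
      by (rule holomorphic_vec_iterated_radial_deriv[OF f open_ball])
    have gm: "(\<lambda>u. ennreal (cmod (?g u) powr p) * indicator unit_ball u) \<in> borel_measurable borel"
      by (rule borel_measurable_cmod_powr_indicator[OF g p])
    have "(\<lambda>z. ennreal (defect z powr (p * real N))
      * (ennreal (cmod (?g z) powr p) * indicator unit_ball z)) \<in> borel_measurable borel"
      using gm by measurable
    hence m: "(\<lambda>z. ennreal ((1 - (norm z)\<^sup>2) powr (p * real N) * cmod (?g z) powr p)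
      * indicator unit_ball z) \<in> borel_measurable borel"
      by (simp add: ennreal_mult' mult.assoc defect_def)
    have E: "(\<integral>\<^sup>+z. ennreal ((1 - (norm z)\<^sup>2) powr (p * real N) * cmod (?g z) powr p)
      \<partial>weighted_volume \<alpha>) = ennreal c * bergman_energy p \<alpha> f"
    proof -
      have "ennreal (defect z powr \<alpha>) * ennreal ((1 - (norm z)\<^sup>2) powr (p * real N)
        * cmod (?g z) powr p) =
          ennreal (defect z powr (\<alpha> + p * real N) * cmod (?g z) powr p)" for z
        by (simp add: ennreal_mult'[symmetric] defect_def powr_add mult.assoc)
      thus ?thesis unfolding c(2)[OF m] bergman_energy_def N_def[symmetric] by (simp only:)
    qed
    show "bergman_norm p \<alpha> f = ennreal (cmod (f 0))
      + ennreal_powr (ennreal c * bergman_energy p \<alpha> f) (1 / p)"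
      unfolding bergman_norm_def Let_def N_def[symmetric] E ..
    assume fin: "bergman_energy p \<alpha> f < \<infinity>"
    have sp: "space (weighted_volume \<alpha> :: 'n cvec measure) = unit_ball"
      by (simp add: weighted_volume_def weighted_volume_raw_def space_restrict_space
        space_scale_measure)
    have "(\<integral>\<^sup>+z. ennreal (((1 - (norm z)\<^sup>2) ^ N * cmod (?g z)) powr p) \<partial>weighted_volume \<alpha>)
       = (\<integral>\<^sup>+z. ennreal ((1 - (norm z)\<^sup>2) powr (p * real N) * cmod (?g z) powr p) \<partial>weighted_volume \<alpha>)"
    proof (rule nn_integral_cong)
      fix z assume "z \<in> space (weighted_volume \<alpha> :: 'n cvec measure)"
      hence d: "1 - (norm z)\<^sup>2 > 0" using defect_pos[of z] unfolding sp defect_def by simp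
      have "((1 - (norm z)\<^sup>2) ^ N * cmod (?g z)) powr p
        = ((1 - (norm z)\<^sup>2) powr real N) powr p * cmod (?g z) powr p"
        using d by (subst powr_mult) (auto simp: powr_realpow)
      also have "((1 - (norm z)\<^sup>2) powr real N) powr p = (1 - (norm z)\<^sup>2) powr (p * real N)"
        by (simp add: powr_powr mult.commute)
      finally show "ennreal (((1 - (norm z)\<^sup>2) ^ N * cmod (?g z)) powr p)
        = ennreal ((1 - (norm z)\<^sup>2) powr (p * real N) * cmod (?g z) powr p)"
        by simp
    qed
    also have "\<dots> < \<infinity>" unfolding E using fin by (simp add: ennreal_mult_less_top)
    finally show "f \<in> bergman_space p \<alpha>" unfolding bergman_space_def using f N by blast
  qed
qed

lemma ennreal_powr_ennreal: "0 \<le> x \<Longrightarrow> ennreal_powr (ennreal x) a = ennreal (x powr a)"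
  by (simp add: ennreal_powr_def)

section \<open>Test functions\<close>

text \<open>Formulas for iterated radial derivatives hold only on the ball, so agreement there must suffice
for the next derivative.\<close>

lemma radial_deriv_cong:
  assumes "open S" "f holomorphic_vec_on S" "\<And>z. z \<in> S \<Longrightarrow> f z = g z" "z \<in> S"
  shows "radial_deriv f z = radial_deriv g z"
proof -
  have g: "g holomorphic_vec_on S" by (rule holomorphic_vec_cong[OF assms(1-3)])
  have "(g has_derivative frechet_derivative f (at z)) (at z)"
    by (rule has_derivative_transform_within_open[OF holomorphic_vecD(1)[OF assms(2,4)] assms(1,4,3)])
  hence "frechet_derivative f (at z) = frechet_derivative g (at z)" by (rule frechet_derivative_at)
  thus ?thesis by (simp add: radial_deriv_eq[OF assms(2,4)] radial_deriv_eq[OF g assms(4)])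
qed

lemma one_minus_herm_nonzero:
  assumes "z \<in> unit_ball" "w \<in> unit_ball" shows "1 - herm w z \<noteq> 0"
  using one_minus_norm_le_cmod_one_minus_herm[of z w] assms by auto

lemma holomorphic_vec_kernel_power:
  assumes z: "z \<in> unit_ball"
  shows "(\<lambda>w. \<Sum>j\<le>k. of_real (a j) * inverse ((1 - herm w z) ^ (m + j))) holomorphic_vec_on unit_ball"
    and "w \<in> unit_ball \<Longrightarrow> radial_deriv (\<lambda>w. \<Sum>j\<le>k. of_real (a j) * inverse ((1 - herm w z) ^ (m + j))) w =
      (\<Sum>j\<le>k. of_real (a j * real (m + j)) * (inverse ((1 - herm w z) ^ Suc (m + j))
        - inverse ((1 - herm w z) ^ (m + j))))"
proof -
  define \<phi> where "\<phi> = (\<lambda>x::complex. \<Sum>j\<le>k. of_real (a j) * inverse ((1 - x) ^ (m + j)))"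
  define \<phi>' where "\<phi>' = (\<lambda>x::complex. \<Sum>j\<le>k. of_real (a j * real (m + j))
    * inverse ((1 - x) ^ Suc (m + j)))"
  have D: "(\<phi> has_field_derivative \<phi>' (herm w z)) (at (herm w z))" if w: "w \<in> unit_ball" for w
  proof -
    have nz: "1 - herm w z \<noteq> 0" by (rule one_minus_herm_nonzero[OF z w])
    have one: "((\<lambda>x::complex. inverse ((1 - x) ^ i)) has_field_derivative of_nat i
      * inverse ((1 - x0) ^ Suc i)) (at x0)"
      if "1 - x0 \<noteq> 0" for i x0
    proof (cases i)
      case (Suc l)
      have D1: "((\<lambda>x::complex. inverse ((1 - x) ^ i)) has_field_derivative
        - (inverse ((1 - x0) ^ i) * (of_nat i * (1 - x0) ^ (i - 1) * (-1))
        * inverse ((1 - x0) ^ i))) (at x0)"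
        using that by (auto intro!: derivative_eq_intros)
      have eq: "- (inverse ((1 - x0) ^ i) * (of_nat i * (1 - x0) ^ (i - 1) * (-1))
        * inverse ((1 - x0) ^ i)) = of_nat i * inverse ((1 - x0) ^ Suc i)"
      proof -
        have "- (inverse (v ^ Suc l) * (b * v ^ l * (-1)) * inverse (v ^ Suc l))
          = b * inverse (v ^ Suc (Suc l))"
          if "v \<noteq> 0" for v b :: complex
          using that by (simp add: field_simps)
        from this[OF that] show ?thesis unfolding Suc by simp
      qed
      show ?thesis by (rule DERIV_cong[OF D1 eq])
    qed simp
    show ?thesis unfolding \<phi>_def \<phi>'_def
      by (rule DERIV_sum) (use one[OF nz] in \<open>auto intro!: DERIV_cmult[THEN DERIV_cong] simp:
        mult.assoc\<close>)
  qed
  show "(\<lambda>w. \<Sum>j\<le>k. of_real (a j) * inverse ((1 - herm w z) ^ (m + j))) holomorphic_vec_on unit_ball"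
    using holomorphic_vec_compose_herm(1)[where S = unit_ball, OF D] unfolding \<phi>_def .
  assume w: "w \<in> unit_ball"
  have nz: "1 - herm w z \<noteq> 0" by (rule one_minus_herm_nonzero[OF z w])
  have s: "x * inverse ((1 - x) ^ Suc i) = inverse ((1 - x) ^ Suc i) - inverse ((1 - x) ^ i)"
    if "1 - x \<noteq> 0" for x :: complex and i
  proof -
    have e: "inverse ((1 - x) ^ i) = (1 - x) * inverse ((1 - x) ^ Suc i)" using that by simp
    have "x * E = E - (1 - x) * E" for E by (simp add: left_diff_distrib)
    thus ?thesis unfolding e .
  qed
  have "radial_deriv (\<lambda>w. \<phi> (herm w z)) w = herm w z * \<phi>' (herm w z)"
    by (rule holomorphic_vec_compose_herm(2)[where S = unit_ball, OF D w])
  also have "\<dots> = (\<Sum>j\<le>k. of_real (a j * real (m + j))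
    * (inverse ((1 - herm w z) ^ Suc (m + j)) - inverse ((1 - herm w z) ^ (m + j))))"
    unfolding \<phi>'_def sum_distrib_left by (intro sum.cong refl) (simp only: s[OF nz, symmetric] mult_ac)
  finally show "radial_deriv (\<lambda>w. \<Sum>j\<le>k. of_real (a j) * inverse ((1 - herm w z) ^ (m + j))) w =
      (\<Sum>j\<le>k. of_real (a j * real (m + j)) * (inverse ((1 - herm w z) ^ Suc (m + j))
        - inverse ((1 - herm w z) ^ (m + j))))"
    by (simp add: \<phi>_def)
qed

text \<open>Since \<open>x d/dx (1 - x)\<^bsup>-i\<^esup> = i (1 - x)\<^bsup>-i-1\<^esup> - i (1 - x)\<^bsup>-i\<^esup>\<close>, each radial derivative raises the
top power by one and multiplies the leading coefficient by \<open>m + k\<close>, which keeps it positive.\<close>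

lemma iterated_radial_deriv_kernel_power:
  assumes m: "m \<ge> 1"
  shows "\<exists>a::nat \<Rightarrow> real. a k > 0 \<and> (\<forall>z w. z \<in> (unit_ball :: ('n::finite) cvec set) \<longrightarrow> w \<in> unit_ball \<longrightarrow>
     (radial_deriv ^^ k) (\<lambda>w. inverse ((1 - herm w z) ^ m)) w
       = (\<Sum>j\<le>k. of_real (a j) * inverse ((1 - herm w z) ^ (m + j))))"
proof (induction k)
  case 0
  show ?case by (intro exI[of _ "\<lambda>_. 1"]) auto
next
  case (Suc k)
  then obtain a :: "nat \<Rightarrow> real" where a: "a k > 0" "\<And>z w. z \<in> (unit_ball :: 'n cvec set) \<Longrightarrow>
    w \<in> unit_ball \<Longrightarrow>
     (radial_deriv ^^ k) (\<lambda>w. inverse ((1 - herm w z) ^ m)) w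
       = (\<Sum>j\<le>k. of_real (a j) * inverse ((1 - herm w z) ^ (m + j)))"
    by blast
  define c where "c = (\<lambda>j. a j * real (m + j))"
  \<comment> \<open>The coefficients after regrouping \<open>\<Sum> c\<^sub>j (E\<^bsub>j+1\<^esub> - E\<^sub>j)\<close> by powers.\<close>
  define b where "b = (\<lambda>j. (if j = 0 then 0 else c (j - 1)) - (if j \<le> k then c j else 0))"
  show ?case
  proof (intro exI[of _ b] conjI allI impI)
    show "b (Suc k) > 0" using a(1) m by (simp add: b_def c_def)
    fix z w :: "'n cvec" assume z: "z \<in> unit_ball" and w: "w \<in> unit_ball"
    define E where "E = (\<lambda>j. inverse ((1 - herm w z) ^ (m + j)))"
    have "(radial_deriv ^^ Suc k) (\<lambda>w. inverse ((1 - herm w z) ^ m)) w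
      = radial_deriv ((radial_deriv ^^ k) (\<lambda>w. inverse ((1 - herm w z) ^ m))) w"
      by simp
    also have "\<dots> = radial_deriv (\<lambda>w. \<Sum>j\<le>k. of_real (a j) * inverse ((1 - herm w z) ^ (m + j))) w"
      by (rule radial_deriv_cong[symmetric, OF open_ball holomorphic_vec_kernel_power(1)[OF z]
        a(2)[symmetric, OF z] w])
    also have "\<dots> = (\<Sum>j\<le>k. of_real (c j) * (E (Suc j) - E j))"
      unfolding holomorphic_vec_kernel_power(2)[OF z w] by (simp add: c_def E_def)
    also have "\<dots> = (\<Sum>j\<le>k. of_real (c j) * E (Suc j)) - (\<Sum>j\<le>k. of_real (c j) * E j)"
      by (simp add: right_diff_distrib sum_subtractf)
    also have "(\<Sum>j\<le>k. of_real (c j) * E (Suc j))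
      = (\<Sum>j\<le>Suc k. of_real (if j = 0 then 0 else c (j - 1)) * E j)"
      by (subst sum.atMost_Suc_shift) simp
    also have "(\<Sum>j\<le>k. of_real (c j) * E j) = (\<Sum>j\<le>Suc k. of_real (if j \<le> k then c j else 0) * E j)"
      by simp
    also have "(\<Sum>j\<le>Suc k. of_real (if j = 0 then 0 else c (j - 1)) * E j) - \<dots>
      = (\<Sum>j\<le>Suc k. of_real (b j) * E j)"
      unfolding sum_subtractf[symmetric] b_def by (intro sum.cong refl) (simp add: left_diff_distrib)
    finally show "(radial_deriv ^^ Suc k) (\<lambda>w. inverse ((1 - herm w z) ^ m)) w
      = (\<Sum>j\<le>Suc k. of_real (b j) * inverse ((1 - herm w z) ^ (m + j)))"
      by (simp add: E_def)
  qed
qed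

lemma iterated_radial_deriv_component:
  "w \<in> (unit_ball :: ('n::finite) cvec set) \<Longrightarrow> (radial_deriv ^^ k) (\<lambda>w. w $ j) w = w $ j"
proof (induction k arbitrary: w)
  case (Suc k)
  have "(radial_deriv ^^ Suc k) (\<lambda>w. w $ j) w = radial_deriv ((radial_deriv ^^ k) (\<lambda>w. w $ j)) w"
    by simp
  also have "\<dots> = radial_deriv (\<lambda>w. w $ j) w"
    by (rule radial_deriv_cong[symmetric, OF open_ball holomorphic_vec_component Suc.IH[symmetric]
      Suc.prems])
  also have "\<dots> = w $ j"
  proof -
    have "((\<lambda>w::'n cvec. w $ j) has_derivative (\<lambda>w. w $ j)) (at w)"
      by (rule bounded_linear_imp_has_derivative[OF bounded_linear_vec_nth])
    hence "(\<lambda>w. w $ j) = frechet_derivative (\<lambda>w. w $ j) (at w)" by (rule frechet_derivative_at)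
    thus ?thesis using radial_deriv_eq[OF holomorphic_vec_component Suc.prems, of j] by metis
  qed
  finally show ?case .
qed simp

text \<open>All powers of the kernel are dominated by the highest one because \<open>|1 - \<langle>w,z\<rangle>| \<le> 2\<close>. Forelli-Rudin
then applies to its \<open>p\<close>-th power, with \<open>s = pm - (n + 1 + \<alpha>) > 0\<close>.\<close>

lemma kernel_power_energy_le:
  fixes p \<alpha> :: real
  assumes p: "p > 0" and m: "m \<ge> 1" "p * real m > real CARD('n) + 1 + \<alpha>"
  shows "\<exists>D>0. \<forall>z\<in>(unit_ball :: ('n::finite) cvec set).
    bergman_energy p \<alpha> (\<lambda>w. inverse ((1 - herm w z) ^ m))
      \<le> ennreal (D * defect z powr (real CARD('n) + 1 + \<alpha> - p * real m))"
proof -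
  define N where "N = bergman_index p \<alpha>"
  define t where "t = \<alpha> + p * real N"
  define s where "s = p * real m - (real CARD('n) + 1 + \<alpha>)"
  have t: "t > -1" using bergman_index_props(1)[OF p, of \<alpha>] by (simp add: t_def N_def)
  have s: "s > 0" using m by (simp add: s_def)
  obtain a :: "nat \<Rightarrow> real" where a: "\<And>z w. z \<in> (unit_ball :: 'n cvec set) \<Longrightarrow> w \<in> unit_ball \<Longrightarrow>
     (radial_deriv ^^ N) (\<lambda>w. inverse ((1 - herm w z) ^ m)) w
       = (\<Sum>j\<le>N. of_real (a j) * inverse ((1 - herm w z) ^ (m + j)))"
    using iterated_radial_deriv_kernel_power[OF m(1), of N, where 'n='n] by blast
  define A where "A = (\<Sum>j\<le>N. \<bar>a j\<bar> * 2 ^ (N - j)) + 1"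
  have A: "A > 0" unfolding A_def by (simp add: add_nonneg_pos sum_nonneg)
  obtain B where B: "B > 0" "\<And>z. z \<in> (unit_ball :: 'n cvec set) \<Longrightarrow>
    ball_integral lborel (\<lambda>w. defect w powr t / cmod (1 - herm w z) powr (CARD('n) + 1 + t + s))
      \<le> ennreal (B * defect z powr (-s))"
    using forelli_rudin[OF t s, where 'n='n] by blast
  show ?thesis
  proof (intro exI[of _ "A powr p * B"] conjI ballI)
    show "0 < A powr p * B" using A B by simp
    fix z :: "'n cvec" assume z: "z \<in> unit_ball"
    let ?f = "\<lambda>w. inverse ((1 - herm w z) ^ m)"
    have "bergman_energy p \<alpha> ?f \<le> (\<integral>\<^sup>+w. ennreal (A powr p)
      * (ennreal (defect w powr t / cmod (1 - herm w z) powr (CARD('n) + 1 + t + s))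
      * indicator unit_ball w) \<partial>lborel)"
      unfolding bergman_energy_def N_def[symmetric] t_def[symmetric]
    proof (rule nn_integral_mono)
      fix w :: "'n cvec"
      show "ennreal (defect w powr t * cmod ((radial_deriv ^^ N) ?f w) powr p) * indicator unit_ball w \<le>
        ennreal (A powr p) * (ennreal (defect w powr t
          / cmod (1 - herm w z) powr (CARD('n) + 1 + t + s)) * indicator unit_ball w)"
      proof (cases "w \<in> unit_ball")
        case w: True
        define y where "y = cmod (1 - herm w z)"
        have y0: "y > 0" using one_minus_herm_nonzero[OF z w] by (simp add: y_def)
        have "cmod (herm w z) \<le> 1" using cmod_herm_le[of w z] mult_mono[of "norm w" 1 "norm z" 1] w
          z by simp
        hence y2: "y \<le> 2" unfolding y_def using norm_triangle_ineq4[of 1 "herm w z"] by simp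
        have "cmod ((radial_deriv ^^ N) ?f w) \<le> (\<Sum>j\<le>N. \<bar>a j\<bar> * inverse (y ^ (m + j)))"
          unfolding a[OF z w] y_def by (rule order_trans[OF norm_sum])
            (simp add: norm_mult norm_inverse norm_power)
        also have "\<dots> \<le> (\<Sum>j\<le>N. \<bar>a j\<bar> * 2 ^ (N - j) * inverse (y ^ (m + N)))"
        proof (rule sum_mono)
          fix j assume "j \<in> {..N}"
          hence e: "m + N = (m + j) + (N - j)" by simp
          have "y ^ (N - j) \<le> 2 ^ (N - j)" using y0 y2 by (intro power_mono) auto
          hence "inverse (y ^ (m + j)) \<le> 2 ^ (N - j) * inverse (y ^ (m + N))"
            unfolding e power_add using y0 by (simp add: field_simps)
          hence "\<bar>a j\<bar> * inverse (y ^ (m + j)) \<le> \<bar>a j\<bar> * (2 ^ (N - j) * inverse (y ^ (m + N)))"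
            by (rule mult_left_mono) simp
          thus "\<bar>a j\<bar> * inverse (y ^ (m + j)) \<le> \<bar>a j\<bar> * 2 ^ (N - j) * inverse (y ^ (m + N))"
            by (simp only: mult.assoc)
        qed
        also have "\<dots> \<le> A * inverse (y ^ (m + N))"
          unfolding sum_distrib_right[symmetric] A_def using y0 by (intro mult_right_mono) auto
        finally have "cmod ((radial_deriv ^^ N) ?f w) powr p \<le> (A * inverse (y ^ (m + N))) powr p"
          using p by (intro powr_mono2) auto
        also have "\<dots> = A powr p * inverse (y powr (CARD('n) + 1 + t + s))"
        proof -
          have "(inverse (y ^ (m + N))) powr p = inverse (y powr (real (m + N) * p))"
          proof -
            have "inverse (y ^ (m + N)) = y powr (- real (m + N))"
              using y0 by (simp only: powr_minus powr_realpow)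
            hence "(inverse (y ^ (m + N))) powr p = y powr (- real (m + N) * p)"
              by (simp only: powr_powr)
            thus ?thesis by (simp only: minus_mult_left[symmetric] powr_minus)
          qed
          also have "real (m + N) * p = CARD('n) + 1 + t + s" by (simp add: t_def s_def algebra_simps)
          finally show ?thesis using A y0 by (simp add: powr_mult)
        qed
        finally have "defect w powr t * cmod ((radial_deriv ^^ N) ?f w) powr p
          \<le> A powr p * (defect w powr t / y powr (CARD('n) + 1 + t + s))"
          using mult_left_mono[of "cmod ((radial_deriv ^^ N) ?f w) powr p" "A powr p
            * inverse (y powr (CARD('n) + 1 + t + s))" "defect w powr t"]
          by (simp add: divide_inverse mult_ac)
        hence "ennreal (defect w powr t * cmod ((radial_deriv ^^ N) ?f w) powr p)
          \<le> ennreal (A powr p * (defect w powr t / y powr (CARD('n) + 1 + t + s)))"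
          by (rule ennreal_leI)
        also have "\<dots> = ennreal (A powr p) * ennreal (defect w powr t / y powr (CARD('n) + 1 + t + s))"
          by (rule ennreal_mult') simp
        finally show ?thesis using w by (simp add: y_def)
      qed simp
    qed
    also have "\<dots> = ennreal (A powr p) * ball_integral lborel (\<lambda>w. defect w powr t
      / cmod (1 - herm w z) powr (CARD('n) + 1 + t + s))"
    proof (rule nn_integral_cmult)
      have [measurable]: "(unit_ball :: 'n cvec set) \<in> sets lborel" by simp
      show "(\<lambda>w. ennreal (defect w powr t / cmod (1 - herm w z) powr (CARD('n) + 1 + t + s))
        * indicator unit_ball w) \<in> borel_measurable lborel"
        by measurable
    qed
    also have "\<dots> \<le> ennreal (A powr p) * ennreal (B * defect z powr (-s))"
      by (intro mult_left_mono B(2)[OF z]) auto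
    also have "\<dots> = ennreal (A powr p * B * defect z powr (real CARD('n) + 1 + \<alpha> - p * real m))"
      by (simp add: ennreal_mult'[symmetric] mult.assoc s_def)
    finally show "bergman_energy p \<alpha> ?f \<le> ennreal (A powr p * B
      * defect z powr (real CARD('n) + 1 + \<alpha> - p * real m))" .
  qed
qed

lemma component_energy_finite:
  assumes p: "p > 0"
  shows "bergman_energy p \<alpha> (\<lambda>w::('n::finite) cvec. w $ j) < \<infinity>"
proof -
  define t where "t = \<alpha> + p * real (bergman_index p \<alpha>)"
  have t: "t > -1" using bergman_index_props(1)[OF p, of \<alpha>] by (simp add: t_def)
  have "bergman_energy p \<alpha> (\<lambda>w::'n cvec. w $ j) \<le> ball_integral lborel (\<lambda>w::'n cvec. defect w powr t)"
    unfolding bergman_energy_def t_def[symmetric]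
  proof (rule nn_integral_mono)
    fix w :: "'n cvec"
    show "ennreal (defect w powr t * cmod ((radial_deriv ^^ bergman_index p \<alpha>) (\<lambda>w. w $ j) w) powr
      p) * indicator unit_ball w \<le>
       ennreal (defect w powr t) * indicator unit_ball w"
    proof (cases "w \<in> unit_ball")
      case True
      have "cmod (w $ j) \<le> 1" using Finite_Cartesian_Product.norm_nth_le[of w j] True by simp
      hence "cmod (w $ j) powr p \<le> 1" using p by (intro powr_le1) auto
      hence "defect w powr t * cmod (w $ j) powr p \<le> defect w powr t * 1" by (intro mult_left_mono) auto
      thus ?thesis using True by (simp add: iterated_radial_deriv_component[OF True] ennreal_leI)
    qed simp
  qed
  also have "\<dots> < \<infinity>" by (rule weighted_volume_unit_ball_finite[OF t])
  finally show ?thesis .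
qed

section \<open>The Carleson measure theorem\<close>

lemma bergman_norm_powr_le:
  fixes p q \<alpha> :: real
  assumes p: "p > 0" and q: "q > 0"
  shows "\<exists>c>0. \<forall>f D. f holomorphic_vec_on (unit_ball :: ('n::finite) cvec set) \<longrightarrow> D \<ge> 0 \<longrightarrow>
    bergman_energy p \<alpha> f \<le> ennreal D \<longrightarrow> f \<in> bergman_space p \<alpha> \<and>
    ennreal_powr (bergman_norm p \<alpha> f) q \<le> ennreal ((cmod (f 0) + (c * D) powr (1 / p)) powr q)"
proof -
  obtain c where c: "c > 0" "\<And>f. f holomorphic_vec_on (unit_ball :: 'n cvec set) \<Longrightarrow>
    bergman_norm p \<alpha> f = ennreal (cmod (f 0))
      + ennreal_powr (ennreal c * bergman_energy p \<alpha> f) (1 / p) \<and>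
    (bergman_energy p \<alpha> f < \<infinity> \<longrightarrow> f \<in> bergman_space p \<alpha>)"
    using bergman_norm_eq_energy[OF p, of \<alpha>, where 'n='n] by blast
  show ?thesis
  proof (intro exI[of _ c] conjI allI impI)
    fix f :: "'n cvec \<Rightarrow> complex" and D :: real
    assume f: "f holomorphic_vec_on unit_ball" and D: "D \<ge> 0" and le: "bergman_energy p \<alpha> f \<le> ennreal D"
    obtain d where d: "bergman_energy p \<alpha> f = ennreal d" "0 \<le> d" "d \<le> D"
      using le D by (cases "bergman_energy p \<alpha> f") (auto simp: top_unique)
    show "f \<in> bergman_space p \<alpha>" using c(2)[OF f] d by simp
    have "bergman_norm p \<alpha> f = ennreal (cmod (f 0) + (c * d) powr (1 / p))"
      using c d by (simp add: c(2)[OF f] ennreal_mult[symmetric] ennreal_powr_ennreal)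
    hence "ennreal_powr (bergman_norm p \<alpha> f) q = ennreal ((cmod (f 0) + (c * d) powr (1 / p)) powr q)"
      by (simp only: ennreal_powr_ennreal add_nonneg_nonneg norm_ge_zero powr_ge_zero)
    also have "\<dots> \<le> ennreal ((cmod (f 0) + (c * D) powr (1 / p)) powr q)"
      using c d p q by (intro ennreal_leI powr_mono2 add_left_mono mult_left_mono add_nonneg_nonneg)
        auto
    finally show "ennreal_powr (bergman_norm p \<alpha> f) q
      \<le> ennreal ((cmod (f 0) + (c * D) powr (1 / p)) powr q)" .
  qed (rule c(1))
qed

text \<open>For \<open>z = (1 - r)\<zeta>\<close> and \<open>w\<close> in the tube one has \<open>|1 - \<langle>w,z\<rangle>| \<le> 2r\<close>, so for small \<open>r\<close> the lower
powers of the kernel amount to at most half of the leading term.\<close>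

lemma kernel_power_lower_bound:
  assumes m: "m \<ge> 1"
  shows "\<exists>A r0. 0 < A \<and> 0 < r0 \<and> r0 < 1 \<and> (\<forall>r \<zeta> w. 0 < r \<longrightarrow> r < r0 \<longrightarrow>
    \<zeta> \<in> sphere (0::('n::finite) cvec) 1 \<longrightarrow> w \<in> carleson_tube \<zeta> r \<longrightarrow>
     A * r powr (- real (m + k)) \<le> cmod ((radial_deriv ^^ k)
       (\<lambda>w. inverse ((1 - herm w ((1 - r) *\<^sub>R \<zeta>)) ^ m)) w))"
proof -
  obtain a :: "nat \<Rightarrow> real" where a: "a k > 0" "\<And>z w. z \<in> (unit_ball :: 'n cvec set) \<Longrightarrow> w \<in> unit_ball \<Longrightarrow>
     (radial_deriv ^^ k) (\<lambda>w. inverse ((1 - herm w z) ^ m)) w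
       = (\<Sum>j\<le>k. of_real (a j) * inverse ((1 - herm w z) ^ (m + j)))"
    using iterated_radial_deriv_kernel_power[OF m, of k, where 'n='n] by blast
  define S where "S = (\<Sum>j<k. \<bar>a j\<bar>)"
  have S: "S \<ge> 0" by (simp add: S_def sum_nonneg)
  \<comment> \<open>Chosen so that \<open>y \<le> 2r\<^sub>0\<close> implies both \<open>y \<le> 1\<close> and \<open>S y \<le> a\<^sub>k/2\<close>.\<close>
  define r0 where "r0 = min (1/2) (a k / (4 * (S + 1)))"
  have r0: "0 < r0" "r0 \<le> 1/2" "r0 * (4 * (S + 1)) \<le> a k"
  proof -
    have le: "r0 \<le> a k / (4 * (S + 1))" unfolding r0_def by (rule min.cobounded2)
    have "0 < 4 * (S + 1)" using S by simp
    from le[unfolded pos_le_divide_eq[OF this]] show "r0 * (4 * (S + 1)) \<le> a k" .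
    show "r0 \<le> 1/2" unfolding r0_def by (rule min.cobounded1)
    show "0 < r0" using a(1) S by (simp add: r0_def add_nonneg_pos)
  qed
  define A where "A = a k / 2 * 2 powr (- real (m + k))"
  show ?thesis
  proof (intro exI conjI allI impI)
    show "A > 0" using a by (simp add: A_def)
    show "0 < r0" "r0 < 1" using r0 by auto
    fix r :: real and \<zeta> w :: "'n cvec"
    assume r: "0 < r" "r < r0" and \<zeta>: "\<zeta> \<in> sphere 0 1" and "w \<in> carleson_tube \<zeta> r"
    hence w: "w \<in> unit_ball" "cmod (1 - herm w \<zeta>) < r" by (auto simp: carleson_tube_def)
    define z where "z = (1 - r) *\<^sub>R \<zeta>"
    have z: "z \<in> unit_ball" using r r0 \<zeta> by (simp add: z_def)
    define y where "y = cmod (1 - herm w z)"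
    have y0: "y > 0" using one_minus_herm_nonzero[OF z w(1)] by (simp add: y_def)
    have "y \<le> cmod (1 - herm w \<zeta>) + (1 - (1 - r))"
      unfolding y_def z_def by (rule cmod_one_minus_herm_radial_le(2)) (use w \<zeta> r r0 in auto)
    hence y: "y \<le> 2 * r" "y \<le> 1" using w r r0 by auto
    let ?E = "\<lambda>j. inverse ((1 - herm w z) ^ (m + j))"
    have "cmod (\<Sum>j<k. of_real (a j) * ?E j) \<le> (\<Sum>j<k. \<bar>a j\<bar> * inverse (y ^ (m + j)))"
      by (rule order_trans[OF norm_sum]) (simp add: norm_mult norm_inverse norm_power y_def)
    also have "\<dots> \<le> (\<Sum>j<k. \<bar>a j\<bar> * (y * inverse (y ^ (m + k))))"
    proof (intro sum_mono mult_left_mono)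
      fix j assume "j \<in> {..<k}"
      hence e: "m + k = (m + j) + Suc (k - Suc j)" by simp
      have "y ^ (k - Suc j) \<le> 1" using y0 y by (intro power_le_one) auto
      thus "inverse (y ^ (m + j)) \<le> y * inverse (y ^ (m + k))"
        unfolding e power_add using y0 by (simp add: field_simps)
    qed auto
    also have "\<dots> = S * y * inverse (y ^ (m + k))" by (simp add: S_def sum_distrib_right mult.assoc)
    also have "\<dots> \<le> a k / 2 * inverse (y ^ (m + k))"
    proof (rule mult_right_mono)
      have "S * y \<le> (S + 1) * (2 * r0)" using S y y0 r by (intro mult_mono) auto
      thus "S * y \<le> a k / 2" using r0(3) by (simp add: algebra_simps)
    qed (use y0 in simp)
    finally have low: "cmod (\<Sum>j<k. of_real (a j) * ?E j) \<le> a k / 2 * inverse (y ^ (m + k))" .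
    have "(\<Sum>j\<le>k. of_real (a j) * ?E j) = of_real (a k) * ?E k + (\<Sum>j<k. of_real (a j) * ?E j)"
      by (simp only: lessThan_Suc_atMost[symmetric] sum.lessThan_Suc add.commute)
    hence "cmod (of_real (a k) * ?E k) - cmod (\<Sum>j<k. of_real (a j) * ?E j)
      \<le> cmod (\<Sum>j\<le>k. of_real (a j) * ?E j)"
      by (simp only: norm_diff_ineq)
    moreover have "cmod (of_real (a k) * ?E k) = a k * inverse (y ^ (m + k))"
      using a by (simp add: norm_mult norm_inverse norm_power y_def)
    ultimately have "a k / 2 * inverse (y ^ (m + k)) \<le> cmod (\<Sum>j\<le>k. of_real (a j) * ?E j)" using low
      by simp
    moreover have "A * r powr (- real (m + k)) \<le> a k / 2 * inverse (y ^ (m + k))"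
    proof -
      have "(2 * r) powr (- real (m + k)) \<le> y powr (- real (m + k))" using y y0
        by (intro powr_mono2') auto
      also have "\<dots> = inverse (y ^ (m + k))" using y0 by (simp only: powr_minus powr_realpow)
      finally have "a k / 2 * (2 * r) powr (- real (m + k)) \<le> a k / 2 * inverse (y ^ (m + k))"
        using a by (intro mult_left_mono) auto
      thus ?thesis using r by (simp only: A_def powr_mult mult.assoc)
    qed
    ultimately show "A * r powr (- real (m + k))
      \<le> cmod ((radial_deriv ^^ k) (\<lambda>w. inverse ((1 - herm w ((1 - r) *\<^sub>R \<zeta>)) ^ m)) w)"
      unfolding z_def[symmetric] a(2)[OF z w(1)] by linarith
  qed
qed

lemma emeasure_le_of_integral_ge:
  fixes g :: "'a \<Rightarrow> real"
  assumes A: "A \<in> sets \<nu>" and c: "0 < c" and g: "\<And>w. w \<in> A \<Longrightarrow> c \<le> g w" and sub: "A \<subseteq> B"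
    and le: "(\<integral>\<^sup>+w. ennreal (g w) * indicator B w \<partial>\<nu>) \<le> ennreal D" and D: "D \<ge> 0"
  shows "emeasure \<nu> A \<le> ennreal (D / c)"
proof -
  have "ennreal c * emeasure \<nu> A = (\<integral>\<^sup>+w. ennreal c * indicator A w \<partial>\<nu>)"
    by (rule nn_integral_cmult_indicator[symmetric, OF A])
  also have "\<dots> \<le> (\<integral>\<^sup>+w. ennreal (g w) * indicator B w \<partial>\<nu>)"
    using g sub by (intro nn_integral_mono) (auto simp: indicator_def ennreal_leI)
  also have "\<dots> \<le> ennreal D" by (rule le)
  also have "ennreal D = ennreal c * ennreal (D / c)" using c D by (simp add: ennreal_mult[symmetric])
  finally show ?thesis using c by (subst (asm) ennreal_mult_le_mult_iff) auto
qed

text \<open>For \<open>k = 0\<close> the constant function, which is the test function with \<open>z = 0\<close>, gives the total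
mass. For \<open>k > 0\<close> constants are lost, and the coordinate functions, fixed by \<open>R\<close>, bound the mass away
from the origin, with some \<open>|w\<^sub>j| \<ge> \<epsilon>/n\<close>; since \<open>R\<^sup>kf\<close> vanishes at the origin, the
bound near it is taken from the hypothesis.\<close>

lemma embedding_imp_finite:
  fixes \<nu> :: "('n::finite) cvec measure" and p q \<alpha> C :: real
  assumes sets: "sets \<nu> = sets borel" and p: "p > 0" and q: "q > 0"
    and near0: "0 < k \<Longrightarrow> \<exists>\<epsilon>. 0 < \<epsilon> \<and> emeasure \<nu> (ball 0 \<epsilon>) < \<infinity>"
    and C: "C > 0" and emb: "\<And>f. f \<in> bergman_space p \<alpha> \<Longrightarrow>
      ball_integral \<nu> (\<lambda>w. cmod ((radial_deriv ^^ k) f w) powr q)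
        \<le> ennreal C * ennreal_powr (bergman_norm p \<alpha> f) q"
  shows "emeasure \<nu> unit_ball < \<infinity>"
proof -
  obtain c where c: "c > 0" "\<And>f D. f holomorphic_vec_on (unit_ball :: 'n cvec set) \<Longrightarrow> D \<ge> 0 \<Longrightarrow>
    bergman_energy p \<alpha> f \<le> ennreal D \<Longrightarrow> f \<in> bergman_space p \<alpha> \<and>
    ennreal_powr (bergman_norm p \<alpha> f) q \<le> ennreal ((cmod (f 0) + (c * D) powr (1 / p)) powr q)"
    using bergman_norm_powr_le[OF p q, of \<alpha>, where 'n='n] by blast
  have fin: "\<exists>E\<ge>0. ball_integral \<nu> (\<lambda>w. cmod ((radial_deriv ^^ k) f w) powr q) \<le> ennreal E"
    if f: "f holomorphic_vec_on unit_ball" and e: "bergman_energy p \<alpha> f < \<infinity>" for f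
  proof -
    obtain D where D: "bergman_energy p \<alpha> f = ennreal D" "D \<ge> 0" using e
      by (cases "bergman_energy p \<alpha> f") auto
    let ?x = "(cmod (f 0) + (c * D) powr (1 / p)) powr q"
    have "f \<in> bergman_space p \<alpha>" "ennreal_powr (bergman_norm p \<alpha> f) q \<le> ennreal ?x"
      using c(2)[OF f D(2)] D(1) by auto
    with emb[of f] have "ball_integral \<nu> (\<lambda>w. cmod ((radial_deriv ^^ k) f w) powr q)
      \<le> ennreal C * ennreal ?x"
      by (meson mult_left_mono order_trans zero_le)
    thus ?thesis using C by (intro exI[of _ "C * ?x"]) (auto simp: ennreal_mult)
  qed
  show ?thesis
  proof (cases "k = 0")
    case True
    obtain m :: nat where m: "(real CARD('n) + 1 + \<alpha>) / p < m" using reals_Archimedean2 by blast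
    define m' where "m' = max m 1"
    have m': "m' \<ge> 1" "p * real m' > real CARD('n) + 1 + \<alpha>"
    proof -
      have "(real CARD('n) + 1 + \<alpha>) / p < real m'" using m by (simp add: m'_def less_max_iff_disj)
      thus "p * real m' > real CARD('n) + 1 + \<alpha>" using p by (simp add: pos_divide_less_eq mult.commute)
    qed (simp add: m'_def)
    obtain D where D: "\<And>z. z \<in> (unit_ball :: 'n cvec set) \<Longrightarrow>
      bergman_energy p \<alpha> (\<lambda>w. inverse ((1 - herm w z) ^ m'))
        \<le> ennreal (D * defect z powr (real CARD('n) + 1 + \<alpha> - p * real m'))"
      using kernel_power_energy_le[OF p m'] by blast
    have "bergman_energy p \<alpha> (\<lambda>w::'n cvec. 1) < \<infinity>"
      using D[of 0] by (simp add: le_less_trans)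
    from fin[OF holomorphic_vec_const this] True
    obtain E where E: "E \<ge> 0" "ball_integral \<nu> (\<lambda>w. 1 powr q) \<le> ennreal E" by auto
    have "emeasure \<nu> unit_ball \<le> ennreal (E / 1)"
      by (rule emeasure_le_of_integral_ge[OF _ _ _ subset_refl E(2,1)]) (auto simp: sets)
    thus ?thesis by (simp add: le_less_trans)
  next
    case False
    then obtain \<epsilon> where e: "0 < \<epsilon>" "emeasure \<nu> (ball 0 \<epsilon>) < \<infinity>" using near0 by blast
    define \<eta> where "\<eta> = \<epsilon> / CARD('n)"
    have \<eta>: "\<eta> > 0" using e by (simp add: \<eta>_def)
    define T where "T = (\<lambda>j. {w \<in> (unit_ball :: 'n cvec set). \<eta> \<le> cmod (w $ j)})"
    have T: "T j \<in> sets \<nu>" for j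
    proof -
      have "T j = unit_ball \<inter> {w. \<eta> \<le> cmod (w $ j)}" by (auto simp: T_def)
      moreover have "closed {w::'n cvec. \<eta> \<le> cmod (w $ j)}"
        by (intro closed_Collect_le continuous_intros)
      ultimately show ?thesis unfolding sets by (simp add: borel_closed)
    qed
    have Tfin: "emeasure \<nu> (T j) < \<infinity>" for j
    proof -
      obtain E where E: "E \<ge> 0" "ball_integral \<nu>
        (\<lambda>w. cmod ((radial_deriv ^^ k) (\<lambda>w. w $ j) w) powr q) \<le> ennreal E"
        using fin[OF holomorphic_vec_component component_energy_finite[OF p]] by blast
      have "emeasure \<nu> (T j) \<le> ennreal (E / \<eta> powr q)"
      proof (rule emeasure_le_of_integral_ge[OF T _ _ _ E(2,1)])
        fix w assume "w \<in> T j"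
        thus "\<eta> powr q \<le> cmod ((radial_deriv ^^ k) (\<lambda>w. w $ j) w) powr q"
          using q \<eta> by (intro powr_mono2) (auto simp: T_def iterated_radial_deriv_component)
      qed (use \<eta> in \<open>auto simp: T_def\<close>)
      thus ?thesis by (simp add: le_less_trans)
    qed
    have "unit_ball \<subseteq> ball 0 \<epsilon> \<union> (\<Union>j. T j)"
    proof
      fix w :: "'n cvec" assume w: "w \<in> unit_ball"
      show "w \<in> ball 0 \<epsilon> \<union> (\<Union>j. T j)"
      proof (rule ccontr)
        assume n: "w \<notin> ball 0 \<epsilon> \<union> (\<Union>j. T j)"
        hence "cmod (w $ j) < \<eta>" for j using w by (auto simp: T_def not_le)
        hence "(\<Sum>j\<in>UNIV. cmod (w $ j)) < (\<Sum>j\<in>(UNIV::'n set). \<eta>)" by (intro sum_strict_mono) auto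
        moreover have "norm w \<le> (\<Sum>j\<in>UNIV. cmod (w $ j))" unfolding norm_vec_def
          by (rule L2_set_le_sum) simp
        ultimately show False using n by (simp add: \<eta>_def)
      qed
    qed
    hence "emeasure \<nu> unit_ball \<le> emeasure \<nu> (ball 0 \<epsilon> \<union> (\<Union>j. T j))"
      by (rule emeasure_mono) (use T sets in auto)
    also have "\<dots> \<le> emeasure \<nu> (ball 0 \<epsilon>) + emeasure \<nu> (\<Union>j. T j)"
      by (rule emeasure_subadditive) (use T sets in auto)
    also have "\<dots> \<le> emeasure \<nu> (ball 0 \<epsilon>) + (\<Sum>j\<in>UNIV. emeasure \<nu> (T j))"
      by (intro add_left_mono emeasure_subadditive_finite) (use T in auto)
    also have "\<dots> < \<infinity>" using e Tfin by (simp add: less_top[symmetric] ennreal_sum_eq_top)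
    finally show ?thesis .
  qed
qed

text \<open>For small \<open>r\<close> the test function with pole \<open>(1 - r)\<zeta>\<close> compares a lower bound of order
\<open>r\<^bsup>-(m+k)q\<^esup>\<close> on the tube with a norm of order \<open>r\<^bsup>-sq/p\<^esup>\<close>, and \<open>(m + k)q - sq/p = \<tau>\<close>. For the other
\<open>r\<close> finiteness of the measure suffices.\<close>

lemma embedding_imp_carleson:
  fixes \<nu> :: "('n::finite) cvec measure" and p q \<alpha> \<tau> C :: real
  assumes sets: "sets \<nu> = sets borel" and p: "p > 0" and q: "q > 0"
    and near0: "0 < k \<Longrightarrow> \<exists>\<epsilon>. 0 < \<epsilon> \<and> emeasure \<nu> (ball 0 \<epsilon>) < \<infinity>"
    and \<tau>: "\<tau> = (real CARD('n) + 1 + \<alpha> + real k * p) * q / p" "\<tau> > 0"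
    and C: "C > 0" and emb: "\<And>f. f \<in> bergman_space p \<alpha> \<Longrightarrow>
      ball_integral \<nu> (\<lambda>w. cmod ((radial_deriv ^^ k) f w) powr q)
        \<le> ennreal C * ennreal_powr (bergman_norm p \<alpha> f) q"
  shows "\<exists>C>0. \<forall>r>0. \<forall>\<zeta>\<in>sphere 0 1. emeasure \<nu> (carleson_tube \<zeta> r) \<le> ennreal (C * r powr \<tau>)"
proof -
  have "emeasure \<nu> unit_ball < \<infinity>" by (rule embedding_imp_finite[OF sets p q near0 C emb])
  then obtain M where M: "emeasure \<nu> unit_ball = ennreal M" "M \<ge> 0"
    by (cases "emeasure \<nu> unit_ball") auto
  obtain m0 :: nat where m0: "(real CARD('n) + 1 + \<alpha>) / p < m0" using reals_Archimedean2 by blast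
  define m where "m = max m0 1"
  have m: "m \<ge> 1" "p * real m > real CARD('n) + 1 + \<alpha>"
  proof -
    have "(real CARD('n) + 1 + \<alpha>) / p < real m" using m0 by (simp add: m_def less_max_iff_disj)
    thus "p * real m > real CARD('n) + 1 + \<alpha>" using p by (simp add: pos_divide_less_eq mult.commute)
  qed (simp add: m_def)
  define s where "s = p * real m - (real CARD('n) + 1 + \<alpha>)"
  have s: "s > 0" using m by (simp add: s_def)
  obtain D where D: "D > 0" "\<And>z. z \<in> (unit_ball :: 'n cvec set) \<Longrightarrow>
    bergman_energy p \<alpha> (\<lambda>w. inverse ((1 - herm w z) ^ m))
      \<le> ennreal (D * defect z powr (real CARD('n) + 1 + \<alpha> - p * real m))"
    using kernel_power_energy_le[OF p m] by blast
  obtain c where c: "c > 0" "\<And>f D. f holomorphic_vec_on (unit_ball :: 'n cvec set) \<Longrightarrow> D \<ge> 0 \<Longrightarrow>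
    bergman_energy p \<alpha> f \<le> ennreal D \<Longrightarrow> f \<in> bergman_space p \<alpha> \<and>
    ennreal_powr (bergman_norm p \<alpha> f) q \<le> ennreal ((cmod (f 0) + (c * D) powr (1 / p)) powr q)"
    using bergman_norm_powr_le[OF p q, of \<alpha>, where 'n='n] by blast
  obtain A r0 where A: "0 < A" "0 < r0" "r0 < 1" "\<And>r \<zeta> w. 0 < r \<Longrightarrow> r < r0 \<Longrightarrow>
    \<zeta> \<in> sphere (0::'n cvec) 1 \<Longrightarrow> w \<in> carleson_tube \<zeta> r \<Longrightarrow>
     A * r powr (- real (m + k)) \<le> cmod ((radial_deriv ^^ k)
       (\<lambda>w. inverse ((1 - herm w ((1 - r) *\<^sub>R \<zeta>)) ^ m)) w)"
    using kernel_power_lower_bound[OF m(1), of k, where 'n='n] by blast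
  define E where "E = C * (1 + (c * D) powr (1 / p)) powr q * A powr (-q)"
  have "0 < 1 + (c * D) powr (1 / p)" by (simp add: add_pos_nonneg)
  hence Epos: "E > 0" using C A(1) by (simp add: E_def)
  define E' where "E' = E + M * r0 powr (-\<tau>)"
  have E': "E' > 0" using Epos M by (simp add: E'_def add_pos_nonneg)
  show ?thesis
  proof (intro exI[of _ E'] conjI allI impI ballI)
    show "E' > 0" by (rule E')
    fix r :: real and \<zeta> :: "'n cvec"
    assume r: "r > 0" and \<zeta>: "\<zeta> \<in> sphere 0 1"
    show "emeasure \<nu> (carleson_tube \<zeta> r) \<le> ennreal (E' * r powr \<tau>)"
    proof (cases "r < r0")
      case True
      define z where "z = (1 - r) *\<^sub>R \<zeta>"
      let ?f = "\<lambda>w. inverse ((1 - herm w z) ^ m)"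
      have nz: "norm z = 1 - r" using True A r \<zeta> by (simp add: z_def)
      hence z: "z \<in> unit_ball" using r by simp
      have rd: "r \<le> defect z" using defect_bounds(1)[OF z] nz by simp
      have f: "?f holomorphic_vec_on unit_ball"
        using holomorphic_vec_kernel_power(1)[OF z, where k = 0 and a = "\<lambda>_. 1" and m = m] by simp
      have "bergman_energy p \<alpha> ?f \<le> ennreal (D * defect z powr (-s))"
        using D(2)[OF z] by (simp add: s_def)
      also have "\<dots> \<le> ennreal (D * r powr (-s))"
        using D(1) rd r s by (intro ennreal_leI mult_left_mono powr_mono2') auto
      finally have en: "bergman_energy p \<alpha> ?f \<le> ennreal (D * r powr (-s))" .
      have "0 \<le> D * r powr (-s)" using D(1) by simp
      from c(2)[OF f this en]
      have fs: "?f \<in> bergman_space p \<alpha>"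
        and "ennreal_powr (bergman_norm p \<alpha> ?f) q
          \<le> ennreal ((1 + (c * (D * r powr (-s))) powr (1 / p)) powr q)"
        by (simp_all add: norm_inverse)
      note this(2)
      also have "(1 + (c * (D * r powr (-s))) powr (1 / p)) powr q
        \<le> ((1 + (c * D) powr (1 / p)) * r powr (- s / p)) powr q"
      proof (intro powr_mono2)
        have "(c * (D * r powr (-s))) powr (1 / p) = (c * D) powr (1 / p) * r powr (- s / p)"
          using c D r by (simp add: powr_mult powr_powr)
        moreover have "1 \<le> r powr (- s / p)"
        proof -
          have "r powr 0 \<le> r powr (- s / p)" using r True A s p
            by (intro powr_mono') (auto simp: divide_le_0_iff)
          thus ?thesis using r by simp
        qed
        ultimately show "1 + (c * (D * r powr (-s))) powr (1 / p)
          \<le> (1 + (c * D) powr (1 / p)) * r powr (- s / p)"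
          by (simp add: distrib_right)
      qed (use q in auto)
      also have "((1 + (c * D) powr (1 / p)) * r powr (- s / p)) powr q
        = (1 + (c * D) powr (1 / p)) powr q * r powr (- s / p * q)"
        by (simp add: powr_mult powr_powr add_nonneg_nonneg)
      finally have nb: "ennreal_powr (bergman_norm p \<alpha> ?f) q
        \<le> ennreal ((1 + (c * D) powr (1 / p)) powr q * r powr (- s / p * q))"
        by (simp add: ennreal_leI)
      define X where "X = C * ((1 + (c * D) powr (1 / p)) powr q * r powr (- s / p * q))"
      have X: "X \<ge> 0" using C by (simp add: X_def)
      have "ball_integral \<nu> (\<lambda>w. cmod ((radial_deriv ^^ k) ?f w) powr q)
        \<le> ennreal C * ennreal_powr (bergman_norm p \<alpha> ?f) q"
        by (rule emb[OF fs])
      also have "\<dots> \<le> ennreal C * ennreal ((1 + (c * D) powr (1 / p)) powr q * r powr (- s / p * q))"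
        by (intro mult_left_mono nb) auto
      also have "\<dots> = ennreal X" using C by (simp add: X_def ennreal_mult')
      finally have int: "ball_integral \<nu> (\<lambda>w. cmod ((radial_deriv ^^ k) ?f w) powr q) \<le> ennreal X" .
      have "emeasure \<nu> (carleson_tube \<zeta> r) \<le> ennreal (X / (A * r powr (- real (m + k))) powr q)"
      proof (rule emeasure_le_of_integral_ge[OF _ _ _ _ int X])
        fix w assume "w \<in> carleson_tube \<zeta> r"
        thus "(A * r powr (- real (m + k))) powr q \<le> cmod ((radial_deriv ^^ k) ?f w) powr q"
          using A(4)[OF r True \<zeta>] A(1) q unfolding z_def by (intro powr_mono2) auto
      qed (use sets A r in \<open>auto simp: carleson_tube_def[of \<zeta> r]\<close>)
      also have "X / (A * r powr (- real (m + k))) powr q = E * r powr \<tau>"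
      proof -
        have "(A * r powr (- real (m + k))) powr q = A powr q * r powr (- real (m + k) * q)"
          using A by (simp only: powr_mult powr_powr)
        hence "X / (A * r powr (- real (m + k))) powr q
          = E * (r powr (- s / p * q) / r powr (- real (m + k) * q))"
          by (simp add: X_def E_def powr_minus divide_inverse mult_ac)
        also have "r powr (- s / p * q) / r powr (- real (m + k) * q)
          = r powr (- s / p * q - (- real (m + k) * q))"
          by (rule powr_diff[symmetric])
        also have "- s / p * q - (- real (m + k) * q) = \<tau>" using p by (simp add: \<tau>(1) s_def field_simps)
        finally show ?thesis .
      qed
      also have "ennreal (E * r powr \<tau>) \<le> ennreal (E' * r powr \<tau>)"
        using M by (intro ennreal_leI mult_right_mono) (auto simp: E'_def)
      finally show ?thesis .
    next
      case False
      have "emeasure \<nu> (carleson_tube \<zeta> r) \<le> emeasure \<nu> unit_ball"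
        by (rule emeasure_mono) (auto simp: carleson_tube_def sets)
      also have "\<dots> \<le> ennreal (E' * r powr \<tau>)" unfolding M(1)
      proof (rule ennreal_leI)
        have "r0 powr \<tau> \<le> r powr \<tau>" using False A \<tau> by (intro powr_mono2) auto
        hence "M * r0 powr (-\<tau>) * r0 powr \<tau> \<le> M * r0 powr (-\<tau>) * r powr \<tau>" using M
          by (intro mult_left_mono) auto
        moreover have "M * r0 powr (-\<tau>) * r0 powr \<tau> = M" using A by (simp add: powr_minus)
        moreover have "M * r0 powr (-\<tau>) * r powr \<tau> \<le> E' * r powr \<tau>" using Epos
          by (intro mult_right_mono) (auto simp: E'_def)
        ultimately show "M \<le> E' * r powr \<tau>" by linarith
      qed
      finally show ?thesis .
    qed
  qed
qed

lemma carleson_imp_bergman_ball: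
  fixes \<nu> :: "('n::finite) cvec measure" and \<tau> C R :: real
  assumes sets: "sets \<nu> = sets borel" and C: "C > 0"
    and car: "\<And>r \<zeta>. r > 0 \<Longrightarrow> \<zeta> \<in> sphere 0 1 \<Longrightarrow> emeasure \<nu> (carleson_tube \<zeta> r) \<le> ennreal (C * r powr \<tau>)"
  shows "\<exists>C>0. \<forall>a\<in>unit_ball. emeasure \<nu> (bergman_ball a R) \<le> ennreal (C * defect a powr \<tau>)"
proof (intro exI[of _ "C * exp (4 * R) powr \<tau>"] conjI ballI)
  show "C * exp (4 * R) powr \<tau> > 0" using C by simp
  fix a :: "'n cvec" assume a: "a \<in> unit_ball"
  have da: "defect a > 0" by (rule defect_pos[OF a])
  obtain \<zeta> where \<zeta>: "\<zeta> \<in> sphere 0 1" "bergman_ball a R \<subseteq> carleson_tube \<zeta> (exp (4 * R) * defect a)"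
    using bergman_ball_subset_carleson_tube[OF a] by blast
  have "emeasure \<nu> (bergman_ball a R) \<le> emeasure \<nu> (carleson_tube \<zeta> (exp (4 * R) * defect a))"
    by (rule emeasure_mono[OF \<zeta>(2)]) (simp add: sets)
  also have "\<dots> \<le> ennreal (C * (exp (4 * R) * defect a) powr \<tau>)" by (rule car) (use da \<zeta> in auto)
  finally show "emeasure \<nu> (bergman_ball a R) \<le> ennreal (C * exp (4 * R) powr \<tau> * defect a powr \<tau>)"
    using da by (simp add: powr_mult mult.assoc)
qed

text \<open>The slabs of small parameter lie in Bergman balls of radius \<open>R\<close>, so the embedding holds with the
weight \<open>\<gamma> = \<alpha> + kp\<close>. The difference between the index \<open>N\<close> in the norm and \<open>k \<ge> N\<close> is made up by
the inequality for radial derivatives. When the norm is infinite there is nothing to prove.\<close>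

lemma bergman_ball_imp_embedding:
  fixes \<nu> :: "('n::finite) cvec measure" and p q \<alpha> \<tau> C R :: real
  assumes sets: "sets \<nu> = sets borel" and null: "emeasure \<nu> (- unit_ball) = 0" and p: "0 < p" "p \<le> q"
    and k: "\<alpha> + real k * p > -1" and \<tau>: "\<tau> = (real CARD('n) + 1 + \<alpha> + real k * p) * q / p"
    and R: "R > 0" and C: "C > 0"
    and ball: "\<And>a. a \<in> unit_ball \<Longrightarrow> emeasure \<nu> (bergman_ball a R) \<le> ennreal (C * defect a powr \<tau>)"
  shows "\<exists>C>0. \<forall>f\<in>bergman_space p \<alpha>.
      ball_integral \<nu> (\<lambda>w. cmod ((radial_deriv ^^ k) f w) powr q)
        \<le> ennreal C * ennreal_powr (bergman_norm p \<alpha> f) q"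
proof -
  \<comment> \<open>Small enough that slabs have Bergman radius \<open>5\<epsilon> < R\<close>.\<close>
  define \<epsilon> where "\<epsilon> = min (1/8) (R / 6)"
  have e: "0 < \<epsilon>" "\<epsilon> \<le> 1/8" "5 * \<epsilon> < R" using R by (auto simp: \<epsilon>_def min_def)
  have bound: "emeasure \<nu> {w \<in> unit_ball. near \<epsilon> w u}
    \<le> ennreal (C * defect u powr \<tau>)" if u: "u \<in> unit_ball" for u
  proof -
    have "{w \<in> unit_ball. near \<epsilon> w u} \<subseteq> bergman_ball u R" using near_imp_bergman_ball e by blast
    hence "emeasure \<nu> {w \<in> unit_ball. near \<epsilon> w u} \<le> emeasure \<nu> (bergman_ball u R)"
      by (rule emeasure_mono) (simp add: sets borel_open[OF open_bergman_ball[OF u]])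
    with ball[OF u] show ?thesis by (rule order_trans[rotated])
  qed
  have sf: "sigma_finite_measure \<nu>"
    by (rule sigma_finite_from_near[OF sets null e(1)]) (rule le_less_trans[OF bound], auto)
  define \<gamma> where "\<gamma> = \<alpha> + real k * p"
  have \<tau>': "\<tau> = (real CARD('n) + 1 + \<gamma>) * q / p" by (simp add: \<tau> \<gamma>_def)
  obtain C1 where C1: "C1 > 0" "\<And>F I. F holomorphic_vec_on unit_ball \<Longrightarrow> I \<ge> 0 \<Longrightarrow>
    ball_integral lborel (\<lambda>w::'n cvec. defect w powr \<gamma> * cmod (F w) powr p) \<le> ennreal I \<Longrightarrow>
    ball_integral \<nu> (\<lambda>w. cmod (F w) powr q) \<le> ennreal (C1 * I powr (q / p))"
    using carleson_embedding[OF sets sf e(1,2) C p \<tau>' bound] by blast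
  define N where "N = bergman_index p \<alpha>"
  have Nk: "N \<le> k" unfolding N_def using k by (intro bergman_index_props(2)[OF p(1)])
    (simp add: algebra_simps)
  define \<beta> where "\<beta> = \<alpha> + p * real N"
  have \<beta>\<gamma>: "\<beta> + p * real (k - N) = \<gamma>" using Nk by (simp add: \<beta>_def \<gamma>_def of_nat_diff algebra_simps)
  obtain C2 where C2: "C2 > 0" "\<And>g. g holomorphic_vec_on (unit_ball :: 'n cvec set) \<Longrightarrow>
    ball_integral lborel (\<lambda>w. defect w powr \<gamma> * cmod ((radial_deriv ^^ (k - N)) g w) powr p)
    \<le> ennreal C2 * ball_integral lborel (\<lambda>w. defect w powr \<beta> * cmod (g w) powr p)"
    using iterated_radial_deriv_weighted_Lp[OF p(1), where 'n='n and \<beta>=\<beta> and j="k - N"] unfolding \<beta>\<gamma>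
      by blast
  obtain c where c: "c > 0" "\<And>f. f holomorphic_vec_on (unit_ball :: 'n cvec set) \<Longrightarrow>
    bergman_norm p \<alpha> f = ennreal (cmod (f 0)) + ennreal_powr (ennreal c * bergman_energy p \<alpha> f) (1 / p)"
    using bergman_norm_eq_energy[OF p(1), of \<alpha>, where 'n='n] by blast
  define C3 where "C3 = C1 * (C2 / c) powr (q / p)"
  have C3: "C3 > 0" using C1 C2 c by (simp add: C3_def)
  show ?thesis
  proof (intro exI[of _ C3] conjI ballI)
    show "C3 > 0" by (rule C3)
    fix f :: "'n cvec \<Rightarrow> complex" assume "f \<in> bergman_space p \<alpha>"
    hence f: "f holomorphic_vec_on unit_ball" by (simp add: bergman_space_def)
    show "ball_integral \<nu> (\<lambda>w. cmod ((radial_deriv ^^ k) f w) powr q)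
      \<le> ennreal C3 * ennreal_powr (bergman_norm p \<alpha> f) q"
    proof (cases "bergman_energy p \<alpha> f = \<infinity>")
      case True
      hence "bergman_norm p \<alpha> f = \<infinity>" using c by (simp add: c(2)[OF f] ennreal_powr_def ennreal_mult_top)
      thus ?thesis using C3 by (simp add: ennreal_powr_def ennreal_mult_top)
    next
      case False
      then obtain x where x: "bergman_energy p \<alpha> f = ennreal x" "x \<ge> 0"
        by (cases "bergman_energy p \<alpha> f") auto
      let ?F = "(radial_deriv ^^ k) f"
      have split: "(radial_deriv ^^ (k - N)) ((radial_deriv ^^ N) f) = ?F"
      proof -
        have "(radial_deriv ^^ (k - N + N)) f = (radial_deriv ^^ (k - N)) ((radial_deriv ^^ N) f)"
          by (simp only: funpow_add o_apply)
        thus ?thesis using Nk by simp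
      qed
      have "ball_integral lborel (\<lambda>w. defect w powr \<gamma> * cmod (?F w) powr p)
        \<le> ennreal C2 * bergman_energy p \<alpha> f"
        using C2(2)[OF holomorphic_vec_iterated_radial_deriv[OF f open_ball, of N]]
        unfolding split bergman_energy_def N_def[symmetric] \<beta>_def .
      also have "\<dots> = ennreal (C2 * x)" using C2 x by (simp add: ennreal_mult)
      finally have le: "ball_integral lborel (\<lambda>w. defect w powr \<gamma> * cmod (?F w) powr p)
        \<le> ennreal (C2 * x)" .
      have "C2 * x \<ge> 0" using C2 x by simp
      from C1(2)[OF holomorphic_vec_iterated_radial_deriv[OF f open_ball] this le]
      have "ball_integral \<nu> (\<lambda>w. cmod (?F w) powr q) \<le> ennreal (C1 * (C2 * x) powr (q / p))" .
      also have "C1 * (C2 * x) powr (q / p) = C3 * ((c * x) powr (1 / p)) powr q"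
      proof -
        have "C2 * x = (C2 / c) * (c * x)" using c by simp
        hence "(C2 * x) powr (q / p) = (C2 / c) powr (q / p) * (c * x) powr (q / p)"
          by (simp only: powr_mult)
        moreover have "((c * x) powr (1 / p)) powr q = (c * x) powr (q / p)" by (simp add: powr_powr)
        ultimately show ?thesis by (simp add: C3_def)
      qed
      also have "ennreal (C3 * ((c * x) powr (1 / p)) powr q)
        \<le> ennreal (C3 * (cmod (f 0) + (c * x) powr (1 / p)) powr q)"
        using C3 p by (intro ennreal_leI mult_left_mono powr_mono2) auto
      also have "\<dots> = ennreal C3 * ennreal_powr (bergman_norm p \<alpha> f) q"
      proof -
        have "bergman_norm p \<alpha> f = ennreal (cmod (f 0) + (c * x) powr (1 / p))"
          using c x by (simp add: c(2)[OF f] ennreal_mult[symmetric] ennreal_powr_ennreal)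
        hence "ennreal_powr (bergman_norm p \<alpha> f) q
          = ennreal ((cmod (f 0) + (c * x) powr (1 / p)) powr q)"
          by (simp only: ennreal_powr_ennreal add_nonneg_nonneg norm_ge_zero powr_ge_zero)
        thus ?thesis using C3 by (simp only: ennreal_mult' less_imp_le)
      qed
      finally show ?thesis .
    qed
  qed
qed

theorem theorem50:
  fixes p q \<alpha> :: real and k :: nat and \<mu> :: "('n::finite) cvec measure"
  assumes "0 < p" and "p \<le> q"
    and "sets \<mu> = sets (restrict_space borel unit_ball)"
    and "0 < k \<Longrightarrow> \<exists>\<epsilon>. 0 < \<epsilon> \<and> \<epsilon> < 1 \<and> emeasure \<mu> (ball 0 \<epsilon>) < \<infinity>"
    and "\<alpha> + real k * p > -1"
  shows
    "let \<tau> = (real CARD('n) + 1 + \<alpha> + real k * p) * q / p;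
         a = (\<exists>C>0. \<forall>f\<in>bergman_space p \<alpha>.
               (\<integral>\<^sup>+ w. ennreal (cmod ((radial_deriv ^^ k) f w) powr q) \<partial>\<mu>)
                 \<le> ennreal C * ennreal_powr (bergman_norm p \<alpha> f) q);
         b = (\<lambda>s. \<exists>C>0. \<forall>z\<in>unit_ball.
               (\<integral>\<^sup>+ w. ennreal ((1 - (norm z)\<^sup>2) powr s / cmod (1 - herm z w) powr (s + \<tau>)) \<partial>\<mu>)
                 \<le> ennreal C);
         c = (\<exists>C>0. \<forall>r>0. \<forall>\<zeta>\<in>sphere 0 1.
               emeasure \<mu> (carleson_tube \<zeta> r) \<le> ennreal (C * r powr \<tau>));
         d = (\<lambda>R. \<exists>C>0. \<forall>a\<in>unit_ball.
               emeasure \<mu> (bergman_ball a R) \<le> ennreal (C * (1 - (norm a)\<^sup>2) powr \<tau>))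
     in (a \<longleftrightarrow> (\<forall>s>0. b s)) \<and> (a \<longleftrightarrow> (\<exists>s>0. b s)) \<and> (a \<longleftrightarrow> c) \<and>
        (a \<longleftrightarrow> (\<forall>R>0. d R)) \<and> (a \<longleftrightarrow> (\<exists>R>0. d R))"
proof -
  define \<tau> where "\<tau> = (real CARD('n) + 1 + \<alpha> + real k * p) * q / p"
  have q: "q > 0" using assms by simp
  have \<tau>: "\<tau> > 0" using assms q by (simp add: \<tau>_def add_nonneg_pos)
  have id: "(\<lambda>x. x) \<in> measurable \<mu> borel"
    using assms(3) by (subst measurable_cong_sets[OF assms(3) refl])
      (rule measurable_restrict_space1, simp)
  have sp: "space \<mu> = unit_ball" using sets_eq_imp_space_eq[OF assms(3)]
    by (simp add: space_restrict_space)
  \<comment> \<open>Extending \<open>\<mu>\<close> by zero gives a Borel measure on the whole space, to which the previous results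
  apply.\<close>
  define \<nu> :: "'n cvec measure" where "\<nu> = distr \<mu> borel (\<lambda>x. x)"
  have sets: "sets \<nu> = sets borel" by (simp add: \<nu>_def)
  have em: "emeasure \<nu> A = emeasure \<mu> A" if "A \<in> sets borel" "A \<subseteq> unit_ball" for A
    using that id by (simp add: \<nu>_def emeasure_distr sp Int_absorb2)
  have null: "emeasure \<nu> (- unit_ball) = 0"
  proof -
    have "(\<lambda>x. x) -` (- unit_ball) \<inter> space \<mu> = {}" by (auto simp: sp)
    thus ?thesis unfolding \<nu>_def using id by (subst emeasure_distr) auto
  qed
  have int: "(\<integral>\<^sup>+w. g w \<partial>\<mu>) = (\<integral>\<^sup>+w. g w * indicator unit_ball w \<partial>\<nu>)"
    if "(\<lambda>w. g w * indicator unit_ball w) \<in> borel_measurable borel" for g :: "'n cvec \<Rightarrow> ennreal"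
  proof -
    have "(\<integral>\<^sup>+w. g w * indicator unit_ball w \<partial>\<nu>) = (\<integral>\<^sup>+w. g w * indicator unit_ball w \<partial>\<mu>)"
      unfolding \<nu>_def using that id by (subst nn_integral_distr) auto
    also have "\<dots> = (\<integral>\<^sup>+w. g w \<partial>\<mu>)" by (intro nn_integral_cong) (simp add: sp)
    finally show ?thesis ..
  qed
  define a where "a = (\<exists>C>0. \<forall>f\<in>bergman_space p \<alpha>.
      (\<integral>\<^sup>+ w. ennreal (cmod ((radial_deriv ^^ k) f w) powr q) \<partial>\<mu>)
        \<le> ennreal C * ennreal_powr (bergman_norm p \<alpha> f) q)"
  define b where "b = (\<lambda>s. \<exists>C>0. \<forall>z\<in>(unit_ball :: 'n cvec set).
      (\<integral>\<^sup>+ w. ennreal ((1 - (norm z)\<^sup>2) powr s / cmod (1 - herm z w) powr (s + \<tau>)) \<partial>\<mu>) \<le> ennreal C)"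
  define c where "c = (\<exists>C>0. \<forall>r>0. \<forall>\<zeta>\<in>sphere 0 1. emeasure \<mu> (carleson_tube \<zeta> r)
    \<le> ennreal (C * r powr \<tau>))"
  define d where "d = (\<lambda>R. \<exists>C>0. \<forall>a\<in>unit_ball. emeasure \<mu> (bergman_ball a R)
    \<le> ennreal (C * (1 - (norm a)\<^sup>2) powr \<tau>))"
  have a_iff: "a \<longleftrightarrow> (\<exists>C>0. \<forall>f\<in>bergman_space p \<alpha>.
      ball_integral \<nu> (\<lambda>w. cmod ((radial_deriv ^^ k) f w) powr q)
        \<le> ennreal C * ennreal_powr (bergman_norm p \<alpha> f) q)"
  proof -
    have "(\<integral>\<^sup>+ w. ennreal (cmod ((radial_deriv ^^ k) f w) powr q) \<partial>\<mu>) =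
       ball_integral \<nu> (\<lambda>w. cmod ((radial_deriv ^^ k) f w) powr q)" if "f \<in> bergman_space p \<alpha>"
         for f :: "'n cvec \<Rightarrow> complex"
      using that by (intro int borel_measurable_cmod_powr_indicator[OF _ q]
        holomorphic_vec_iterated_radial_deriv)
                    (auto simp: bergman_space_def)
    thus ?thesis unfolding a_def by simp
  qed
  have b_iff: "b s \<longleftrightarrow> (\<exists>C>0. \<forall>z\<in>(unit_ball :: 'n cvec set).
      ball_integral \<nu> (\<lambda>w. defect z powr s / cmod (1 - herm z w) powr (s + \<tau>)) \<le> ennreal C)" for s
  proof -
    have [measurable]: "(unit_ball :: 'n cvec set) \<in> sets borel" by simp
    have "(\<integral>\<^sup>+ w. ennreal (defect z powr s / cmod (1 - herm z w) powr (s + \<tau>)) \<partial>\<mu>) =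
      ball_integral \<nu> (\<lambda>w. defect z powr s / cmod (1 - herm z w) powr (s + \<tau>))" for z
      by (rule int) measurable
    thus ?thesis unfolding b_def defect_def by simp
  qed
  have c_iff: "c \<longleftrightarrow> (\<exists>C>0. \<forall>r>0. \<forall>\<zeta>\<in>sphere 0 1. emeasure \<nu> (carleson_tube \<zeta> r) \<le> ennreal (C * r powr \<tau>))"
  proof -
    have "emeasure \<nu> (carleson_tube \<zeta> r) = emeasure \<mu> (carleson_tube \<zeta> r)" for \<zeta> r
      by (rule em) (auto simp: carleson_tube_def[of \<zeta> r])
    thus ?thesis unfolding c_def by simp
  qed
  have d_iff: "d R \<longleftrightarrow> (\<exists>C>0. \<forall>a\<in>unit_ball. emeasure \<nu> (bergman_ball a R)
    \<le> ennreal (C * defect a powr \<tau>))" for R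
  proof -
    have "emeasure \<nu> (bergman_ball a R) = emeasure \<mu> (bergman_ball a R)" if "a \<in> unit_ball" for a
      by (rule em[OF borel_open[OF open_bergman_ball[OF that]]]) (auto simp: bergman_ball_def[of a R])
    thus ?thesis unfolding d_def defect_def by simp
  qed
  have ac: c if a
  proof -
    obtain C where C: "C > 0" "\<And>f. f \<in> bergman_space p \<alpha> \<Longrightarrow>
      ball_integral \<nu> (\<lambda>w. cmod ((radial_deriv ^^ k) f w) powr q)
        \<le> ennreal C * ennreal_powr (bergman_norm p \<alpha> f) q"
      using \<open>a\<close> unfolding a_iff by blast
    have near0: "\<exists>\<epsilon>. 0 < \<epsilon> \<and> emeasure \<nu> (ball 0 \<epsilon>) < \<infinity>" if k0: "0 < k"
    proof -
      obtain \<epsilon> where e: "0 < \<epsilon>" "\<epsilon> < 1" "emeasure \<mu> (ball 0 \<epsilon>) < \<infinity>" using assms(4)[OF k0] by blast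
      hence "emeasure \<nu> (ball 0 \<epsilon>) = emeasure \<mu> (ball 0 \<epsilon>)" by (intro em) auto
      thus ?thesis using e by auto
    qed
    show ?thesis unfolding c_iff
      by (rule embedding_imp_carleson[OF sets assms(1) q near0 \<tau>_def \<tau> C])
  qed
  have cb: "b s" if c "s > 0" for s
  proof -
    obtain C where C: "C > 0" "\<And>r \<zeta>. r > 0 \<Longrightarrow> \<zeta> \<in> sphere 0 1 \<Longrightarrow> emeasure \<nu> (carleson_tube \<zeta> r)
      \<le> ennreal (C * r powr \<tau>)"
      using \<open>c\<close> unfolding c_iff by blast
    show ?thesis unfolding b_iff by (rule carleson_imp_berezin[OF sets \<open>s > 0\<close> \<tau> C])
  qed
  have bc: c if "b s" "s > 0" for s
  proof -
    obtain C where C: "C > 0" "\<And>z. z \<in> unit_ball \<Longrightarrow>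
      ball_integral \<nu> (\<lambda>w. defect z powr s / cmod (1 - herm z w) powr (s + \<tau>)) \<le> ennreal C"
      using \<open>b s\<close> unfolding b_iff by blast
    show ?thesis unfolding c_iff
      using berezin_imp_carleson[OF sets \<open>s > 0\<close> \<tau> C] C(1)
      by (intro exI[of _ "C * 2 powr (s + \<tau>)"]) auto
  qed
  have cd: "d R" if c for R
  proof -
    obtain C where C: "C > 0" "\<And>r \<zeta>. r > 0 \<Longrightarrow> \<zeta> \<in> sphere 0 1 \<Longrightarrow> emeasure \<nu> (carleson_tube \<zeta> r)
      \<le> ennreal (C * r powr \<tau>)"
      using \<open>c\<close> unfolding c_iff by blast
    show ?thesis unfolding d_iff by (rule carleson_imp_bergman_ball[OF sets C])
  qed
  have da: a if "d R" "R > 0" for R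
  proof -
    obtain C where C: "C > 0" "\<And>a. a \<in> unit_ball \<Longrightarrow> emeasure \<nu> (bergman_ball a R)
      \<le> ennreal (C * defect a powr \<tau>)"
      using \<open>d R\<close> unfolding d_iff by blast
    show ?thesis unfolding a_iff
      by (rule bergman_ball_imp_embedding[OF sets null assms(1,2,5) \<tau>_def \<open>R > 0\<close> C])
  qed
  have "(a \<longleftrightarrow> (\<forall>s>0. b s)) \<and> (a \<longleftrightarrow> (\<exists>s>0. b s)) \<and> (a \<longleftrightarrow> c) \<and> (a \<longleftrightarrow> (\<forall>R>0. d R)) \<and> (a \<longleftrightarrow> (\<exists>R>0. d R))"
    using ac cb bc cd da zero_less_one by metis
  thus ?thesis unfolding Let_def a_def b_def c_def d_def \<tau>_def .
qed

end
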